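(* Let $n\ge1$ and let $\sigma,\tau\in\,]0,1[$ be given real numbers, and set $$\nu(\sigma,\tau):=\frac{1}{\log\Bigl(\frac{1+\sigma\tau}{\sigma+\tau}\Bigr)}.$$ Then for any real number $\nu>\nu(\sigma,\tau)$ there exist constants $C=C(\sigma,\tau,\nu)>0$ and $0<\eta_0<1$ such that for any $R>0$, any plurisubharmonic function $V$ on the Euclidean ball $\mathbb B_R\subset\mathbb C^n$, any $\alpha\in\,]0,2]$ and any $\eta\in\,]0,\eta_0[$, the lower bound $$V(z)\ \ge\ \sup_{\mathbb B_{\sigma R}}V+\nu\,\log(\eta/C)\,\Bigl(\sup_{\mathbb B_R}V-\sup_{\mathbb B_{\sigma R}}V\Bigr)$$ holds for all $z\in\mathbb B_{\tau R}$ outside the union of a countable family of Euclidean balls of radii $(r_j)$ not exceeding $\eta R$ and satisfying $$\sum_j r_j^{2n-2+\alpha}<9^{n-1}(Re)^{2n-2+\alpha}\,\eta^{\alpha}/\alpha.$$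
   Context: $\mathbb B_r$ denotes the Euclidean ball of radius $r$ centered at the origin of $\mathbb C^n$. Plurisubharmonic functions are assumed $\not\equiv-\infty$. $e$ is the base of the natural logarithm. *)

theory Defs
  imports "HOL-Analysis.Analysis"
begin

text \<open>The dimension has to be quantified inside the theorem (after a constant that does not depend
  on it), so \<open>\<complex>\<^sup>n\<close> is the set of sequences that vanish from index \<open>n\<close> on, rather than a type.\<close>

definition Cn :: "nat \<Rightarrow> (nat \<Rightarrow> complex) set" where
  "Cn n = {z. \<forall>i\<ge>n. z i = 0}"

definition cnorm :: "nat \<Rightarrow> (nat \<Rightarrow> complex) \<Rightarrow> real" where
  "cnorm n z = L2_set (\<lambda>i. cmod (z i)) {..<n}"

definition Cball :: "nat \<Rightarrow> (nat \<Rightarrow> complex) \<Rightarrow> real \<Rightarrow> (nat \<Rightarrow> complex) set" where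
  "Cball n a r = {z \<in> Cn n. cnorm n (\<lambda>i. z i - a i) < r}"

abbreviation Cball0 :: "nat \<Rightarrow> real \<Rightarrow> (nat \<Rightarrow> complex) set" where
  "Cball0 n r \<equiv> Cball n (\<lambda>_. 0) r"

definition usc_on :: "nat \<Rightarrow> (nat \<Rightarrow> complex) set \<Rightarrow> ((nat \<Rightarrow> complex) \<Rightarrow> ereal) \<Rightarrow> bool" where
  "usc_on n \<Omega> V \<longleftrightarrow>
    (\<forall>a\<in>\<Omega>. \<forall>c. V a < c \<longrightarrow> (\<exists>d>0. \<forall>z\<in>\<Omega>. cnorm n (\<lambda>i. z i - a i) < d \<longrightarrow> V z < c))"

text \<open>The mean value over \<open>[0, 2\<pi>]\<close> of a function with values in \<open>[-\<infinity>, \<infinity>]\<close>, as the difference of the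
  integrals of its positive and negative parts (\<open>e2ennreal\<close> sends negative numbers to \<open>0\<close>). It is only
  meaningful when one of the two is finite; below, the function is upper semicontinuous and
  \<open>< \<infinity>\<close> along a circle, hence bounded above, so the first one is.\<close>

definition circle_mean :: "(real \<Rightarrow> ereal) \<Rightarrow> ereal" where
  "circle_mean f =
    (enn2ereal (\<integral>\<^sup>+t\<in>{0..2*pi}. e2ennreal (f t) \<partial>lborel)
      - enn2ereal (\<integral>\<^sup>+t\<in>{0..2*pi}. e2ennreal (- f t) \<partial>lborel)) / ereal (2 * pi)"

text \<open>Plurisubharmonic functions on a connected open set \<open>\<Omega>\<close> of \<open>\<complex>\<^sup>n\<close>: upper semicontinuous with values
  in \<open>[-\<infinity>, \<infinity>)\<close>, satisfying the submean inequality on every closed disc contained in \<open>\<Omega>\<close> of every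
  complex line, and not identically \<open>-\<infinity>\<close>. Values outside \<open>\<Omega>\<close> are irrelevant.\<close>

definition psh_on :: "nat \<Rightarrow> (nat \<Rightarrow> complex) set \<Rightarrow> ((nat \<Rightarrow> complex) \<Rightarrow> ereal) \<Rightarrow> bool" where
  "psh_on n \<Omega> V \<longleftrightarrow>
    (\<forall>z\<in>\<Omega>. V z < \<infinity>) \<and>
    usc_on n \<Omega> V \<and>
    (\<forall>a\<in>Cn n. \<forall>w\<in>Cn n. (\<forall>\<zeta>. cmod \<zeta> \<le> 1 \<longrightarrow> (\<lambda>i. a i + \<zeta> * w i) \<in> \<Omega>) \<longrightarrow>
      V a \<le> circle_mean (\<lambda>t. V (\<lambda>i. a i + cis t * w i))) \<and>
    (\<exists>z\<in>\<Omega>. V z \<noteq> -\<infinity>)"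

definition nu :: "real \<Rightarrow> real \<Rightarrow> real" where
  "nu \<sigma> \<tau> = 1 / ln ((1 + \<sigma> * \<tau>) / (\<sigma> + \<tau>))"

end

theory Submission
  imports Defs "HOL-Complex_Analysis.Complex_Analysis"
begin

text \<open>
  After a dilation the ball is the unit ball, and \<open>W = M - V\<close>, with \<open>M\<close> the supremum of \<open>V\<close>, is a non-negative
  superharmonic function with a value of size \<open>m\<close>, the difference of the two suprema, in the
  ball of radius \<open>\<sigma>\<close>. The claim is an upper bound \<open>W \<le> m \<nu> ln (1/\<eta>)\<close> in the ball of radius \<open>\<tau>\<close> outside small balls.
  Two facts carry the proof.

  First, \<open>W\<close> has at most logarithmic growth in the mean. Along the complex line that joins a point \<open>z\<close> of the
  ball of radius \<open>\<tau>\<close> to a reference point in the ball of radius \<open>\<sigma>\<close>, comparison with the Green function of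
  the slice with pole \<open>z\<close> shows that the infimum of \<open>W\<close> over the ball of radius \<open>t\<close> around \<open>z\<close> is at most
  \<open>m nu \<sigma> \<tau> (ln (1/t) + const)\<close>: the number \<open>1 / nu \<sigma> \<tau>\<close> is the least possible value of the Green function at
  the reference point (\<open>superh_log_growth\<close>). The volume means of \<open>W\<close> around \<open>z\<close> inherit this bound, with
  a factor as close to 1 as desired (\<open>superh_mean_bound\<close>).

  Second, \<open>W z\<close> exceeds such a mean at radius \<open>s\<close> by a bounded amount unless the Riesz mass of \<open>W\<close> in some
  ball of radius \<open>\<rho> \<le> s\<close> around \<open>z\<close> is more than a multiple of \<open>\<alpha> \<rho>\<^bsup>2n-2+\<alpha>\<^esup> / s\<^sup>\<alpha>\<close> (\<open>superh_pointwise\<close>). The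
  total mass is bounded (\<open>superh_packing\<close>), so by Vitali's selection the bad centres are covered by balls with
  the required sum of powers (\<open>superh_upper_bound_outside_balls\<close>). Masses are handled without a Riesz
  measure: the Laplacian of \<open>W\<close> is tested against the functions \<open>(1 - q \<bar>x - z\<bar>\<^sup>2)\<^sub>+\<^sup>3\<close>, for which it is both the
  derivative of a volume mean with respect to the radius and, by means over small circles in the coordinate directions, a
  quantity with a sign (\<open>superh_laplacian_nonneg\<close>).

  Apart from a factor close to 1, the constants that depend on the dimension enter additively next to
  \<open>ln (1/\<eta>)\<close>. As \<open>\<nu> > nu \<sigma> \<tau>\<close>, they are absorbed by a choice of \<open>\<eta>\<^sub>0\<close> that depends on \<open>n\<close>; therefore \<open>C = 1\<close>
  works in all dimensions.
\<close>

section \<open>The norm of \<open>\<complex>\<^sup>n\<close>\<close>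

definition trunc :: "nat \<Rightarrow> (nat \<Rightarrow> complex) \<Rightarrow> nat \<Rightarrow> complex" where
  "trunc n x = (\<lambda>i. if i < n then x i else 0)"

abbreviation cdist :: "nat \<Rightarrow> (nat \<Rightarrow> complex) \<Rightarrow> (nat \<Rightarrow> complex) \<Rightarrow> real" where
  "cdist n x y \<equiv> cnorm n (\<lambda>i. x i - y i)"

lemma trunc_in_Cn [simp]: "trunc n x \<in> Cn n"
  by (auto simp: trunc_def Cn_def)

lemma trunc_Cn [simp]: "x \<in> Cn n \<Longrightarrow> trunc n x = x"
  by (auto simp: trunc_def Cn_def fun_eq_iff)

lemma zero_in_Cn [simp]: "(\<lambda>_. 0) \<in> Cn n"
  by (simp add: Cn_def)

lemma Cn_scale: "x \<in> Cn n \<Longrightarrow> (\<lambda>i. c * x i) \<in> Cn n"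
  by (auto simp: Cn_def)

lemma cnorm_cong: "(\<And>i. i < n \<Longrightarrow> cmod (x i) = cmod (y i)) \<Longrightarrow> cnorm n x = cnorm n y"
  unfolding cnorm_def by (rule L2_set_cong) auto

lemma cnorm_nonneg [simp]: "0 \<le> cnorm n x"
  by (simp add: cnorm_def)

lemma cnorm_zero [simp]: "cnorm n (\<lambda>_. 0) = 0"
  by (simp add: cnorm_def L2_set_def)

lemma cnorm_power2: "(cnorm n x)\<^sup>2 = (\<Sum>i<n. (cmod (x i))\<^sup>2)"
  by (simp add: cnorm_def L2_set_def sum_nonneg)

lemma cnorm_triangle: "cnorm n (\<lambda>i. x i + y i) \<le> cnorm n x + cnorm n y"
proof -
  have "cnorm n (\<lambda>i. x i + y i) \<le> L2_set (\<lambda>i. cmod (x i) + cmod (y i)) {..<n}"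
    unfolding cnorm_def by (rule L2_set_mono) (auto simp: norm_triangle_ineq)
  also have "\<dots> \<le> cnorm n x + cnorm n y"
    unfolding cnorm_def by (rule L2_set_triangle_ineq)
  finally show ?thesis .
qed

lemma cnorm_scale: "cnorm n (\<lambda>i. c * x i) = cmod c * cnorm n x"
  by (simp add: cnorm_def norm_mult L2_set_right_distrib)

lemma cdist_commute: "cdist n x y = cdist n y x"
  by (rule cnorm_cong) (simp add: norm_minus_commute)

lemma cdist_triangle: "cdist n x z \<le> cdist n x y + cdist n y z"
  using cnorm_triangle[of n "\<lambda>i. x i - y i" "\<lambda>i. y i - z i"] by simp

lemma cnorm_le_cdist: "cnorm n x \<le> cdist n x y + cnorm n y"
  using cnorm_triangle[of n "\<lambda>i. x i - y i" "y"] by simp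

lemma cdist_le_cnorm: "cdist n x y \<le> cnorm n x + cnorm n y"
  using cdist_triangle[of n x y "\<lambda>_. 0"] cdist_commute[of n y "\<lambda>_. 0"]
    cdist_triangle[of n x "y" "\<lambda>_. 0"]
  using cnorm_triangle[of n x "\<lambda>i. -1 * y i"] cnorm_scale[of n "-1" y] by simp

lemma cnorm_trunc [simp]: "cnorm n (trunc n x) = cnorm n x"
  by (rule cnorm_cong) (simp add: trunc_def)

lemma cmod_le_cnorm: "i < n \<Longrightarrow> cmod (x i) \<le> cnorm n x"
  unfolding cnorm_def by (rule member_le_L2_set) auto

lemma continuous_on_cnorm [continuous_intros]:
  assumes "\<And>i. continuous_on S (\<lambda>x. f x i)"
  shows "continuous_on S (\<lambda>x. cnorm n (f x))"
  unfolding cnorm_def L2_set_def by (intro continuous_intros assms)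

lemma continuous_on_affine:
  "continuous_on S (\<lambda>x::nat \<Rightarrow> complex. (\<lambda>i. c * x i + a i))"
  by (rule continuous_on_coordinatewise_then_product)
    (intro continuous_intros continuous_on_subset[OF continuous_on_product_coordinates subset_UNIV])

section \<open>Lebesgue measure on \<open>\<complex>\<^sup>n\<close>\<close>

lemma distr_lborel_Complex:
  "distr (lborel \<Otimes>\<^sub>M lborel) borel (\<lambda>(x, y). Complex x y) = lborel"
proof (rule lborel_eqI[symmetric])
  have meas: "(\<lambda>(x, y). Complex x y) \<in> borel_measurable (lborel \<Otimes>\<^sub>M lborel :: (real \<times> real) measure)"
  proof -
    have "(\<lambda>p. Complex (fst p) (snd p)) \<in> borel_measurable (borel :: (real \<times> real) measure)"
      by (intro borel_measurable_continuous_onI) (auto intro!: continuous_intros continuous_on_Complex)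
    then show ?thesis by (simp add: case_prod_beta' lborel_prod)
  qed
  fix l u :: complex
  assume lu: "\<And>b. b \<in> Basis \<Longrightarrow> l \<bullet> b \<le> u \<bullet> b"
  then have "Re l \<le> Re u" "Im l \<le> Im u"
    using lu[of 1] lu[of \<i>] by (auto simp: Basis_complex_def)
  have pre: "(\<lambda>(x, y). Complex x y) -` box l u \<inter> space (lborel \<Otimes>\<^sub>M lborel)
      = {Re l<..<Re u} \<times> {Im l<..<Im u}"
    by (auto simp: box_def Basis_complex_def space_pair_measure)
  show "emeasure (distr (lborel \<Otimes>\<^sub>M lborel) borel (\<lambda>(x, y). Complex x y)) (box l u)
      = (\<Prod>b\<in>Basis. (u - l) \<bullet> b)"
    using \<open>Re l \<le> Re u\<close> \<open>Im l \<le> Im u\<close>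
    by (subst emeasure_distr[OF meas]) (auto simp: pre lborel.emeasure_pair_measure_Times
        Basis_complex_def ennreal_mult[symmetric])
qed simp

lemma borel_measurable_Complex [measurable]:
  "f \<in> borel_measurable M \<Longrightarrow> g \<in> borel_measurable M \<Longrightarrow> (\<lambda>x. Complex (f x) (g x)) \<in> borel_measurable M"
  by (rule borel_measurable_continuous_Pair) (auto intro!: continuous_intros continuous_on_Complex)

lemma nn_integral_lborel_Complex:
  assumes [measurable]: "f \<in> borel_measurable borel"
  shows "(\<integral>\<^sup>+z. f z \<partial>lborel) = (\<integral>\<^sup>+x. \<integral>\<^sup>+y. f (Complex x y) \<partial>lborel \<partial>lborel)"
proof -
  have "(\<integral>\<^sup>+z. f z \<partial>lborel) = (\<integral>\<^sup>+p. f (case p of (x, y) \<Rightarrow> Complex x y) \<partial>(lborel \<Otimes>\<^sub>M lborel))"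
    by (subst distr_lborel_Complex[symmetric], subst nn_integral_distr) auto
  also have "\<dots> = (\<integral>\<^sup>+x. \<integral>\<^sup>+y. f (Complex x y) \<partial>lborel \<partial>lborel)"
    by (subst lborel.nn_integral_fst[symmetric]) auto
  finally show ?thesis .
qed

lemma nn_integral_lborel_Complex':
  assumes [measurable]: "f \<in> borel_measurable borel"
  shows "(\<integral>\<^sup>+z. f z \<partial>lborel) = (\<integral>\<^sup>+y. \<integral>\<^sup>+x. f (Complex x y) \<partial>lborel \<partial>lborel)"
  unfolding nn_integral_lborel_Complex[OF assms]
  by (rule lborel_pair.Fubini') measurable

text \<open>Multiplication by \<open>p + \<i> q\<close> with \<open>p \<noteq> 0\<close> is the composition of two substitutions that change one
  real coordinate each, with Jacobians \<open>\<bar>p\<bar>\<close> and \<open>(p\<^sup>2 + q\<^sup>2) / \<bar>p\<bar>\<close>; Tonelli's theorem separates them.\<close>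

lemma nn_integral_complex_mult:
  assumes [measurable]: "f \<in> borel_measurable borel" and "c \<noteq> (0::complex)"
  shows "(\<integral>\<^sup>+z. f z \<partial>lborel) = ennreal ((cmod c)\<^sup>2) * (\<integral>\<^sup>+z. f (c * z) \<partial>lborel)"
proof -
  define p q where "p = Re c" and "q = Im c"
  have c: "c = Complex p q" by (simp add: p_def q_def)
  have n: "(cmod c)\<^sup>2 = p\<^sup>2 + q\<^sup>2" by (simp add: p_def q_def cmod_power2)
  have pos: "p\<^sup>2 + q\<^sup>2 > 0" using assms(2) c by (auto simp: sum_power2_gt_zero_iff complex_eq_iff)
  have [measurable]: "(\<lambda>z. f (c * z)) \<in> borel_measurable borel" by measurable
  have mul: "c * Complex x y = Complex (p * x - q * y) (q * x + p * y)" for x y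
    by (simp add: c complex_eq_iff)
  show ?thesis
  proof (cases "p = 0")
    case False
    have 1: "(\<integral>\<^sup>+x. f (Complex (p * x - q * y) (q * x + p * y)) \<partial>lborel)
        = ennreal (1 / \<bar>p\<bar>) * (\<integral>\<^sup>+x. f (Complex x (q / p * x + (q\<^sup>2 + p\<^sup>2) / p * y)) \<partial>lborel)" for y
    proof -
      have "(\<integral>\<^sup>+x. f (Complex (p * x - q * y) (q * x + p * y)) \<partial>lborel)
         = ennreal \<bar>1 / p\<bar> * (\<integral>\<^sup>+x. f (Complex (p * (q * y / p + 1 / p * x) - q * y) (q * (q * y / p + 1 / p * x) + p * y)) \<partial>lborel)"
        using False by (intro nn_integral_real_affine) auto
      also have "(\<lambda>x. Complex (p * (q * y / p + 1 / p * x) - q * y) (q * (q * y / p + 1 / p * x) + p * y))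
          = (\<lambda>x. Complex x (q / p * x + (q\<^sup>2 + p\<^sup>2) / p * y))"
        using False by (auto simp: fun_eq_iff field_simps power2_eq_square)
      finally show ?thesis by simp
    qed
    have 2: "(\<integral>\<^sup>+y. f (Complex x y) \<partial>lborel)
        = ennreal ((q\<^sup>2 + p\<^sup>2) / \<bar>p\<bar>) * (\<integral>\<^sup>+y. f (Complex x (q / p * x + (q\<^sup>2 + p\<^sup>2) / p * y)) \<partial>lborel)" for x
      using pos False nn_integral_real_affine[of "\<lambda>y. f (Complex x y)" "(q\<^sup>2 + p\<^sup>2) / p" "q / p * x"]
      by (simp add: add.commute)
    have "(\<integral>\<^sup>+z. f (c * z) \<partial>lborel)
       = (\<integral>\<^sup>+y. \<integral>\<^sup>+x. f (Complex (p * x - q * y) (q * x + p * y)) \<partial>lborel \<partial>lborel)"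
      by (subst nn_integral_lborel_Complex') (auto simp: mul)
    also have "\<dots> = ennreal (1 / \<bar>p\<bar>) *
       (\<integral>\<^sup>+y. \<integral>\<^sup>+x. f (Complex x (q / p * x + (q\<^sup>2 + p\<^sup>2) / p * y)) \<partial>lborel \<partial>lborel)"
      unfolding 1 by (subst nn_integral_cmult) auto
    also have "(\<integral>\<^sup>+y. \<integral>\<^sup>+x. f (Complex x (q / p * x + (q\<^sup>2 + p\<^sup>2) / p * y)) \<partial>lborel \<partial>lborel)
       = (\<integral>\<^sup>+x. \<integral>\<^sup>+y. f (Complex x (q / p * x + (q\<^sup>2 + p\<^sup>2) / p * y)) \<partial>lborel \<partial>lborel)"
      by (rule lborel_pair.Fubini') measurable
    finally have *: "(\<integral>\<^sup>+z. f (c * z) \<partial>lborel) = ennreal (1 / \<bar>p\<bar>) *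
      (\<integral>\<^sup>+x. \<integral>\<^sup>+y. f (Complex x (q / p * x + (q\<^sup>2 + p\<^sup>2) / p * y)) \<partial>lborel \<partial>lborel)" .
    have "(\<integral>\<^sup>+z. f z \<partial>lborel) = ennreal ((q\<^sup>2 + p\<^sup>2) / \<bar>p\<bar>) *
      (\<integral>\<^sup>+x. \<integral>\<^sup>+y. f (Complex x (q / p * x + (q\<^sup>2 + p\<^sup>2) / p * y)) \<partial>lborel \<partial>lborel)"
      by (subst nn_integral_lborel_Complex, simp, subst 2, subst nn_integral_cmult) auto
    also have "ennreal ((q\<^sup>2 + p\<^sup>2) / \<bar>p\<bar>) = ennreal ((cmod c)\<^sup>2) * ennreal (1 / \<bar>p\<bar>)"
      unfolding n by (subst ennreal_mult[symmetric]) (use pos in \<open>auto simp: add.commute\<close>)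
    finally show ?thesis unfolding * by (simp add: mult.assoc)
  next
    case True
    then have q: "q \<noteq> 0" using pos by auto
    have 1: "(\<integral>\<^sup>+y. f (Complex (- q * y) (q * x)) \<partial>lborel)
        = ennreal (1 / \<bar>q\<bar>) * (\<integral>\<^sup>+y. f (Complex y (q * x)) \<partial>lborel)" for x
      using q nn_integral_real_affine[of "\<lambda>y. f (Complex (- q * y) (q * x))" "- 1 / q" 0]
      by (simp add: abs_div)
    have 2: "(\<integral>\<^sup>+x. f (Complex y (q * x)) \<partial>lborel) = ennreal (1 / \<bar>q\<bar>) * (\<integral>\<^sup>+x. f (Complex y x) \<partial>lborel)" for y
      using q nn_integral_real_affine[of "\<lambda>x. f (Complex y (q * x))" "1 / q" 0]
      by (simp add: abs_div)
    have "(\<integral>\<^sup>+z. f (c * z) \<partial>lborel) = (\<integral>\<^sup>+x. \<integral>\<^sup>+y. f (Complex (- q * y) (q * x)) \<partial>lborel \<partial>lborel)"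
      using True by (subst nn_integral_lborel_Complex) (auto simp: mul)
    also have "\<dots> = ennreal (1 / \<bar>q\<bar>) * (\<integral>\<^sup>+x. \<integral>\<^sup>+y. f (Complex y (q * x)) \<partial>lborel \<partial>lborel)"
      unfolding 1 by (subst nn_integral_cmult) auto
    also have "(\<integral>\<^sup>+x. \<integral>\<^sup>+y. f (Complex y (q * x)) \<partial>lborel \<partial>lborel)
        = (\<integral>\<^sup>+y. \<integral>\<^sup>+x. f (Complex y (q * x)) \<partial>lborel \<partial>lborel)"
      by (rule lborel_pair.Fubini'[symmetric]) measurable
    also have "\<dots> = ennreal (1 / \<bar>q\<bar>) * (\<integral>\<^sup>+z. f z \<partial>lborel)"
      unfolding 2 by (subst nn_integral_cmult) (auto simp: nn_integral_lborel_Complex)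
    finally have "(\<integral>\<^sup>+z. f (c * z) \<partial>lborel) = ennreal (1 / \<bar>q\<bar>) * (ennreal (1 / \<bar>q\<bar>) * (\<integral>\<^sup>+z. f z \<partial>lborel))" .
    moreover have "ennreal ((cmod c)\<^sup>2) * (ennreal (1 / \<bar>q\<bar>) * ennreal (1 / \<bar>q\<bar>)) = 1"
      using q True unfolding n by (simp add: ennreal_mult[symmetric] power2_eq_square)
    ultimately show ?thesis by (metis mult.assoc mult_1)
  qed
qed

lemma nn_integral_complex_affine:
  assumes [measurable]: "f \<in> borel_measurable borel" and "c \<noteq> (0::complex)"
  shows "ennreal ((cmod c)\<^sup>2) * (\<integral>\<^sup>+z. f (c * z + a) \<partial>lborel) = (\<integral>\<^sup>+z. f z \<partial>lborel)"
proof -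
  have "(\<integral>\<^sup>+z. f z \<partial>lborel) = (\<integral>\<^sup>+z. f (z + a) \<partial>lborel)"
    by (subst lborel_distr_plus[of a, symmetric], subst nn_integral_distr) (auto simp: add.commute)
  also have "\<dots> = ennreal ((cmod c)\<^sup>2) * (\<integral>\<^sup>+z. f (c * z + a) \<partial>lborel)"
    using assms by (subst nn_integral_complex_mult[of _ c]) auto
  finally show ?thesis by simp
qed

text \<open>The measure lives on all sequences, where it is carried by \<open>Cn n\<close>. In this way the Borel sets of the
  product topology serve every dimension, and functions on \<open>\<complex>\<^sup>n\<close> need not be restricted to
  extensional arguments.\<close>

definition lebC :: "nat \<Rightarrow> (nat \<Rightarrow> complex) measure" where
  "lebC n = distr (PiM {..<n} (\<lambda>_. lborel)) borel (trunc n)"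

lemma sets_lebC [simp, measurable_cong]: "sets (lebC n) = sets borel"
  and space_lebC [simp]: "space (lebC n) = UNIV"
  by (auto simp: lebC_def)

lemma borel_measurable_trunc [measurable]:
  "trunc n \<in> PiM {..<n} (\<lambda>_. lborel) \<rightarrow>\<^sub>M borel"
proof -
  have "trunc n \<in> PiM {..<n} (\<lambda>_. lborel) \<rightarrow>\<^sub>M PiM UNIV (\<lambda>_. borel)"
  proof (rule measurable_PiM_single')
    fix i show "(\<lambda>x. trunc n x i) \<in> borel_measurable (PiM {..<n} (\<lambda>_. lborel))"
      by (cases "i < n") (auto simp: trunc_def)
  qed auto
  then show ?thesis
    using measurable_cong_sets[OF refl sets_PiM_equal_borel] by blast
qed

lemma nn_integral_lebC:
  assumes [measurable]: "f \<in> borel_measurable borel"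
  shows "(\<integral>\<^sup>+x. f x \<partial>lebC n) = (\<integral>\<^sup>+x. f (trunc n x) \<partial>PiM {..<n} (\<lambda>_. lborel))"
  unfolding lebC_def by (rule nn_integral_distr) measurable

interpretation lborel_product: product_sigma_finite "\<lambda>_::nat. lborel :: complex measure" ..

lemma emeasure_lebC_polydisc:
  "{x::nat \<Rightarrow> complex. \<forall>i<n. cmod (x i) \<le> r} \<in> sets borel"
  "emeasure (lebC n) {x. \<forall>i<n. cmod (x i) \<le> r} = emeasure lborel (cball (0::complex) r) ^ n"
proof -
  show meas: "{x::nat \<Rightarrow> complex. \<forall>i<n. cmod (x i) \<le> r} \<in> sets borel" by measurable
  have "trunc n -` {x. \<forall>i<n. cmod (x i) \<le> r} \<inter> space (PiM {..<n} (\<lambda>_. lborel)) = (\<Pi>\<^sub>E i\<in>{..<n}. cball (0::complex) r)"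
    by (simp add: set_eq_iff space_PiM trunc_def PiE_iff) blast
  then show "emeasure (lebC n) {x. \<forall>i<n. cmod (x i) \<le> r} = emeasure lborel (cball (0::complex) r) ^ n"
    unfolding lebC_def
    by (subst emeasure_distr) (use meas in \<open>simp_all add: lborel_product.emeasure_PiM\<close>)
qed

lemma emeasure_lebC_polydisc_finite: "emeasure (lebC n) {x. \<forall>i<n. cmod (x i) \<le> r} < \<infinity>"
  using emeasure_compact_finite[OF compact_cball, of "0::complex" r]
  by (auto simp: emeasure_lebC_polydisc less_top[symmetric] power_eq_top_ennreal)

lemma sigma_finite_lebC: "sigma_finite_measure (lebC n)"
proof
  let ?A = "\<lambda>k::nat. {x::nat \<Rightarrow> complex. \<forall>i<n. cmod (x i) \<le> real k}"
  have "\<exists>k. x \<in> ?A k" for x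
  proof -
    obtain k where "(\<Sum>i<n. cmod (x i)) \<le> real k" using real_arch_simple by blast
    then show ?thesis
      by (intro exI[of _ k]) (auto intro!: order_trans[OF member_le_sum[of _ "{..<n}" "\<lambda>i. cmod (x i)"]])
  qed
  then have "\<Union>(range ?A) = UNIV" by blast
  moreover have "emeasure (lebC n) (?A k) \<noteq> \<infinity>" for k
    using emeasure_lebC_polydisc_finite[of n "real k"] by simp
  ultimately show "\<exists>A. countable A \<and> A \<subseteq> sets (lebC n) \<and> \<Union> A = space (lebC n) \<and> (\<forall>a\<in>A. emeasure (lebC n) a \<noteq> \<infinity>)"
    using emeasure_lebC_polydisc(1) by (intro exI[of _ "range ?A"]) auto
qed

text \<open>Besides translations this covers the rotations \<open>x \<mapsto> e\<^sup>i\<^sup>t x\<close>, which turn submean inequalities on discs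
  into inequalities for volume means, and the dilations, which fix the size of the kernels below.\<close>

lemma nn_integral_lebC_affine:
  assumes f [measurable]: "f \<in> borel_measurable borel" and c: "c \<noteq> 0" and a: "a \<in> Cn n"
  shows "ennreal (cmod c ^ (2 * n)) * (\<integral>\<^sup>+x. f (\<lambda>i. c * x i + a i) \<partial>lebC n) = (\<integral>\<^sup>+x. f x \<partial>lebC n)"
proof -
  let ?P = "PiM {..<n} (\<lambda>_. lborel :: complex measure)"
  let ?T = "\<lambda>x. \<lambda>i\<in>{..<n}. c * x i + a i"
  have T: "?T \<in> ?P \<rightarrow>\<^sub>M ?P"
    by (rule measurable_restrict) measurable
  have eq: "scale_measure (ennreal (cmod c ^ (2 * n))) (distr ?P ?P ?T) = ?P"
  proof (rule lborel_product.PiM_eqI)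
    fix A :: "nat \<Rightarrow> complex set"
    assume A: "\<And>i. i \<in> {..<n} \<Longrightarrow> A i \<in> sets lborel"
    have pre: "?T -` (Pi\<^sub>E {..<n} A) \<inter> space ?P = (\<Pi>\<^sub>E i\<in>{..<n}. {z. c * z + a i \<in> A i})"
      by (rule set_eqI, simp only: vimage_def Int_iff mem_Collect_eq space_PiM PiE_iff
          restrict_extensional space_lborel) (simp cong: conj_cong)
    have Ai: "{z. c * z + a i \<in> A i} \<in> sets borel" if "i < n" for i
    proof -
      have [measurable]: "A i \<in> sets borel" using A[of i] that by simp
      have "(\<lambda>z. c * z + a i) \<in> borel_measurable (borel :: complex measure)" by measurable
      from measurable_sets[OF this, of "A i"] show ?thesis by (simp add: vimage_def)
    qed
    have one: "ennreal ((cmod c)\<^sup>2) * emeasure lborel {z. c * z + a i \<in> A i} = emeasure lborel (A i)" if "i < n" for i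
    proof -
      have [measurable]: "A i \<in> sets borel" using A[of i] that by simp
      have "ennreal ((cmod c)\<^sup>2) * (\<integral>\<^sup>+z. indicator (A i) (c * z + a i) \<partial>lborel) = (\<integral>\<^sup>+z. indicator (A i) z \<partial>lborel)"
        by (rule nn_integral_complex_affine) (use c in auto)
      moreover have "(\<lambda>z. indicator (A i) (c * z + a i)) = (indicator {z. c * z + a i \<in> A i} :: complex \<Rightarrow> ennreal)"
        by (auto simp: fun_eq_iff indicator_def)
      ultimately show ?thesis using Ai[OF that] by simp
    qed
    have "emeasure (scale_measure (ennreal (cmod c ^ (2 * n))) (distr ?P ?P ?T)) (Pi\<^sub>E {..<n} A)
      = ennreal (cmod c ^ (2 * n)) * emeasure ?P (\<Pi>\<^sub>E i\<in>{..<n}. {z. c * z + a i \<in> A i})"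
      by (subst emeasure_scale_measure, subst emeasure_distr[OF T])
         (use A in \<open>auto simp: pre intro!: sets_PiM_I_finite\<close>)
    also have "\<dots> = (\<Prod>i<n. ennreal ((cmod c)\<^sup>2)) * (\<Prod>i<n. emeasure lborel {z. c * z + a i \<in> A i})"
      by (subst lborel_product.emeasure_PiM) (use Ai in \<open>auto simp: power_mult ennreal_power\<close>)
    also have "\<dots> = (\<Prod>i<n. emeasure lborel (A i))"
      unfolding prod.distrib[symmetric] by (intro prod.cong) (auto simp: one)
    finally show "emeasure (scale_measure (ennreal (cmod c ^ (2 * n))) (distr ?P ?P ?T)) (Pi\<^sub>E {..<n} A)
      = (\<Prod>i<n. emeasure lborel (A i))" .
  qed auto
  have aff [measurable]: "(\<lambda>x. (\<lambda>i. c * x i + a i)) \<in> borel_measurable borel"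
    by (intro borel_measurable_continuous_onI continuous_on_affine)
  have tr: "trunc n (?T x) = (\<lambda>i. c * trunc n x i + a i)" for x
    using a by (auto simp: trunc_def Cn_def fun_eq_iff)
  have "(\<integral>\<^sup>+x. f x \<partial>lebC n) = (\<integral>\<^sup>+x. f (trunc n x) \<partial>scale_measure (ennreal (cmod c ^ (2 * n))) (distr ?P ?P ?T))"
    unfolding eq by (rule nn_integral_lebC) measurable
  also have "\<dots> = ennreal (cmod c ^ (2 * n)) * (\<integral>\<^sup>+x. f (trunc n (?T x)) \<partial>?P)"
    by (subst nn_integral_scale_measure) (auto simp: nn_integral_distr[OF T])
  also have "(\<integral>\<^sup>+x. f (trunc n (?T x)) \<partial>?P) = (\<integral>\<^sup>+x. f (\<lambda>i. c * x i + a i) \<partial>lebC n)"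
    unfolding tr by (subst nn_integral_lebC) measurable
  finally show ?thesis by simp
qed

section \<open>Superharmonic functions\<close>

text \<open>The values in \<open>[0, \<infinity>]\<close> make all integrals of such functions meaningful. The functions that matter
  vanish outside the unit ball, so that lower semicontinuity may be demanded everywhere. It is asked for
  in two forms: in the product topology of all sequences, for measurability, and in the norm, for
  estimates near a point.\<close>

definition superh :: "nat \<Rightarrow> ((nat \<Rightarrow> complex) \<Rightarrow> ennreal) \<Rightarrow> bool" where
  "superh n W \<longleftrightarrow>
    (\<forall>c. open {x. c < W x}) \<and>
    (\<forall>a\<in>Cn n. \<forall>c. c < W a \<longrightarrow> (\<exists>d>0. \<forall>z\<in>Cn n. cdist n z a < d \<longrightarrow> c < W z)) \<and>
    (\<forall>a\<in>Cn n. \<forall>w\<in>Cn n. (\<forall>\<zeta>. cmod \<zeta> \<le> 1 \<longrightarrow> cnorm n (\<lambda>i. a i + \<zeta> * w i) < 1) \<longrightarrow>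
      (\<integral>\<^sup>+t\<in>{0..2*pi}. W (\<lambda>i. a i + cis t * w i) \<partial>lborel) \<le> ennreal (2 * pi) * W a)"

lemma superh_borel_measurable [measurable (raw)]:
  "superh n W \<Longrightarrow> f \<in> borel_measurable M \<Longrightarrow> (\<lambda>x. W (f x)) \<in> borel_measurable M"
proof -
  assume W: "superh n W" and f: "f \<in> borel_measurable M"
  have "W \<in> borel_measurable borel"
    by (rule borel_measurableI_greater) (use W in \<open>auto simp: superh_def\<close>)
  from measurable_compose[OF f this] show ?thesis .
qed

lemma superh_measurable: "superh n W \<Longrightarrow> W \<in> borel_measurable borel"
  by (rule superh_borel_measurable[OF _ measurable_ident_sets[OF refl]])

lemma superh_circle:
  assumes "superh n W" "a \<in> Cn n" "w \<in> Cn n"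
    "\<And>\<zeta>. cmod \<zeta> \<le> 1 \<Longrightarrow> cnorm n (\<lambda>i. a i + \<zeta> * w i) < 1"
  shows "(\<integral>\<^sup>+t\<in>{0..2*pi}. W (\<lambda>i. a i + cis t * w i) \<partial>lborel) \<le> ennreal (2 * pi) * W a"
  using assms unfolding superh_def by blast

lemma superh_lsc:
  assumes "superh n W" "a \<in> Cn n" "c < W a"
  obtains d where "d > 0" "\<And>z. z \<in> Cn n \<Longrightarrow> cdist n z a < d \<Longrightarrow> c < W z"
  using assms unfolding superh_def by metis

text \<open>If no minimum is attained, the open sets \<open>{f > f y}\<close> for \<open>y \<in> K\<close> cover \<open>K\<close>; in a finite subcover the
  smallest of the finitely many values \<open>f y\<close> would have to exceed another one of them.\<close>

lemma lsc_attains_min: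
  fixes f :: "'a::topological_space \<Rightarrow> 'b::linorder"
  assumes "compact K" "K \<noteq> {}" and lsc: "\<And>c. \<exists>U. open U \<and> {x \<in> K. c < f x} = U \<inter> K"
  obtains x where "x \<in> K" "\<And>y. y \<in> K \<Longrightarrow> f x \<le> f y"
proof -
  have "\<exists>x\<in>K. \<forall>y\<in>K. f x \<le> f y"
  proof (rule ccontr)
    assume "\<not> ?thesis"
    then have ne: "\<And>x. x \<in> K \<Longrightarrow> \<exists>y\<in>K. f y < f x" by (meson not_le)
    obtain U where U: "\<And>c. open (U c)" "\<And>c. {x \<in> K. c < f x} = U c \<inter> K"
      using lsc by metis
    have "K \<subseteq> (\<Union>y\<in>K. U (f y))"
    proof
      fix x assume "x \<in> K"
      with ne obtain y where "y \<in> K" "f y < f x" by blast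
      then show "x \<in> (\<Union>y\<in>K. U (f y))" using U(2)[of "f y"] \<open>x \<in> K\<close> by auto
    qed
    then obtain F where F: "F \<subseteq> K" "finite F" "K \<subseteq> (\<Union>y\<in>F. U (f y))"
      using compactE_image[OF \<open>compact K\<close>, of K "\<lambda>y. U (f y)"] U(1) by metis
    then have "F \<noteq> {}" using \<open>K \<noteq> {}\<close> by auto
    then obtain y where y: "y \<in> F" "\<And>x. x \<in> F \<Longrightarrow> f y \<le> f x"
      using F(2) by (metis arg_min_if_finite(1) arg_min_least)
    with F obtain x where "x \<in> F" "y \<in> U (f x)" by blast
    then have "f x < f y" using U(2)[of "f x"] y F by blast
    then show False using y(2)[OF \<open>x \<in> F\<close>] by simp
  qed
  then show thesis using that by blast
qed

lemma nn_integral_ge_has_integral: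
  assumes "continuous_on {a..b} \<phi>" "(\<phi> has_integral I) {a..b::real}"
    and le: "\<And>t. t \<in> {a..b} \<Longrightarrow> ennreal (\<phi> t) \<le> F t"
  shows "ennreal I \<le> (\<integral>\<^sup>+t\<in>{a..b}. F t \<partial>lborel)"
proof -
  let ?p = "\<lambda>t. max 0 (\<phi> t)"
  have "?p integrable_on {a..b}"
    by (intro integrable_continuous_real continuous_intros assms)
  then obtain J where J: "(?p has_integral J) {a..b}" by blast
  have "I \<le> J" by (rule has_integral_le[OF assms(2) J]) auto
  have "ennreal I \<le> ennreal J" by (rule ennreal_leI) fact
  also have "\<dots> = (\<integral>\<^sup>+t. ennreal (indicator {a..b} t * ?p t) \<partial>lborel)"
    by (rule nn_integral_has_integral_lebesgue[symmetric, OF _ J]) auto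
  also have "\<dots> \<le> (\<integral>\<^sup>+t\<in>{a..b}. F t \<partial>lborel)"
    by (intro nn_integral_mono) (auto simp: indicator_def le max_def ennreal_neg le)
  finally show ?thesis .
qed

lemma has_integral_Re_cis: "((\<lambda>t. Re (c * cis t)) has_integral 0) {0..2*pi}"
proof -
  have "((\<lambda>t. Re (c * cis t)) has_integral (Im (c * cis (2*pi)) - Im (c * cis 0))) {0..2*pi}"
    by (rule fundamental_theorem_of_calculus)
       (auto simp: has_real_derivative_iff_has_vector_derivative[symmetric]
         intro!: derivative_eq_intros)
  then show ?thesis by simp
qed

lemma has_integral_Re_cis_power2:
  "((\<lambda>t. (Re (c * cis t))\<^sup>2) has_integral (pi * (cmod c)\<^sup>2)) {0..2*pi}"
proof -
  let ?F = "\<lambda>t. (cmod c)\<^sup>2 * t / 2 + Im (c\<^sup>2 * cis (2 * t)) / 4"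
  have "((\<lambda>t. (Re (c * cis t))\<^sup>2) has_integral (?F (2*pi) - ?F 0)) {0..2*pi}"
  proof (rule fundamental_theorem_of_calculus)
    fix t assume "t \<in> {0..2*pi}"
    have "(?F has_real_derivative (cmod c)\<^sup>2 / 2 + Re (c\<^sup>2 * cis (2 * t)) / 2) (at t within {0..2*pi})"
      by (auto intro!: derivative_eq_intros simp: field_simps)
    moreover have "(cmod c)\<^sup>2 / 2 + Re (c\<^sup>2 * cis (2 * t)) / 2 = (Re (c * cis t))\<^sup>2"
    proof -
      have "(cmod u)\<^sup>2 / 2 + Re (u\<^sup>2) / 2 = (Re u)\<^sup>2" for u
        by (subst cmod_power2) (simp add: power2_eq_square field_simps)
      moreover have "c\<^sup>2 * cis (2 * t) = (c * cis t)\<^sup>2"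
        by (simp add: power_mult_distrib power2_eq_square cis_mult)
      moreover have "cmod c = cmod (c * cis t)" by (simp add: norm_mult)
      ultimately show ?thesis by metis
    qed
    ultimately show "(?F has_vector_derivative (Re (c * cis t))\<^sup>2) (at t within {0..2*pi})"
      by (simp add: has_real_derivative_iff_has_vector_derivative)
  qed simp
  moreover have "cis (4 * pi) = 1" using cis_multiple_2pi[of 2] by simp
  ultimately show ?thesis by (simp add: mult.commute[of pi])
qed

text \<open>The mean value property of \<open>ln \<bar>\<cdot>\<bar>\<close> on a disc without zeros, obtained from Cauchy's formula for the
  holomorphic logarithm of \<open>1 + q u\<close> with \<open>\<bar>q\<bar> < 1\<close>.\<close>

lemma has_integral_ln_cmod_circle:
  assumes "cmod \<kappa> < cmod \<gamma>"
  shows "((\<lambda>t. ln (cmod (\<gamma> + \<kappa> * cis t))) has_integral (2 * pi * ln (cmod \<gamma>))) {0..2*pi}"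
proof -
  define q where "q = \<kappa> / \<gamma>"
  have g: "\<gamma> \<noteq> 0" using assms by auto
  have q: "cmod q < 1" using assms g by (simp add: q_def norm_divide divide_simps)
  let ?f = "\<lambda>u. Ln (1 + q * u)"
  have lt: "cmod (q * u) < 1" if "cmod u \<le> 1" for u
    using q mult_left_mono[OF that, of "cmod q"] by (simp add: norm_mult)
  have nr: "1 + q * u \<notin> \<real>\<^sub>\<le>\<^sub>0" if "cmod u \<le> 1" for u
    using lt[OF that] abs_Re_le_cmod[of "q * u"] by (auto simp: complex_nonpos_Reals_iff)
  have "?f holomorphic_on cball 0 1"
    by (intro holomorphic_intros) (use nr in auto)
  then have "((\<lambda>u. ?f u / (u - 0)) has_contour_integral (2 * of_real pi * \<i> * ?f 0)) (circlepath 0 1)"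
    by (rule Cauchy_integral_circlepath_simple) simp
  then have "((\<lambda>t. ?f (0 + 1 * cis t) / (0 + 1 * cis t - 0) * 1 * \<i> * cis t) has_integral 0) {0..2*pi}"
    unfolding circlepath_def by (subst (asm) has_contour_integral_part_circlepath_iff) auto
  then have "((\<lambda>t. \<i> * ?f (cis t)) has_integral 0) {0..2*pi}"
    by (rule has_integral_eq[rotated]) auto
  from has_integral_Im[OF this] have *: "((\<lambda>t. Re (?f (cis t))) has_integral 0) {0..2*pi}" by simp
  have "((\<lambda>t. Re (?f (cis t)) + ln (cmod \<gamma>)) has_integral (0 + ln (cmod \<gamma>) * (2 * pi))) {0..2*pi}"
    using has_integral_const_real[of "ln (cmod \<gamma>)" 0 "2*pi"]
    by (intro has_integral_add *) (simp add: mult.commute)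
  then have "((\<lambda>t. Re (?f (cis t)) + ln (cmod \<gamma>)) has_integral (2 * pi * ln (cmod \<gamma>))) {0..2*pi}"
    by (simp add: mult_ac)
  moreover have "Re (?f (cis t)) + ln (cmod \<gamma>) = ln (cmod (\<gamma> + \<kappa> * cis t))" for t
  proof -
    have ne: "1 + q * cis t \<noteq> 0" using nr[of "cis t"] by auto
    have "\<gamma> + \<kappa> * cis t = \<gamma> * (1 + q * cis t)" using g by (simp add: q_def field_simps)
    then show ?thesis using g ne by (simp add: norm_mult ln_mult)
  qed
  ultimately show ?thesis by simp
qed

lemma cnorm_line_power2:
  "(cnorm n (\<lambda>i. z i + \<zeta> * v i))\<^sup>2
    = (cnorm n z)\<^sup>2 + 2 * Re (\<zeta> * (\<Sum>i<n. v i * cnj (z i))) + (cmod \<zeta>)\<^sup>2 * (cnorm n v)\<^sup>2"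
proof -
  have "(cmod (z i + \<zeta> * v i))\<^sup>2
      = (cmod (z i))\<^sup>2 + 2 * Re (\<zeta> * (v i * cnj (z i))) + (cmod \<zeta>)\<^sup>2 * (cmod (v i))\<^sup>2" for i
    unfolding cmod_power2 by (simp add: power2_eq_square algebra_simps)
  then show ?thesis
    by (simp add: cnorm_power2 sum.distrib sum_distrib_left)
qed

text \<open>A bound for the infimum over a ball of radius \<open>t\<close> if the value at the reference point is 1. The summand 1 covers
  the case that the reference point itself belongs to that ball.\<close>

definition growth :: "real \<Rightarrow> real \<Rightarrow> real \<Rightarrow> real" where
  "growth \<sigma> \<tau> t = 1 + nu \<sigma> \<tau> * (ln (1/t) + (ln 2 - ln (1 - \<tau>\<^sup>2) / 2))"

lemma nu_pos: "0 < \<sigma> \<Longrightarrow> \<sigma> < 1 \<Longrightarrow> 0 < \<tau> \<Longrightarrow> \<tau> < 1 \<Longrightarrow> 0 < nu \<sigma> \<tau>"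
proof -
  assume st: "0 < \<sigma>" "\<sigma> < 1" "0 < \<tau>" "\<tau> < 1"
  then have "0 < (1 - \<sigma>) * (1 - \<tau>)" by simp
  then have "1 < (1 + \<sigma> * \<tau>) / (\<sigma> + \<tau>)" using st by (simp add: field_simps)
  then show ?thesis by (simp add: nu_def)
qed

lemma growth_ge_1:
  assumes "0 < \<sigma>" "\<sigma> < 1" "0 < \<tau>" "\<tau> < 1" "0 < t" "t < 1"
  shows "1 \<le> growth \<sigma> \<tau> t"
proof -
  have "0 < 1 - \<tau>\<^sup>2" "1 - \<tau>\<^sup>2 < 1" using assms by (auto simp: power_less_one_iff abs_square_less_1)
  then have "ln (1 - \<tau>\<^sup>2) < 0" by simp
  moreover have "ln (1/t) > 0" using assms by simp
  ultimately have "0 \<le> ln (1/t) + (ln 2 - ln (1 - \<tau>\<^sup>2) / 2)" using ln_gt_zero[of "2::real"] by linarith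
  then have "0 \<le> nu \<sigma> \<tau> * (ln (1/t) + (ln 2 - ln (1 - \<tau>\<^sup>2) / 2))"
    using nu_pos[of \<sigma> \<tau>] assms by (intro mult_nonneg_nonneg) auto
  then show ?thesis unfolding growth_def by linarith
qed

text \<open>The minimum principle, with a harmonic minorant \<open>G\<close> that is controlled at the boundary points. At an
  interior minimum of \<open>u - G - \<epsilon> \<bar>\<zeta>\<bar>\<^sup>2\<close> the circle means give a contradiction at once, because the term
  \<open>\<epsilon> \<bar>\<zeta>\<bar>\<^sup>2\<close> makes the comparison function strictly subharmonic; so no connectedness argument is needed.\<close>

lemma superharmonic_minorant:
  fixes u :: "complex \<Rightarrow> ennreal" and G :: "complex \<Rightarrow> real"
  assumes lscu: "\<And>c. open {\<zeta>. c < u \<zeta>}" and K: "compact K" "K \<subseteq> cball 0 B" and contG: "continuous_on K G"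
    and bdry: "\<And>p. p \<in> K \<Longrightarrow> ennreal (G p) \<le> u p \<or>
      (\<exists>r>0. cball p r \<subseteq> K \<and> (\<integral>\<^sup>+t\<in>{0..2*pi}. u (p + of_real r * cis t) \<partial>lborel) \<le> ennreal (2 * pi) * u p \<and>
        ((\<lambda>t. G (p + of_real r * cis t)) has_integral (2 * pi * G p)) {0..2*pi})"
    and p0: "p0 \<in> K"
  shows "ennreal (G p0) \<le> u p0"
proof (rule ccontr)
  assume "\<not> ?thesis"
  then have lt: "u p0 < ennreal (G p0)" by simp
  then obtain m where m: "u p0 = ennreal m" "0 \<le> m" by (cases "u p0") auto
  have mG: "m < G p0" using lt m by (simp add: ennreal_less_iff)
  define \<epsilon> where "\<epsilon> = (G p0 - m) / (2 * (B\<^sup>2 + 1))"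
  have B1: "0 < B\<^sup>2 + 1" by (simp add: add_nonneg_pos)
  then have eps: "0 < \<epsilon>" using mG by (simp add: \<epsilon>_def)
  have "2 * (B\<^sup>2 + 1) * \<epsilon> = G p0 - m" using B1 by (simp add: \<epsilon>_def)
  then have "2 * (\<epsilon> * B\<^sup>2) + 2 * \<epsilon> = G p0 - m" by (simp add: algebra_simps)
  moreover have "0 \<le> \<epsilon> * B\<^sup>2" using eps by simp
  ultimately have epsB: "\<epsilon> * B\<^sup>2 < G p0 - m" using eps by linarith
  define \<phi> where "\<phi> = (\<lambda>\<zeta>. G \<zeta> + \<epsilon> * ((cmod \<zeta>)\<^sup>2 - B\<^sup>2))"
  define f where "f = (\<lambda>\<zeta>. enn2ereal (u \<zeta>) - ereal (\<phi> \<zeta>))"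
  have contphi: "continuous_on K \<phi>" unfolding \<phi>_def by (intro continuous_intros contG)
  have lsc: "\<exists>U. open U \<and> {\<zeta> \<in> K. k < f \<zeta>} = U \<inter> K" for k
  proof -
    have "openin (top_of_set K) {\<zeta> \<in> K. k < f \<zeta>}"
    proof (subst openin_subopen, safe)
      fix \<zeta> assume \<zeta>: "\<zeta> \<in> K" "k < f \<zeta>"
      then have "k + ereal (\<phi> \<zeta>) < enn2ereal (u \<zeta>)"
        unfolding f_def by (cases k; cases "enn2ereal (u \<zeta>)") auto
      then obtain y where y: "k + ereal (\<phi> \<zeta>) < ereal y" "ereal y < enn2ereal (u \<zeta>)"
        using ereal_dense2 by blast
      have o1: "open {\<xi>. ereal y < enn2ereal (u \<xi>)}"
      proof (cases "y < 0")
        case True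
        then have "{\<xi>. ereal y < enn2ereal (u \<xi>)} = UNIV"
          by (auto intro: less_le_trans[OF _ enn2ereal_nonneg])
        then show ?thesis by simp
      next
        case False
        then have "{\<xi>. ereal y < enn2ereal (u \<xi>)} = {\<xi>. ennreal y < u \<xi>}"
          by (auto simp: less_ennreal.rep_eq enn2ereal_ennreal)
        then show ?thesis using lscu by simp
      qed
      have o2: "openin (top_of_set K) {\<xi> \<in> K. k + ereal (\<phi> \<xi>) < ereal y}"
      proof (cases k)
        case (real r)
        then have "{\<xi> \<in> K. k + ereal (\<phi> \<xi>) < ereal y} = K \<inter> \<phi> -` {..<y - r}" by auto
        then show ?thesis using continuous_openin_preimage_gen[OF contphi open_lessThan] by simp
      qed (use y in auto)
      let ?T = "{\<xi> \<in> K. k + ereal (\<phi> \<xi>) < ereal y} \<inter> {\<xi>. ereal y < enn2ereal (u \<xi>)}"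
      have "openin (top_of_set K) ?T" using o1 o2 by (metis openin_Int_open)
      moreover have "\<zeta> \<in> ?T" using y \<zeta> by auto
      moreover have "?T \<subseteq> {\<zeta> \<in> K. k < f \<zeta>}"
      proof safe
        fix \<xi> assume "k + ereal (\<phi> \<xi>) < ereal y" "ereal y < enn2ereal (u \<xi>)"
        then have "k + ereal (\<phi> \<xi>) < enn2ereal (u \<xi>)" by (rule less_trans)
        then show "k < f \<xi>" unfolding f_def by (cases k; cases "enn2ereal (u \<xi>)") auto
      qed
      ultimately show "\<exists>T. openin (top_of_set K) T \<and> \<zeta> \<in> T \<and> T \<subseteq> {\<zeta> \<in> K. k < f \<zeta>}" by blast
    qed
    then show ?thesis unfolding openin_open by auto
  qed
  have "K \<noteq> {}" using p0 by auto
  from lsc_attains_min[OF K(1) this lsc] obtain p where p: "p \<in> K" "\<And>\<zeta>. \<zeta> \<in> K \<Longrightarrow> f p \<le> f \<zeta>"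
    by blast
  have "f p0 < 0"
  proof -
    have "\<epsilon> * (cmod p0)\<^sup>2 \<ge> 0" using eps by simp
    then have "m < \<phi> p0" using epsB by (simp add: \<phi>_def right_diff_distrib)
    then show ?thesis by (simp add: f_def m enn2ereal_ennreal)
  qed
  then have fp: "f p < 0" using p(2)[OF p0] by simp
  then obtain w where w: "u p = ennreal w" "0 \<le> w" by (cases "u p") (auto simp: f_def)
  have wphi: "w < \<phi> p" using fp w by (simp add: f_def enn2ereal_ennreal)
  have phile: "\<phi> p \<le> G p"
  proof -
    have "cmod p \<le> B" using K(2) p(1) by auto
    then have "(cmod p)\<^sup>2 \<le> B\<^sup>2" by (intro power_mono) auto
    then show ?thesis using eps by (simp add: \<phi>_def mult_nonneg_nonpos)
  qed
  have "\<not> ennreal (G p) \<le> u p" using w wphi phile by simp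
  with bdry[OF p(1)] obtain r where r: "0 < r" "cball p r \<subseteq> K"
      "(\<integral>\<^sup>+t\<in>{0..2*pi}. u (p + of_real r * cis t) \<partial>lborel) \<le> ennreal (2 * pi) * u p"
      "((\<lambda>t. G (p + of_real r * cis t)) has_integral (2 * pi * G p)) {0..2*pi}"
    by blast
  have inK: "p + of_real r * cis s \<in> K" for s
    using r(1,2) by (auto simp: subset_iff dist_norm norm_mult)
  define \<psi> where "\<psi> = (\<lambda>s. \<phi> (p + of_real r * cis s) + (w - \<phi> p))"
  have ic: "((\<lambda>s. k) has_integral (2 * pi * k)) {0..2*pi}" for k :: real
    using has_integral_const_real[of k 0 "2*pi"] by simp
  have int: "(\<psi> has_integral (2 * pi * (w + \<epsilon> * r\<^sup>2))) {0..2*pi}"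
  proof -
    have e2: "(cmod (p + of_real r * cis s))\<^sup>2 = (cmod p)\<^sup>2 + 2 * r * Re (cnj p * cis s) + r\<^sup>2" for s
    proof -
      have "r * (r * (cos s * cos s)) + r * (r * (sin s * sin s)) = r * r"
        by (simp only: distrib_left[symmetric] sin_cos_squared_add3 mult_1_right)
      then show ?thesis unfolding cmod_power2 by (simp add: power2_eq_square algebra_simps)
    qed
    have "((\<lambda>s. G (p + of_real r * cis s) + \<epsilon> * (2 * r * Re (cnj p * cis s) + ((cmod p)\<^sup>2 + r\<^sup>2 - B\<^sup>2)) + (w - \<phi> p))
       has_integral (2 * pi * G p + \<epsilon> * (2 * r * 0 + 2 * pi * ((cmod p)\<^sup>2 + r\<^sup>2 - B\<^sup>2)) + 2 * pi * (w - \<phi> p))) {0..2*pi}"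
      by (intro has_integral_add has_integral_mult_right has_integral_Re_cis ic r(4))
    also have "(\<lambda>s. G (p + of_real r * cis s) + \<epsilon> * (2 * r * Re (cnj p * cis s) + ((cmod p)\<^sup>2 + r\<^sup>2 - B\<^sup>2)) + (w - \<phi> p)) = \<psi>"
      unfolding \<psi>_def \<phi>_def e2 by (simp add: fun_eq_iff algebra_simps)
    also have "2 * pi * G p + \<epsilon> * (2 * r * 0 + 2 * pi * ((cmod p)\<^sup>2 + r\<^sup>2 - B\<^sup>2)) + 2 * pi * (w - \<phi> p)
       = 2 * pi * (w + \<epsilon> * r\<^sup>2)" by (simp add: \<phi>_def algebra_simps)
    finally show ?thesis .
  qed
  have "ennreal (2 * pi * (w + \<epsilon> * r\<^sup>2)) \<le> (\<integral>\<^sup>+s\<in>{0..2*pi}. u (p + of_real r * cis s) \<partial>lborel)"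
  proof (rule nn_integral_ge_has_integral[OF _ int])
    have "continuous_on {0..2*pi} (\<lambda>s. p + of_real r * cis s)" by (intro continuous_intros)
    then have "continuous_on {0..2*pi} (\<lambda>s. \<phi> (p + of_real r * cis s))"
      by (rule continuous_on_compose2[OF contphi]) (use inK in auto)
    then show "continuous_on {0..2*pi} \<psi>" unfolding \<psi>_def by (intro continuous_intros)
    fix s
    show "ennreal (\<psi> s) \<le> u (p + of_real r * cis s)"
    proof (cases "u (p + of_real r * cis s)")
      case (real v)
      have "f p \<le> f (p + of_real r * cis s)" by (rule p(2)[OF inK])
      then have "w - \<phi> p \<le> v - \<phi> (p + of_real r * cis s)"
        using w real by (simp add: f_def enn2ereal_ennreal)
      then show ?thesis using real by (simp add: \<psi>_def ennreal_leI)
    qed simp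
  qed
  also have "\<dots> \<le> ennreal (2 * pi * w)" using r(3) w by (simp add: ennreal_mult)
  finally have "2 * pi * (w + \<epsilon> * r\<^sup>2) \<le> 2 * pi * w" using w by simp
  then have "\<epsilon> * r\<^sup>2 \<le> 0" by simp
  then show False using eps r by (simp add: mult_le_0_iff)
qed

section \<open>Logarithmic growth near a point\<close>

text \<open>The quotient \<open>d \<surd>S / h\<close> will be the modulus at the reference point of the automorphism of the ball that
  moves the pole to the origin. Thus the pseudo-hyperbolic distance of points of norms \<open>x \<le> \<sigma>\<close> and \<open>y \<le> \<tau>\<close> is
  largest for points of norms \<open>\<sigma>\<close> and \<open>\<tau>\<close> on opposite sides of the origin.\<close>

lemma pseudohyperbolic_bound:
  fixes x y \<sigma> \<tau> h d S :: real
  assumes xy: "0 \<le> x" "0 \<le> y" "x \<le> \<sigma>" "y \<le> \<tau>" and st: "0 < \<sigma>" "\<sigma> < 1" "0 < \<tau>" "\<tau> < 1"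
    and h: "0 < h" "h \<le> 1 + x * y" and S: "0 \<le> S"
    and id: "d\<^sup>2 * S = h\<^sup>2 - (1 - y\<^sup>2) * (1 - x\<^sup>2)"
  shows "(1 + \<sigma> * \<tau>) / (\<sigma> + \<tau>) * (d * sqrt S) \<le> h"
proof -
  have xy1: "x < 1" "y < 1" using xy st by auto
  have "(1 - y\<^sup>2) * (1 - x\<^sup>2) * h\<^sup>2 \<le> (1 - y\<^sup>2) * (1 - x\<^sup>2) * (1 + x * y)\<^sup>2"
    using xy xy1 h by (intro mult_left_mono power_mono mult_nonneg_nonneg) (auto simp: power_le_one)
  then have "(1 + x * y)\<^sup>2 * (d\<^sup>2 * S) \<le> h\<^sup>2 * ((1 + x * y)\<^sup>2 - (1 - y\<^sup>2) * (1 - x\<^sup>2))"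
    unfolding id by (simp add: algebra_simps)
  also have "(1 + x * y)\<^sup>2 - (1 - y\<^sup>2) * (1 - x\<^sup>2) = (x + y)\<^sup>2" by (simp add: power2_eq_square algebra_simps)
  finally have "((1 + x * y) * (d * sqrt S))\<^sup>2 \<le> (h * (x + y))\<^sup>2"
    using S by (simp add: power_mult_distrib mult_ac)
  then have 1: "(1 + x * y) * (d * sqrt S) \<le> h * (x + y)"
    by (rule power2_le_imp_le) (use xy h in auto)
  have "(1 + \<sigma> * \<tau>) * (x + y) \<le> (1 + x * y) * (\<sigma> + \<tau>)"
  proof -
    have "(1 + x * y) * (\<sigma> + \<tau>) - (1 + \<sigma> * \<tau>) * (x + y)
       = (\<sigma> - x) * (1 - y * \<tau>) + (\<tau> - y) * (1 - x * \<sigma>)" by (simp add: algebra_simps)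
    moreover have "y * \<tau> \<le> 1" "x * \<sigma> \<le> 1" using xy xy1 st by (auto intro: mult_le_one)
    then have "0 \<le> (\<sigma> - x) * (1 - y * \<tau>)" "0 \<le> (\<tau> - y) * (1 - x * \<sigma>)" using xy by simp_all
    ultimately show ?thesis by linarith
  qed
  then have 2: "(1 + \<sigma> * \<tau>) / (\<sigma> + \<tau>) * (x + y) \<le> 1 + x * y" using st by (simp add: field_simps)
  have "(1 + x * y) * ((1 + \<sigma> * \<tau>) / (\<sigma> + \<tau>) * (d * sqrt S)) \<le> (1 + \<sigma> * \<tau>) / (\<sigma> + \<tau>) * (h * (x + y))"
    using mult_left_mono[OF 1, of "(1 + \<sigma> * \<tau>) / (\<sigma> + \<tau>)"] st by (simp add: mult_ac)
  also have "\<dots> \<le> (1 + x * y) * h" using mult_left_mono[OF 2, of h] h by (simp add: mult_ac)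
  finally show ?thesis using xy by (subst (asm) mult_le_cancel_left_pos) (simp_all add: add_pos_nonneg)
qed

text \<open>Along the complex line through \<open>z\<close> and the reference point \<open>z0\<close>, the superharmonic function is compared
  with a multiple of the Green function of the disc that the line cuts out of the ball, with pole \<open>z\<close>.
  If \<open>W\<close> is at least \<open>A\<close> within distance \<open>t\<close> of \<open>z\<close>, the multiple \<open>A / (ln (1/t) + const)\<close> is admissible. At
  \<open>z0\<close> the Green function is at least \<open>ln ((1 + \<sigma> \<tau>) / (\<sigma> + \<tau>))\<close>, which is where \<open>nu \<sigma> \<tau>\<close> comes from.\<close>

lemma superh_log_growth:
  assumes W: "superh n W" and z: "z \<in> Cn n" "cnorm n z \<le> \<tau>" and z0: "z0 \<in> Cn n" "cnorm n z0 \<le> \<sigma>"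
    and st: "0 < \<sigma>" "\<sigma> < 1" "0 < \<tau>" "\<tau> < 1" and t: "0 < t" "t < 1" and A: "0 \<le> A"
    and big: "\<And>w. w \<in> Cn n \<Longrightarrow> cnorm n w < 1 \<Longrightarrow> cdist n w z \<le> t \<Longrightarrow> ennreal A \<le> W w"
  shows "ennreal (A / growth \<sigma> \<tau> t) \<le> W z0"
proof -
  define \<rho> where "\<rho> = (1 + \<sigma> * \<tau>) / (\<sigma> + \<tau>)"
  define L where "L = ln (1/t) + (ln 2 - ln (1 - \<tau>\<^sup>2) / 2)"
  have "0 < (1 - \<sigma>) * (1 - \<tau>)" using st by simp
  then have rho: "\<rho> > 1" using st by (simp add: \<rho>_def field_simps)
  then have lnrho: "ln \<rho> > 0" by simp
  have nu: "nu \<sigma> \<tau> = 1 / ln \<rho>" by (simp add: nu_def \<rho>_def)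
  have tau2: "0 < 1 - \<tau>\<^sup>2" "1 - \<tau>\<^sup>2 < 1" using st by (auto simp: power_less_one_iff abs_square_less_1)
  then have "ln (1 - \<tau>\<^sup>2) < 0" by simp
  moreover have "ln (1/t) > 0" using t by simp
  ultimately have L: "L > 0" using ln_gt_zero[of "2::real"] unfolding L_def by linarith
  have goal: "A / (1 + nu \<sigma> \<tau> * L) \<le> A" using L lnrho A by (simp add: nu field_simps)
  show ?thesis
  proof (cases "cdist n z0 z \<le> t")
    case True
    then have "ennreal A \<le> W z0" using big[of z0] z0 st by simp
    moreover have "ennreal (A / (1 + nu \<sigma> \<tau> * L)) \<le> ennreal A" by (rule ennreal_leI[OF goal])
    ultimately show ?thesis unfolding L_def growth_def by (rule order_trans[rotated])
  next
    case False
    define d where "d = cdist n z0 z"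
    have d: "d > t" "d > 0" using False t by (auto simp: d_def)
    define v where "v = (\<lambda>i. (z0 i - z i) / of_real d)"
    define pt where "pt = (\<lambda>\<zeta>::complex. (\<lambda>i. z i + \<zeta> * v i))"
    define a where "a = (cnorm n z)\<^sup>2"
    define b where "b = (\<Sum>i<n. v i * cnj (z i))"
    define H where "H = (\<lambda>\<zeta>. of_real (1 - a) - \<zeta> * b)"
    define S where "S = 1 - a + (cmod b)\<^sup>2"
    define G where "G = (\<lambda>\<zeta>. ln (cmod (H \<zeta>)) - ln (cmod \<zeta>) - ln S / 2)"
    \<comment> \<open>\<open>G\<close> is the Green function of the slice: \<open>G = - ln \<bar>\<phi>\<bar>\<close> for the automorphism \<open>\<phi>\<close> of the ball that
      moves \<open>z\<close> to the origin, as the identity \<open>ident\<close> shows.\<close>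
    define K where "K = {\<zeta>. cnorm n (pt \<zeta>) \<le> 1 \<and> t \<le> cmod \<zeta>}"
    define c where "c = A / L"
    have vC: "v \<in> Cn n" using z z0 by (auto simp: v_def Cn_def)
    have nv: "cnorm n v = 1"
    proof -
      have "v = (\<lambda>i. of_real (1 / d) * (z0 i - z i))" by (auto simp: v_def field_simps)
      then have "cnorm n v = cmod (of_real (1 / d)) * cdist n z0 z" using cnorm_scale by metis
      then show ?thesis using d by (simp add: d_def[symmetric] norm_divide)
    qed
    have ptC: "pt \<zeta> \<in> Cn n" for \<zeta> using z vC by (auto simp: pt_def Cn_def)
    have ptd: "pt (of_real d) = z0" using d by (auto simp: pt_def v_def)
    have ptz: "cdist n (pt \<zeta>) z = cmod \<zeta>" for \<zeta>
      using cnorm_scale[of n \<zeta> v] by (simp add: pt_def nv)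
    have a1: "a \<le> \<tau>\<^sup>2" using z by (simp add: a_def power_mono)
    then have a: "0 < 1 - a" "0 \<le> a" using tau2 by (auto simp: a_def)
    have S: "S \<ge> 1 - a" "S > 0" using a by (auto simp: S_def add_pos_nonneg)
    have npt: "(cnorm n (pt \<zeta>))\<^sup>2 = a + 2 * Re (\<zeta> * b) + (cmod \<zeta>)\<^sup>2" for \<zeta>
      unfolding pt_def cnorm_line_power2 by (simp add: a_def b_def nv)
    have ident: "(cmod (H \<zeta>))\<^sup>2 = (1 - a) * (1 - (cnorm n (pt \<zeta>))\<^sup>2) + (cmod \<zeta>)\<^sup>2 * S" for \<zeta>
      unfolding npt S_def H_def cmod_power2 by (simp add: power2_eq_square algebra_simps)
    have Hpos: "H \<zeta> \<noteq> 0" if "cnorm n (pt \<zeta>) \<le> 1" "\<zeta> \<noteq> 0" for \<zeta>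
    proof -
      have "(1 - a) * (1 - (cnorm n (pt \<zeta>))\<^sup>2) \<ge> 0" using a that by (simp add: power_le_one)
      moreover have "(cmod \<zeta>)\<^sup>2 * S > 0" using that S by simp
      ultimately have "(cmod (H \<zeta>))\<^sup>2 > 0" unfolding ident by linarith
      then show ?thesis by auto
    qed
    have K0: "\<zeta> \<noteq> 0" "H \<zeta> \<noteq> 0" "cmod \<zeta> \<le> 2" if "\<zeta> \<in> K" for \<zeta>
    proof -
      show "\<zeta> \<noteq> 0" using that t by (auto simp: K_def)
      then show "H \<zeta> \<noteq> 0" using Hpos that by (auto simp: K_def)
      have "cmod \<zeta> \<le> cnorm n (pt \<zeta>) + cnorm n z" using cdist_le_cnorm ptz by metis
      then show "cmod \<zeta> \<le> 2" using that z st by (auto simp: K_def)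
    qed
    have contpt: "continuous_on UNIV pt"
      unfolding pt_def by (intro continuous_on_coordinatewise_then_product continuous_intros)
    have contH: "continuous_on T H" for T unfolding H_def by (intro continuous_intros)
    have contnpt: "continuous_on UNIV (\<lambda>\<zeta>. cnorm n (pt \<zeta>))"
      unfolding pt_def by (intro continuous_intros)
    have "closed K"
      unfolding K_def Collect_conj_eq
      by (intro closed_Int closed_Collect_le contnpt continuous_intros)
    moreover have "bounded K" using K0(3) by (auto simp: bounded_iff)
    ultimately have compK: "compact K" by (simp add: compact_eq_bounded_closed)
    have contG: "continuous_on K G"
      unfolding G_def by (intro continuous_intros contH) (use K0 in auto)
    have Gd: "G (of_real d) \<ge> ln \<rho>"
    proof -
      have Hd: "H (of_real d) = 1 - (\<Sum>i<n. z0 i * cnj (z i))"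
      proof -
        have "of_real d * b = (\<Sum>i<n. (z0 i - z i) * cnj (z i))"
          using d by (simp add: b_def v_def sum_distrib_left)
        also have "\<dots> = (\<Sum>i<n. z0 i * cnj (z i)) - (\<Sum>i<n. z i * cnj (z i))"
          by (simp add: algebra_simps sum_subtractf)
        also have "(\<Sum>i<n. z i * cnj (z i)) = of_real a"
          by (simp only: a_def cnorm_power2 of_real_sum complex_norm_square)
        finally show ?thesis by (simp add: H_def)
      qed
      have "cmod (\<Sum>i<n. z0 i * cnj (z i)) \<le> (\<Sum>i<n. \<bar>cmod (z0 i)\<bar> * \<bar>cmod (z i)\<bar>)"
        by (rule order_trans[OF norm_sum]) (simp add: norm_mult)
      also have "\<dots> \<le> cnorm n z0 * cnorm n z"
        unfolding cnorm_def by (rule L2_set_mult_ineq)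
      finally have Hle: "cmod (H (of_real d)) \<le> 1 + cnorm n z0 * cnorm n z"
        unfolding Hd using norm_triangle_ineq4[of 1 "\<Sum>i<n. z0 i * cnj (z i)"] by simp
      have zlt: "cnorm n z0 < 1" "cnorm n z < 1" using z z0 st by auto
      then have Hnz: "H (of_real d) \<noteq> 0" using Hpos[of "of_real d"] d by (simp add: ptd)
      define x y where "x = cnorm n z0" and "y = cnorm n z"
      define h where "h = cmod (H (of_real d))"
      have xy: "0 \<le> x" "0 \<le> y" "x \<le> \<sigma>" "y \<le> \<tau>" "x < 1" "y < 1" and h: "0 < h" "h \<le> 1 + x * y"
        using z z0 zlt Hle Hnz by (auto simp: x_def y_def h_def)
      have id2: "d\<^sup>2 * S = h\<^sup>2 - (1 - y\<^sup>2) * (1 - x\<^sup>2)"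
        using ident[of "of_real d"] d by (simp add: ptd a_def x_def y_def h_def)
      have "\<rho> * (d * sqrt S) \<le> h"
        unfolding \<rho>_def
        by (rule pseudohyperbolic_bound[OF xy(1) xy(2) xy(3) xy(4) st h less_imp_le[OF S(2)] id2])
      moreover have "0 < \<rho> * (d * sqrt S)" using rho d S by simp
      ultimately have "ln (\<rho> * (d * sqrt S)) \<le> ln h" using h by simp
      moreover have "ln (\<rho> * (d * sqrt S)) = ln \<rho> + ln d + ln S / 2"
        using rho d S by (simp add: ln_mult ln_sqrt)
      ultimately show ?thesis using d by (simp add: G_def h_def)
    qed
    have cpos: "0 \<le> c" using A L by (simp add: c_def)
    have "ennreal (c * G (of_real d)) \<le> W (pt (of_real d))"
    proof (rule superharmonic_minorant[OF _ compK _ continuous_on_mult_left[OF contG]])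
      show "open {\<zeta>. k < W (pt \<zeta>)}" for k
        using open_vimage[OF _ contpt, of "{x. k < W x}"] W by (simp add: superh_def vimage_def)
      show "K \<subseteq> cball 0 2" using K0(3) by auto
      show "of_real d \<in> K" using d z0 st by (simp add: K_def ptd)
      fix p assume pK: "p \<in> K"
      then have p: "cnorm n (pt p) \<le> 1" "t \<le> cmod p" by (auto simp: K_def)
      consider "cnorm n (pt p) = 1" | "cnorm n (pt p) < 1" "cmod p = t" | "cnorm n (pt p) < 1" "t < cmod p"
        using p by linarith
      then show "ennreal (c * G p) \<le> W (pt p) \<or>
        (\<exists>r>0. cball p r \<subseteq> K \<and> (\<integral>\<^sup>+s\<in>{0..2*pi}. W (pt (p + of_real r * cis s)) \<partial>lborel) \<le> ennreal (2 * pi) * W (pt p) \<and>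
          ((\<lambda>s. c * G (p + of_real r * cis s)) has_integral (2 * pi * (c * G p))) {0..2*pi})"
      proof cases
        \<comment> \<open>On the boundary of the ball the Green function vanishes.\<close>
        case 1
        then have "(cmod (H p))\<^sup>2 = (cmod p)\<^sup>2 * S" using ident[of p] by simp
        then have "ln ((cmod (H p))\<^sup>2) = ln ((cmod p)\<^sup>2 * S)" by simp
        then have "2 * ln (cmod (H p)) = 2 * ln (cmod p) + ln S"
          using K0[OF pK] S by (simp add: ln_mult ln_realpow)
        then have "G p = 0" by (simp add: G_def)
        then show ?thesis by simp
      next
        case 2
        have "cmod (H p) \<le> 2"
        proof -
          have "cmod b \<le> (\<Sum>i<n. \<bar>cmod (v i)\<bar> * \<bar>cmod (z i)\<bar>)"
            unfolding b_def by (rule order_trans[OF norm_sum]) (simp add: norm_mult)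
          also have "\<dots> \<le> cnorm n v * cnorm n z"
            unfolding cnorm_def by (rule L2_set_mult_ineq)
          finally have "cmod b \<le> 1" using nv z st by simp
          then have "cmod p * cmod b \<le> 1" using 2 t by (simp add: mult_le_one)
          moreover have "cmod (H p) \<le> cmod (of_real (1 - a)) + cmod p * cmod b"
            unfolding H_def by (rule order_trans[OF norm_triangle_ineq4]) (simp add: norm_mult)
          moreover have "cmod (of_real (1 - a)) \<le> 1" using a by (simp add: del: of_real_diff)
          ultimately show ?thesis by linarith
        qed
        then have "ln (cmod (H p)) \<le> ln 2" using K0[OF pK] by simp
        moreover have "ln (1 - \<tau>\<^sup>2) \<le> ln S" using S a1 tau2 by simp
        ultimately have "G p \<le> L" using t 2 by (simp add: G_def L_def ln_div)
        then have "c * G p \<le> c * L" using cpos by (rule mult_left_mono)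
        also have "\<dots> = A" using L by (simp add: c_def)
        finally have "ennreal (c * G p) \<le> ennreal A" by (rule ennreal_leI)
        also have "\<dots> \<le> W (pt p)" using big[of "pt p"] ptC 2 ptz by simp
        finally show ?thesis by blast
      next
        case 3
        define r where "r = min ((cmod p - t) / 2) ((1 - cnorm n (pt p)) / 2)"
        have r: "0 < r" "r < cmod p - t" "r < 1 - cnorm n (pt p)" using 3 by (auto simp: r_def min_def field_simps)
        have disc: "cnorm n (pt (p + \<xi>)) < 1" "t \<le> cmod (p + \<xi>)" if "cmod \<xi> \<le> r" for \<xi>
        proof -
          have "pt (p + \<xi>) = (\<lambda>i. pt p i + \<xi> * v i)" by (simp add: pt_def algebra_simps)
          then have "cnorm n (pt (p + \<xi>)) \<le> cnorm n (pt p) + cmod \<xi> * cnorm n v"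
            using cnorm_triangle[of n "pt p" "\<lambda>i. \<xi> * v i"] cnorm_scale[of n \<xi> v] by simp
          then show "cnorm n (pt (p + \<xi>)) < 1" using that r nv by simp
          show "t \<le> cmod (p + \<xi>)" using norm_diff_ineq[of p \<xi>] that r by simp
        qed
        have sub: "cball p r \<subseteq> K"
        proof
          fix \<xi> assume "\<xi> \<in> cball p r"
          then have "cmod (\<xi> - p) \<le> r" by (simp add: dist_norm norm_minus_commute)
          from disc[OF this] show "\<xi> \<in> K" by (simp add: K_def)
        qed
        have eq: "(\<lambda>i. pt p i + \<zeta> * (of_real r * v i)) = pt (p + of_real r * \<zeta>)" for \<zeta>
          by (simp add: pt_def algebra_simps)
        have mean: "(\<integral>\<^sup>+s\<in>{0..2*pi}. W (pt (p + of_real r * cis s)) \<partial>lborel) \<le> ennreal (2 * pi) * W (pt p)"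
          unfolding eq[symmetric]
        proof (rule superh_circle[OF W ptC Cn_scale[OF vC]])
          fix \<zeta> :: complex assume "cmod \<zeta> \<le> 1"
          then have "cmod (of_real r * \<zeta>) \<le> r" using r by (simp add: norm_mult)
          from disc(1)[OF this] show "cnorm n (\<lambda>i. pt p i + \<zeta> * (of_real r * v i)) < 1" unfolding eq .
        qed
        have i1: "((\<lambda>s. ln (cmod (H p + (- of_real r * b) * cis s))) has_integral (2 * pi * ln (cmod (H p)))) {0..2*pi}"
        proof (rule has_integral_ln_cmod_circle, rule ccontr)
          assume "\<not> cmod (- of_real r * b) < cmod (H p)"
          then have le: "cmod (H p) \<le> r * cmod b" using r by (simp add: norm_mult)
          then have b0: "b \<noteq> 0" using K0[OF pK] by auto
          have "cmod (H p / b) \<le> r" using le b0 by (simp add: norm_divide divide_simps)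
          from disc[OF this] have "p + H p / b \<in> K" by (simp add: K_def)
          then have "H (p + H p / b) \<noteq> 0" by (rule K0)
          moreover have "H (p + H p / b) = 0" using b0 by (simp add: H_def field_simps)
          ultimately show False by simp
        qed
        have i2: "((\<lambda>s. ln (cmod (p + of_real r * cis s))) has_integral (2 * pi * ln (cmod p))) {0..2*pi}"
          by (rule has_integral_ln_cmod_circle) (use r t in simp)
        have ic: "((\<lambda>s. ln S / 2) has_integral (2 * pi * (ln S / 2))) {0..2*pi}"
          using has_integral_const_real[of "ln S / 2" 0 "2*pi"] by simp
        have "((\<lambda>s. c * (ln (cmod (H p + (- of_real r * b) * cis s)) - ln (cmod (p + of_real r * cis s)) - ln S / 2))
           has_integral (c * (2 * pi * ln (cmod (H p)) - 2 * pi * ln (cmod p) - 2 * pi * (ln S / 2)))) {0..2*pi}"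
          by (intro has_integral_diff has_integral_mult_right i1 i2 ic)
        moreover have eH: "H (p + of_real r * cis s) = H p + (- of_real r * b) * cis s" for s
          by (simp add: H_def algebra_simps)
        ultimately have "((\<lambda>s. c * G (p + of_real r * cis s)) has_integral (2 * pi * (c * G p))) {0..2*pi}"
          unfolding G_def eH by (simp add: algebra_simps)
        then show ?thesis using r(1) sub mean by blast
      qed
    qed
    moreover have "c * ln \<rho> \<le> c * G (of_real d)" using Gd cpos by (rule mult_left_mono)
    ultimately have "ennreal (c * ln \<rho>) \<le> W z0" unfolding ptd using ennreal_leI order_trans by blast
    moreover have "A / (1 + nu \<sigma> \<tau> * L) \<le> c * ln \<rho>"
    proof -
      have "0 \<le> A * (ln \<rho> * ln \<rho>)" using A lnrho by simp
      then show ?thesis using L lnrho by (simp add: c_def nu field_simps)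
    qed
    ultimately show ?thesis unfolding L_def growth_def using ennreal_leI order_trans by blast
  qed
qed

section \<open>Volume means\<close>

lemma AE_lebC_Cn: "AE x in lebC n. x \<in> Cn n"
proof -
  have "closed (Cn n)"
  proof -
    have "Cn n = (\<Inter>i\<in>{n..}. {x. x i = 0})" by (auto simp: Cn_def)
    also have "closed \<dots>"
      by (intro closed_INT ballI closed_Collect_eq continuous_on_product_coordinates continuous_on_const)
    finally show ?thesis .
  qed
  then have [measurable]: "Cn n \<in> sets borel" by simp
  show ?thesis
    unfolding lebC_def by (subst AE_distr_iff) auto
qed

lemma borel_measurable_funI:
  assumes "\<And>i. (\<lambda>x. f x i) \<in> borel_measurable M"
  shows "f \<in> M \<rightarrow>\<^sub>M (borel :: (nat \<Rightarrow> complex) measure)"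
proof -
  have "f \<in> M \<rightarrow>\<^sub>M PiM UNIV (\<lambda>_. borel)"
    by (rule measurable_PiM_single') (use assms in auto)
  then show ?thesis using measurable_cong_sets[OF refl sets_PiM_equal_borel] by blast
qed

lemma borel_measurable_coord [measurable (raw)]:
  assumes "f \<in> M \<rightarrow>\<^sub>M (borel :: (nat \<Rightarrow> complex) measure)"
  shows "(\<lambda>x. f x i) \<in> borel_measurable M"
proof -
  have "(\<lambda>x::nat \<Rightarrow> complex. x i) \<in> borel_measurable borel"
    by (intro borel_measurable_continuous_onI continuous_on_product_coordinates)
  from measurable_compose[OF assms this] show ?thesis .
qed

lemma borel_measurable_cnorm [measurable (raw)]:
  assumes [measurable]: "f \<in> M \<rightarrow>\<^sub>M (borel :: (nat \<Rightarrow> complex) measure)"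
  shows "(\<lambda>x. cnorm n (f x)) \<in> borel_measurable M"
  unfolding cnorm_def L2_set_def by measurable

lemma borel_measurable_cdist [measurable (raw)]:
  assumes [measurable]: "f \<in> M \<rightarrow>\<^sub>M (borel :: (nat \<Rightarrow> complex) measure)" "g \<in> M \<rightarrow>\<^sub>M borel"
  shows "(\<lambda>x. cdist n (f x) (g x)) \<in> borel_measurable M"
  unfolding cnorm_def L2_set_def by measurable

abbreviation mass_in_ball :: "nat \<Rightarrow> real \<Rightarrow> ((nat \<Rightarrow> complex) \<Rightarrow> ennreal) \<Rightarrow> ennreal" where
  "mass_in_ball n \<theta> W \<equiv> (\<integral>\<^sup>+x. W x * indicator {x. cnorm n x \<le> \<theta>} x \<partial>lebC n)"

text \<open>On each disc \<open>{w + \<zeta> x}\<close> the mean inequality holds for the bounding circle. Integration over \<open>x\<close> with a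
  rotation invariant weight turns the circle means into one volume mean.\<close>

lemma superh_radial_mean:
  assumes W: "superh n W" and w: "w \<in> Cn n" and [measurable]: "\<kappa> \<in> borel_measurable borel"
    and rot: "\<And>t x. \<kappa> (\<lambda>i. cis t * x i) = \<kappa> x" and supp: "\<And>x. \<kappa> x \<noteq> 0 \<Longrightarrow> cnorm n x \<le> s"
    and small: "cnorm n w + s < 1"
  shows "(\<integral>\<^sup>+x. W (\<lambda>i. w i + x i) * \<kappa> x \<partial>lebC n) \<le> W w * (\<integral>\<^sup>+x. \<kappa> x \<partial>lebC n)"
proof -
  interpret sf: sigma_finite_measure "lebC n" by (rule sigma_finite_lebC)
  interpret P: pair_sigma_finite lborel "lebC n" ..
  note [measurable] = superh_measurable[OF W]
  let ?I = "\<integral>\<^sup>+x. W (\<lambda>i. w i + x i) * \<kappa> x \<partial>lebC n"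
  have [measurable]: "(\<lambda>x. (\<lambda>i. w i + x i)) \<in> borel_measurable borel"
    by (rule borel_measurable_funI) measurable
  have m2 [measurable]: "(\<lambda>p. (\<lambda>i. w i + cis (fst p) * snd p i)) \<in> borel_measurable (lborel \<Otimes>\<^sub>M lebC n)"
  proof (rule borel_measurable_funI)
    fix i
    have [measurable]: "(\<lambda>t. cis t) \<in> borel_measurable borel"
      by (intro borel_measurable_continuous_onI continuous_intros)
    show "(\<lambda>p. w i + cis (fst p) * snd p i) \<in> borel_measurable (lborel \<Otimes>\<^sub>M lebC n)" by measurable
  qed
  have rotI: "(\<integral>\<^sup>+x. W (\<lambda>i. w i + cis t * x i) * \<kappa> x \<partial>lebC n) = ?I" for t
    using nn_integral_lebC_affine[of "\<lambda>x. W (\<lambda>i. w i + x i) * \<kappa> x" "cis t" "\<lambda>_. 0" n]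
    by (simp add: rot cis_neq_zero)
  have "ennreal (2 * pi) * ?I = (\<integral>\<^sup>+t\<in>{0..2*pi}. ?I \<partial>lborel)"
    by (subst nn_integral_cmult_indicator) (auto simp: mult.commute)
  also have "\<dots> = (\<integral>\<^sup>+t. \<integral>\<^sup>+x. W (\<lambda>i. w i + cis t * x i) * \<kappa> x * indicator {0..2*pi} t \<partial>lebC n \<partial>lborel)"
  proof (rule nn_integral_cong)
    fix t :: real
    have "(\<lambda>x. W (\<lambda>i. w i + cis t * x i) * \<kappa> x) \<in> borel_measurable (lebC n)"
    proof -
      have [measurable]: "(\<lambda>x. (\<lambda>i. w i + cis t * x i)) \<in> borel_measurable (lebC n)"
        by (rule borel_measurable_funI) measurable
      show ?thesis by measurable
    qed
    then show "?I * indicator {0..2*pi} t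
      = (\<integral>\<^sup>+x. W (\<lambda>i. w i + cis t * x i) * \<kappa> x * indicator {0..2*pi} t \<partial>lebC n)"
      by (subst nn_integral_multc) (auto simp: rotI)
  qed
  also have "\<dots> = (\<integral>\<^sup>+x. \<integral>\<^sup>+t. W (\<lambda>i. w i + cis t * x i) * \<kappa> x * indicator {0..2*pi} t \<partial>lborel \<partial>lebC n)"
  proof (rule P.Fubini'[symmetric])
    have [measurable]: "(\<lambda>p. indicator {0..2*pi} (fst p) :: ennreal) \<in> borel_measurable (lborel \<Otimes>\<^sub>M lebC n)"
      by measurable
    have "(\<lambda>p. W (\<lambda>i. w i + cis (fst p) * snd p i) * \<kappa> (snd p) * indicator {0..2*pi} (fst p))
        \<in> borel_measurable (lborel \<Otimes>\<^sub>M lebC n)" by measurable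
    then show "(\<lambda>(t, x). W (\<lambda>i. w i + cis t * x i) * \<kappa> x * indicator {0..2*pi} t)
        \<in> borel_measurable (lborel \<Otimes>\<^sub>M lebC n)" by (simp add: case_prod_beta')
  qed
  also have "\<dots> \<le> (\<integral>\<^sup>+x. ennreal (2 * pi) * W w * \<kappa> x \<partial>lebC n)"
  proof (rule nn_integral_mono_AE, use AE_lebC_Cn[of n] in eventually_elim)
    fix x assume x: "x \<in> Cn n"
    show "(\<integral>\<^sup>+t. W (\<lambda>i. w i + cis t * x i) * \<kappa> x * indicator {0..2*pi} t \<partial>lborel)
      \<le> ennreal (2 * pi) * W w * \<kappa> x"
    proof (cases "\<kappa> x = 0")
      case False
      have [measurable]: "(\<lambda>t. (\<lambda>i. w i + cis t * x i)) \<in> borel_measurable lborel"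
        by (intro borel_measurable_funI) (auto intro!: borel_measurable_continuous_onI continuous_intros)
      have "(\<integral>\<^sup>+t. W (\<lambda>i. w i + cis t * x i) * \<kappa> x * indicator {0..2*pi} t \<partial>lborel)
        = (\<integral>\<^sup>+t. \<kappa> x * (W (\<lambda>i. w i + cis t * x i) * indicator {0..2*pi} t) \<partial>lborel)"
        by (simp add: mult_ac)
      also have "\<dots> = \<kappa> x * (\<integral>\<^sup>+t\<in>{0..2*pi}. W (\<lambda>i. w i + cis t * x i) \<partial>lborel)"
        by (rule nn_integral_cmult) measurable
      also have "\<dots> \<le> \<kappa> x * (ennreal (2 * pi) * W w)"
      proof (intro mult_left_mono superh_circle[OF W w x])
        fix \<zeta> :: complex assume "cmod \<zeta> \<le> 1"
        then have "cmod \<zeta> * cnorm n x \<le> 1 * s" by (intro mult_mono supp False) auto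
        then show "cnorm n (\<lambda>i. w i + \<zeta> * x i) < 1"
          using cnorm_triangle[of n w "\<lambda>i. \<zeta> * x i"] cnorm_scale[of n \<zeta> x] small by simp
      qed simp
      finally show ?thesis by (simp add: mult_ac)
    qed simp
  qed
  also have "\<dots> = ennreal (2 * pi) * (W w * (\<integral>\<^sup>+x. \<kappa> x \<partial>lebC n))"
    by (subst nn_integral_cmult) (auto simp: mult.assoc)
  finally show ?thesis
    by (subst (asm) ennreal_mult_le_mult_iff) auto
qed

text \<open>Here \<open>q\<close> is the reciprocal of the squared radius. The square of the bump is the kernel of the volume means
  in use, and its cube is a test function of class \<open>C\<^sup>2\<close> whose Laplacian is proportional to the derivative, with respect
  to \<open>q\<close>, of the normalised kernel \<open>q\<^sup>n bump\<^sup>2\<close>. This is what makes means and masses comparable without a Riesz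
  measure.\<close>

definition bump :: "nat \<Rightarrow> real \<Rightarrow> (nat \<Rightarrow> complex) \<Rightarrow> (nat \<Rightarrow> complex) \<Rightarrow> real" where
  "bump n q z x = max 0 (1 - q * (cdist n x z)\<^sup>2)"

lemma borel_measurable_bump [measurable (raw)]:
  assumes [measurable]: "f \<in> M \<rightarrow>\<^sub>M (borel :: (nat \<Rightarrow> complex) measure)"
  shows "(\<lambda>x. bump n q z (f x)) \<in> borel_measurable M"
  unfolding bump_def by measurable

lemma bump_nonneg [simp]: "0 \<le> bump n q z x"
  and bump_le_1: "0 \<le> q \<Longrightarrow> bump n q z x \<le> 1"
  by (auto simp: bump_def)

lemma bump_nonzero:
  assumes "bump n q z x \<noteq> 0" "0 < q"
  shows "cdist n x z < 1 / sqrt q"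
proof (rule power2_less_imp_less)
  have "q * (cdist n x z)\<^sup>2 < 1" using assms by (auto simp: bump_def split: if_splits)
  then show "(cdist n x z)\<^sup>2 < (1 / sqrt q)\<^sup>2" using assms by (simp add: power_divide field_simps)
qed (use assms in auto)

definition bmass :: "nat \<Rightarrow> real" where
  "bmass n = enn2real (\<integral>\<^sup>+x. ennreal ((bump n 1 (\<lambda>_. 0) x)\<^sup>2) \<partial>lebC n)"

lemma bmass:
  "0 < bmass n" "(\<integral>\<^sup>+x. ennreal ((bump n 1 (\<lambda>_. 0) x)\<^sup>2) \<partial>lebC n) = ennreal (bmass n)"
proof -
  let ?N = "\<integral>\<^sup>+x. ennreal ((bump n 1 (\<lambda>_. 0) x)\<^sup>2) \<partial>lebC n"
  let ?D = "\<lambda>r. {x::nat \<Rightarrow> complex. \<forall>i<n. cmod (x i) \<le> r}"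
  have [measurable]: "?D r \<in> sets borel" for r by (rule emeasure_lebC_polydisc)
  have "?N \<le> (\<integral>\<^sup>+x. indicator (?D 1) x \<partial>lebC n)"
  proof (intro nn_integral_mono)
    fix x :: "nat \<Rightarrow> complex"
    show "ennreal ((bump n 1 (\<lambda>_. 0) x)\<^sup>2) \<le> indicator (?D 1) x"
    proof (cases "bump n 1 (\<lambda>_. 0) x = 0")
      case False
      then have "cnorm n x < 1" using bump_nonzero[OF False] by simp
      then have "x \<in> ?D 1" using cmod_le_cnorm[of _ n x] by force
      moreover have "(bump n 1 (\<lambda>_. 0) x)\<^sup>2 \<le> 1" using bump_le_1[of 1 n "\<lambda>_. 0" x] by (simp add: power_le_one)
      ultimately show ?thesis by simp
    qed simp
  qed
  also have "\<dots> < \<infinity>" using emeasure_lebC_polydisc_finite[of n 1] by simp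
  finally have fin: "?N < \<infinity>" .
  define r where "r = 1 / (2 * (real n + 1))"
  have r: "0 < r" "r \<le> 1" by (auto simp: r_def field_simps)
  have "0 < emeasure lborel (cball (0::complex) r)"
    using r by (simp add: emeasure_cball)
  then have "0 < emeasure (lebC n) (?D r)"
    unfolding emeasure_lebC_polydisc(2) by (metis power_not_zero zero_less_iff_neq_zero)
  then have "0 < ennreal (1/4) * emeasure (lebC n) (?D r)"
    by (subst ennreal_zero_less_mult_iff) simp
  also have "\<dots> = (\<integral>\<^sup>+x. ennreal (1/4) * indicator (?D r) x \<partial>lebC n)"
    by (subst nn_integral_cmult_indicator) auto
  also have "\<dots> \<le> ?N"
  proof (intro nn_integral_mono)
    fix x :: "nat \<Rightarrow> complex"
    show "ennreal (1/4) * indicator (?D r) x \<le> ennreal ((bump n 1 (\<lambda>_. 0) x)\<^sup>2)"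
    proof (cases "x \<in> ?D r")
      case True
      have "(cnorm n x)\<^sup>2 \<le> (\<Sum>i<n. r\<^sup>2)"
        unfolding cnorm_power2 using True r by (intro sum_mono power_mono) auto
      also have "\<dots> \<le> real n * (r * 1)" using r by (auto simp: power2_eq_square intro!: mult_left_mono)
      also have "\<dots> \<le> 1 / 2" by (simp add: r_def field_simps)
      finally have "1 / 2 \<le> bump n 1 (\<lambda>_. 0) x" by (simp add: bump_def)
      then have "(1 / 2)\<^sup>2 \<le> (bump n 1 (\<lambda>_. 0) x)\<^sup>2" by (intro power_mono) auto
      then have "ennreal (1 / 4) \<le> ennreal ((bump n 1 (\<lambda>_. 0) x)\<^sup>2)" by (intro ennreal_leI) (simp add: power2_eq_square)
      then show ?thesis using True by simp
    qed simp
  qed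
  finally have pos: "0 < ?N" .
  show "0 < bmass n" unfolding bmass_def using pos fin by (simp add: enn2real_positive_iff)
  show "?N = ennreal (bmass n)" unfolding bmass_def using fin by simp
qed

lemma nn_integral_bump_power2:
  assumes q: "0 < q" and z: "z \<in> Cn n"
  shows "(\<integral>\<^sup>+x. ennreal ((bump n q z x)\<^sup>2) \<partial>lebC n) = ennreal (bmass n / q ^ n)"
proof -
  let ?c = "of_real (sqrt q) :: complex"
  let ?I = "\<integral>\<^sup>+x. ennreal ((bump n q z x)\<^sup>2) \<partial>lebC n"
  have eq: "bump n 1 (\<lambda>_. 0) (\<lambda>i. ?c * x i + (- ?c * z i)) = bump n q z x" for x
  proof -
    have "(\<lambda>i. ?c * x i + (- ?c * z i) - 0) = (\<lambda>i. ?c * (x i - z i))" by (simp add: algebra_simps)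
    then show ?thesis using q cnorm_scale[of n ?c "\<lambda>i. x i - z i"]
      by (simp add: bump_def power_mult_distrib)
  qed
  have "ennreal (cmod ?c ^ (2 * n)) * ?I = ennreal (bmass n)"
    using nn_integral_lebC_affine[of "\<lambda>x. ennreal ((bump n 1 (\<lambda>_. 0) x)\<^sup>2)" ?c "\<lambda>i. - ?c * z i" n]
      q Cn_scale[OF z, of "- ?c"]
    by (simp only: eq bmass) simp
  moreover have "cmod ?c ^ (2 * n) = q ^ n" using q by (simp add: power_mult)
  ultimately have *: "ennreal (q ^ n) * ?I = ennreal (bmass n)" by simp
  have "?I = ennreal (1 / q ^ n) * (ennreal (q ^ n) * ?I)"
    using q by (simp add: mult.assoc[symmetric] ennreal_mult[symmetric])
  also have "\<dots> = ennreal (bmass n / q ^ n)"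
    unfolding * using q bmass(1)[of n] by (subst ennreal_mult[symmetric]) auto
  finally show ?thesis .
qed

lemma superh_bump_mean:
  assumes W: "superh n W" and w: "w \<in> Cn n" and q: "0 < q" and small: "cnorm n w + 1 / sqrt q < 1"
  shows "(\<integral>\<^sup>+x. W x * ennreal ((bump n q w x)\<^sup>2) \<partial>lebC n) \<le> W w * ennreal (bmass n / q ^ n)"
proof -
  note [measurable] = superh_measurable[OF W]
  have sh: "bump n q w (\<lambda>i. w i + x i) = bump n q (\<lambda>_. 0) x" for x by (simp add: bump_def)
  have "(\<integral>\<^sup>+x. W x * ennreal ((bump n q w x)\<^sup>2) \<partial>lebC n)
     = (\<integral>\<^sup>+x. W (\<lambda>i. w i + x i) * ennreal ((bump n q (\<lambda>_. 0) x)\<^sup>2) \<partial>lebC n)"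
    using nn_integral_lebC_affine[of "\<lambda>x. W x * ennreal ((bump n q w x)\<^sup>2)" 1 w n] w
    by (simp add: add.commute[of _ "w _"] sh)
  also have "\<dots> \<le> W w * (\<integral>\<^sup>+x. ennreal ((bump n q (\<lambda>_. 0) x)\<^sup>2) \<partial>lebC n)"
  proof (rule superh_radial_mean[OF W w _ _ _ small])
    show "ennreal ((bump n q (\<lambda>_. 0) (\<lambda>i. cis t * x i))\<^sup>2) = ennreal ((bump n q (\<lambda>_. 0) x)\<^sup>2)" for t x
      using cnorm_scale[of n "cis t" x] by (simp add: bump_def)
    show "cnorm n x \<le> 1 / sqrt q" if "ennreal ((bump n q (\<lambda>_. 0) x)\<^sup>2) \<noteq> 0" for x
      using that bump_nonzero[of n q "\<lambda>_. 0" x] q by (cases "bump n q (\<lambda>_. 0) x = 0") auto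
  qed measurable
  finally show ?thesis using nn_integral_bump_power2[OF q, of "\<lambda>_. 0" n] by simp
qed

text \<open>A mean around \<open>z\<close> is dominated by one around a point \<open>w\<close> at distance \<open>\<theta> s\<close>, with a loss that tends to \<open>1\<close>
  with \<open>\<theta>\<close>. In units of \<open>s\<close>, everything reduces to \<open>(y + \<theta>)\<^sup>2 \<le> (1 + \<theta>) (y\<^sup>2 + \<theta>)\<close>.\<close>

lemma bump_recentre:
  assumes "0 < s" "0 < \<theta>" "cdist n w z \<le> \<theta> * s"
  shows "bump n (1 / s\<^sup>2) z x \<le> (1 + \<theta>) * bump n (1 / ((1 + \<theta>) * s)\<^sup>2) w x"
proof -
  define y where "y = cdist n x z / s"
  define u where "u = cdist n x w / s"
  have u: "0 \<le> u" "u \<le> y + \<theta>" "0 \<le> y"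
    using cdist_triangle[of n x w z] assms cdist_commute[of n w z]
    by (auto simp: u_def y_def field_simps)
  then have "u\<^sup>2 \<le> (y + \<theta>)\<^sup>2" by (intro power_mono)
  also have "(y + \<theta>)\<^sup>2 \<le> (1 + \<theta>) * (y\<^sup>2 + \<theta>)"
  proof -
    have "(1 + \<theta>) * (y\<^sup>2 + \<theta>) - (y + \<theta>)\<^sup>2 = \<theta> * (y - 1)\<^sup>2" by (simp add: power2_eq_square algebra_simps)
    moreover have "0 \<le> \<theta> * (y - 1)\<^sup>2" using assms by simp
    ultimately show ?thesis by linarith
  qed
  finally have "u\<^sup>2 / (1 + \<theta>) \<le> y\<^sup>2 + \<theta>"
    using assms by (subst pos_divide_le_eq) (simp_all add: mult.commute)
  moreover have "(1 + \<theta>) * (1 - u\<^sup>2 / (1 + \<theta>)\<^sup>2) = 1 + \<theta> - u\<^sup>2 / (1 + \<theta>)"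
  proof -
    have "(1 + \<theta>) * (1 - X / (1 + \<theta>)\<^sup>2) = 1 + \<theta> - X / (1 + \<theta>)" for X
      using assms by (simp add: right_diff_distrib power2_eq_square)
    then show ?thesis .
  qed
  ultimately have "1 - y\<^sup>2 \<le> (1 + \<theta>) * (1 - u\<^sup>2 / (1 + \<theta>)\<^sup>2)"
    by linarith
  then have "max 0 (1 - y\<^sup>2) \<le> (1 + \<theta>) * max 0 (1 - u\<^sup>2 / (1 + \<theta>)\<^sup>2)"
    using assms by (intro max.boundedI) (auto intro: order_trans mult_left_mono)
  then show ?thesis unfolding bump_def y_def u_def
    by (simp add: power_divide power_mult_distrib mult.commute)
qed

text \<open>The growth estimate, read backwards: near every point there are points where the function is not large.\<close>

lemma superh_small_value:
  assumes W: "superh n W" and z: "z \<in> Cn n" "cnorm n z \<le> \<tau>"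
    and z0: "z0 \<in> Cn n" "cnorm n z0 \<le> \<sigma>" "W z0 \<le> 1"
    and st: "0 < \<sigma>" "\<sigma> < 1" "0 < \<tau>" "\<tau> < 1" and t: "0 < t" "t < 1" and D: "growth \<sigma> \<tau> t < D"
  obtains w where "w \<in> Cn n" "cnorm n w < 1" "cdist n w z \<le> t" "W w < ennreal D"
proof -
  have g: "1 \<le> growth \<sigma> \<tau> t" by (rule growth_ge_1) fact+
  have "\<exists>w\<in>Cn n. cnorm n w < 1 \<and> cdist n w z \<le> t \<and> W w < ennreal D"
  proof (rule ccontr)
    assume *: "\<not> ?thesis"
    have "ennreal (D / growth \<sigma> \<tau> t) \<le> W z0"
    proof (rule superh_log_growth[OF W z z0(1,2) st t])
      show "0 \<le> D" using g D by simp
      show "ennreal D \<le> W w" if "w \<in> Cn n" "cnorm n w < 1" "cdist n w z \<le> t" for w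
        using * that by (meson not_le)
    qed
    also have "\<dots> \<le> ennreal 1" using z0 by simp
    finally have "D / growth \<sigma> \<tau> t \<le> 1" by (subst (asm) ennreal_le_iff) auto
    then show False using g D by (simp add: divide_le_eq)
  qed
  then show thesis using that by blast
qed

text \<open>The mean over a ball of radius almost 1 around a point close to the origin, at which the value is
  controlled, dominates the integral over a slightly smaller concentric ball.\<close>

lemma superh_L1_bound:
  assumes st: "0 < \<sigma>" "\<sigma> < 1" "0 < \<tau>" "\<tau> < 1"
  obtains K where "0 < K"
    "\<And>W z0. superh n W \<Longrightarrow> z0 \<in> Cn n \<Longrightarrow> cnorm n z0 \<le> \<sigma> \<Longrightarrow> W z0 \<le> 1 \<Longrightarrow>
      mass_in_ball n ((1 + \<tau>) / 2) W \<le> ennreal K"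
proof -
  \<comment> \<open>Steps of length \<open>t\<close> leave room between \<open>\<tau> = 1 - 8 t\<close>, the radius \<open>1 - 4 t = (1 + \<tau>) / 2\<close> and the unit sphere.\<close>
  define t where "t = (1 - \<tau>) / 8"
  define q where "q = 1 / (1 - 2 * t)\<^sup>2"
  define c where "c = (1 - ((1 - 3 * t) / (1 - 2 * t))\<^sup>2)\<^sup>2"
  define D where "D = growth \<sigma> \<tau> t + 1"
  define K where "K = (1 / c) * (D * (bmass n / q ^ n))"
  have t: "0 < t" "t < 1/8" "\<tau> = 1 - 8 * t" using st by (auto simp: t_def field_simps)
  have q: "0 < q" "1 / sqrt q = 1 - 2 * t" using t by (auto simp: q_def real_sqrt_divide)
  have "((1 - 3 * t) / (1 - 2 * t))\<^sup>2 < 1\<^sup>2"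
    using t by (intro power_strict_mono) (auto simp: field_simps)
  then have c: "0 < c" by (simp add: c_def)
  have D: "1 < D" using growth_ge_1[OF st, of t] t by (simp add: D_def)
  show thesis
  proof (rule that[of K])
    show "0 < K" using c D q bmass(1)[of n] by (simp add: K_def)
    fix W z0 assume W: "superh n W" and z0: "z0 \<in> Cn n" "cnorm n z0 \<le> \<sigma>" "W z0 \<le> 1"
    note [measurable] = superh_measurable[OF W]
    obtain w where w: "w \<in> Cn n" "cdist n w (\<lambda>_. 0) \<le> t" "W w < ennreal D"
      using superh_small_value[OF W zero_in_Cn _ z0 st, of t D] t st by (auto simp: D_def)
    have "mass_in_ball n ((1 + \<tau>) / 2) W
       \<le> (\<integral>\<^sup>+x. ennreal (1 / c) * (W x * ennreal ((bump n q w x)\<^sup>2)) \<partial>lebC n)"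
    proof (intro nn_integral_mono)
      fix x
      show "W x * indicator {x. cnorm n x \<le> (1 + \<tau>) / 2} x \<le> ennreal (1 / c) * (W x * ennreal ((bump n q w x)\<^sup>2))"
      proof (cases "cnorm n x \<le> (1 + \<tau>) / 2")
        case True
        then have "cdist n x w \<le> 1 - 3 * t" using cdist_le_cnorm[of n x w] w t by simp
        then have "(cdist n x w)\<^sup>2 \<le> (1 - 3 * t)\<^sup>2" by (intro power_mono) auto
        then have "q * (cdist n x w)\<^sup>2 \<le> ((1 - 3 * t) / (1 - 2 * t))\<^sup>2"
          using t by (simp add: q_def power_divide divide_right_mono)
        then have "1 - ((1 - 3 * t) / (1 - 2 * t))\<^sup>2 \<le> bump n q w x" by (simp add: bump_def)
        moreover have "0 \<le> 1 - ((1 - 3 * t) / (1 - 2 * t))\<^sup>2"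
          using \<open>((1 - 3 * t) / (1 - 2 * t))\<^sup>2 < 1\<^sup>2\<close> by simp
        ultimately have "c \<le> (bump n q w x)\<^sup>2" unfolding c_def by (intro power_mono)
        then have "ennreal 1 \<le> ennreal (1 / c * (bump n q w x)\<^sup>2)" using c by (intro ennreal_leI) (simp add: field_simps)
        then have "1 \<le> ennreal (1 / c) * ennreal ((bump n q w x)\<^sup>2)"
          using c by (simp add: ennreal_mult[symmetric] del: times_divide_eq_left)
        from mult_left_mono[OF this, of "W x"] True show ?thesis by (simp add: mult_ac)
      qed simp
    qed
    also have "\<dots> = ennreal (1 / c) * (\<integral>\<^sup>+x. W x * ennreal ((bump n q w x)\<^sup>2) \<partial>lebC n)"
      by (rule nn_integral_cmult) measurable
    also have "\<dots> \<le> ennreal (1 / c) * (W w * ennreal (bmass n / q ^ n))"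
      using w t q by (intro mult_left_mono superh_bump_mean[OF W]) auto
    also have "\<dots> \<le> ennreal (1 / c) * (ennreal D * ennreal (bmass n / q ^ n))"
      using w by (intro mult_left_mono mult_right_mono) auto
    also have "\<dots> = ennreal K"
      using c D q bmass(1)[of n] by (simp add: K_def ennreal_mult[symmetric] del: times_divide_eq_left times_divide_eq_right)
    finally show "mass_in_ball n ((1 + \<tau>) / 2) W \<le> ennreal K" .
  qed
qed

text \<open>The value of \<open>W\<close> at \<open>z\<close> may be infinite, but some point at distance \<open>\<theta> s\<close> has a value of size \<open>growth\<close>, and
  recentring the mean there costs a power of \<open>1 + \<theta>\<close> only. Since \<open>\<theta>\<close> is at one's disposal, the factor \<open>nu \<sigma> \<tau>\<close> in front
  of \<open>ln (1/s)\<close> is preserved up to an arbitrarily small error.\<close>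

lemma superh_mean_bound:
  assumes W: "superh n W" and z: "z \<in> Cn n" "cnorm n z \<le> \<tau>"
    and z0: "z0 \<in> Cn n" "cnorm n z0 \<le> \<sigma>" "W z0 \<le> 1"
    and st: "0 < \<sigma>" "\<sigma> < 1" "0 < \<tau>" "\<tau> < 1"
    and s: "0 < s" "\<tau> + 3 * s < 1" and \<theta>: "0 < \<theta>" "\<theta> \<le> 1"
  shows "(\<integral>\<^sup>+x. W x * ennreal ((bump n (1 / s\<^sup>2) z x)\<^sup>2) \<partial>lebC n)
    \<le> ennreal ((1 + \<theta>) ^ (2 * n + 2) * (growth \<sigma> \<tau> (\<theta> * s) + 1) * bmass n * s ^ (2 * n))"
proof -
  define D where "D = growth \<sigma> \<tau> (\<theta> * s) + 1"
  define q where "q = 1 / ((1 + \<theta>) * s)\<^sup>2"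
  note [measurable] = superh_measurable[OF W]
  have ts: "0 < \<theta> * s" "\<theta> * s \<le> s" using s \<theta> by auto
  then have ts1: "\<theta> * s < 1" using s st by linarith
  obtain w where w: "w \<in> Cn n" "cdist n w z \<le> \<theta> * s" "W w < ennreal D"
    using superh_small_value[OF W z z0 st ts(1) ts1, of D] by (auto simp: D_def)
  have D: "1 < D" using growth_ge_1[OF st ts(1) ts1] by (simp add: D_def)
  have q: "0 < q" "1 / sqrt q = (1 + \<theta>) * s" using s \<theta> by (auto simp: q_def real_sqrt_divide)
  have "(\<integral>\<^sup>+x. W x * ennreal ((bump n (1 / s\<^sup>2) z x)\<^sup>2) \<partial>lebC n)
     \<le> (\<integral>\<^sup>+x. ennreal ((1 + \<theta>)\<^sup>2) * (W x * ennreal ((bump n q w x)\<^sup>2)) \<partial>lebC n)"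
  proof (intro nn_integral_mono)
    fix x
    have "(bump n (1 / s\<^sup>2) z x)\<^sup>2 \<le> ((1 + \<theta>) * bump n q w x)\<^sup>2"
      unfolding q_def by (intro power_mono bump_recentre s \<theta> w bump_nonneg)
    then have "ennreal ((bump n (1 / s\<^sup>2) z x)\<^sup>2) \<le> ennreal ((1 + \<theta>)\<^sup>2) * ennreal ((bump n q w x)\<^sup>2)"
      by (subst ennreal_mult[symmetric]) (auto simp: power_mult_distrib intro: ennreal_leI)
    from mult_left_mono[OF this, of "W x"]
    show "W x * ennreal ((bump n (1 / s\<^sup>2) z x)\<^sup>2) \<le> ennreal ((1 + \<theta>)\<^sup>2) * (W x * ennreal ((bump n q w x)\<^sup>2))"
      by (simp add: mult_ac)
  qed
  also have "\<dots> = ennreal ((1 + \<theta>)\<^sup>2) * (\<integral>\<^sup>+x. W x * ennreal ((bump n q w x)\<^sup>2) \<partial>lebC n)"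
    by (rule nn_integral_cmult) measurable
  also have "\<dots> \<le> ennreal ((1 + \<theta>)\<^sup>2) * (W w * ennreal (bmass n / q ^ n))"
  proof (intro mult_left_mono superh_bump_mean[OF W w(1) q(1)])
    have "cnorm n w \<le> \<tau> + \<theta> * s" using cnorm_le_cdist[of n w z] w z by simp
    then show "cnorm n w + 1 / sqrt q < 1" using q s ts by (simp add: algebra_simps)
  qed simp
  also have "\<dots> \<le> ennreal ((1 + \<theta>)\<^sup>2) * (ennreal D * ennreal (bmass n / q ^ n))"
    using w by (intro mult_left_mono mult_right_mono) auto
  also have "\<dots> = ennreal ((1 + \<theta>)\<^sup>2 * (D * (bmass n / q ^ n)))"
    using \<theta> D q bmass(1)[of n]
    by (simp add: ennreal_mult del: times_divide_eq_left times_divide_eq_right)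
  also have "(1 + \<theta>)\<^sup>2 * (D * (bmass n / q ^ n)) = (1 + \<theta>) ^ (2 * n + 2) * (growth \<sigma> \<tau> (\<theta> * s) + 1) * bmass n * s ^ (2 * n)"
    unfolding D_def[symmetric] by (simp add: q_def power_divide power_mult_distrib power_mult power_add power2_eq_square)
  finally show ?thesis .
qed

section \<open>The Laplacian of a superharmonic function\<close>

text \<open>The second-order expansion of the cube of the positive part, with a remainder that is unaffected by the kink.\<close>

lemma cube_taylor:
  fixes u d :: real
  shows "\<bar>(max 0 (u - d)) ^ 3 - ((max 0 u) ^ 3 - 3 * (max 0 u)\<^sup>2 * d + 3 * max 0 u * d\<^sup>2)\<bar> \<le> \<bar>d\<bar> ^ 3"
proof -
  have id: "(u - d) ^ 3 = u ^ 3 - 3 * u\<^sup>2 * d + 3 * u * d\<^sup>2 - d ^ 3"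
    by (simp add: power2_eq_square power3_eq_cube algebra_simps)
  consider "0 \<le> u" "d \<le> u" | "0 \<le> u" "u < d" | "u < 0" "d \<le> u" | "u < 0" "u < d" by linarith
  then show ?thesis
  proof cases
    case 1
    then show ?thesis using id by (simp add: max_def power_abs)
  next
    case 2
    have "0 \<le> (d - u) ^ 3" "(d - u) ^ 3 \<le> d ^ 3" using 2 by (auto intro: power_mono)
    moreover have "(d - u) ^ 3 = - ((u - d) ^ 3)" by (simp add: power3_eq_cube algebra_simps)
    ultimately show ?thesis using 2 id by (simp add: max_def)
  next
    case 3
    have "0 \<le> (u - d) ^ 3" "(u - d) ^ 3 \<le> (- d) ^ 3"
      using 3 by (auto intro!: power_mono simp del: power_minus_odd)
    then show ?thesis using 3 by (simp add: max_def)
  next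
    case 4
    then show ?thesis by (simp add: max_def)
  qed
qed

text \<open>A discrete form of \<open>\<integral> W \<Delta>F \<le> 0\<close>: the means of \<open>W\<close> over circles in one coordinate do not exceed \<open>W\<close>, and
  translation invariance moves them from \<open>W\<close> to \<open>F\<close>.\<close>

lemma superh_coordinate_mean:
  assumes W: "superh n W" and i: "i < n" and \<epsilon>: "0 \<le> \<epsilon>" and [measurable]: "F \<in> borel_measurable borel"
    and supp: "\<And>x. F x \<noteq> 0 \<Longrightarrow> cnorm n x \<le> \<rho>" and small: "\<rho> + \<epsilon> < 1"
  shows "(\<integral>\<^sup>+x. W x * (\<integral>\<^sup>+t\<in>{0..2*pi}. F (\<lambda>j. x j - (if j = i then of_real \<epsilon> * cis t else 0)) \<partial>lborel) \<partial>lebC n)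
    \<le> ennreal (2 * pi) * (\<integral>\<^sup>+x. W x * F x \<partial>lebC n)"
proof -
  interpret sf: sigma_finite_measure "lebC n" by (rule sigma_finite_lebC)
  interpret P: pair_sigma_finite lborel "lebC n" ..
  note [measurable] = superh_measurable[OF W]
  define e where "e = (\<lambda>t::real. \<lambda>j. if j = i then of_real \<epsilon> * cis t else (0::complex))"
  have eC: "e t \<in> Cn n" for t using i by (auto simp: e_def Cn_def)
  have [measurable]: "(\<lambda>t. cis t) \<in> borel_measurable borel"
    by (intro borel_measurable_continuous_onI continuous_intros)
  have me [measurable]: "(\<lambda>t. e t j) \<in> borel_measurable lborel" for j
    by (cases "j = i") (simp_all add: e_def)
  have m1 [measurable]: "(\<lambda>p. (\<lambda>j. snd p j - e (fst p) j)) \<in> borel_measurable (lborel \<Otimes>\<^sub>M lebC n)"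
    by (rule borel_measurable_funI) measurable
  have m2 [measurable]: "(\<lambda>p. (\<lambda>j. snd p j + e (fst p) j)) \<in> borel_measurable (lborel \<Otimes>\<^sub>M lebC n)"
    by (rule borel_measurable_funI) measurable
  have m3 [measurable]: "(\<lambda>t. (\<lambda>j. x j - e t j)) \<in> borel_measurable lborel"
      "(\<lambda>t. (\<lambda>j. x j + e t j)) \<in> borel_measurable lborel" for x
    by (intro borel_measurable_funI borel_measurable_diff borel_measurable_add borel_measurable_const me)+
  have m4 [measurable]: "(\<lambda>x. (\<lambda>j. x j - e t j)) \<in> borel_measurable borel" for t
    by (rule borel_measurable_funI) measurable
  have shift: "(\<integral>\<^sup>+x. W x * F (\<lambda>j. x j - e t j) \<partial>lebC n) = (\<integral>\<^sup>+x. W (\<lambda>j. x j + e t j) * F x \<partial>lebC n)" for t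
    using nn_integral_lebC_affine[of "\<lambda>x. W x * F (\<lambda>j. x j - e t j)" 1 "e t" n] eC by simp
  have "(\<integral>\<^sup>+x. W x * (\<integral>\<^sup>+t\<in>{0..2*pi}. F (\<lambda>j. x j - e t j) \<partial>lborel) \<partial>lebC n)
     = (\<integral>\<^sup>+x. \<integral>\<^sup>+t. W x * F (\<lambda>j. x j - e t j) * indicator {0..2*pi} t \<partial>lborel \<partial>lebC n)"
    by (intro nn_integral_cong, subst nn_integral_cmult[symmetric]) (auto simp: mult.assoc)
  also have "\<dots> = (\<integral>\<^sup>+t. \<integral>\<^sup>+x. W x * F (\<lambda>j. x j - e t j) * indicator {0..2*pi} t \<partial>lebC n \<partial>lborel)"
  proof (rule P.Fubini')
    have "(\<lambda>p. W (snd p) * F (\<lambda>j. snd p j - e (fst p) j) * indicator {0..2*pi} (fst p))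
        \<in> borel_measurable (lborel \<Otimes>\<^sub>M lebC n)" by measurable
    then show "(\<lambda>(t, x). W x * F (\<lambda>j. x j - e t j) * indicator {0..2*pi} t)
        \<in> borel_measurable (lborel \<Otimes>\<^sub>M lebC n)" by (simp add: case_prod_beta')
  qed
  also have "\<dots> = (\<integral>\<^sup>+t. \<integral>\<^sup>+x. W (\<lambda>j. x j + e t j) * F x * indicator {0..2*pi} t \<partial>lebC n \<partial>lborel)"
  proof (rule nn_integral_cong)
    fix t :: real
    show "(\<integral>\<^sup>+x. W x * F (\<lambda>j. x j - e t j) * indicator {0..2*pi} t \<partial>lebC n)
       = (\<integral>\<^sup>+x. W (\<lambda>j. x j + e t j) * F x * indicator {0..2*pi} t \<partial>lebC n)"
      using shift[of t] by (cases "t \<in> {0..2*pi}") simp_all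
  qed
  also have "\<dots> = (\<integral>\<^sup>+x. \<integral>\<^sup>+t. W (\<lambda>j. x j + e t j) * F x * indicator {0..2*pi} t \<partial>lborel \<partial>lebC n)"
  proof (rule P.Fubini'[symmetric])
    have "(\<lambda>p. W (\<lambda>j. snd p j + e (fst p) j) * F (snd p) * indicator {0..2*pi} (fst p))
        \<in> borel_measurable (lborel \<Otimes>\<^sub>M lebC n)" by measurable
    then show "(\<lambda>(t, x). W (\<lambda>j. x j + e t j) * F x * indicator {0..2*pi} t)
        \<in> borel_measurable (lborel \<Otimes>\<^sub>M lebC n)" by (simp add: case_prod_beta')
  qed
  also have "\<dots> \<le> (\<integral>\<^sup>+x. ennreal (2 * pi) * (W x * F x) \<partial>lebC n)"
  proof (rule nn_integral_mono_AE, use AE_lebC_Cn[of n] in eventually_elim)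
    fix x assume x: "x \<in> Cn n"
    let ?u = "\<lambda>j. if j = i then of_real \<epsilon> else (0::complex)"
    have eu: "e t = (\<lambda>j. cis t * ?u j)" for t by (auto simp: e_def)
    have uC: "?u \<in> Cn n" using i by (auto simp: Cn_def)
    have nu: "cnorm n ?u \<le> \<epsilon>"
    proof -
      have "(cnorm n ?u)\<^sup>2 = (\<Sum>j<n. if j = i then \<epsilon>\<^sup>2 else 0)"
        unfolding cnorm_power2 by (rule sum.cong) auto
      also have "\<dots> = \<epsilon>\<^sup>2" using i by simp
      finally have "cnorm n ?u = \<epsilon>" by (rule power2_eq_imp_eq[OF _ cnorm_nonneg \<epsilon>])
      then show ?thesis by (rule eq_refl)
    qed
    show "(\<integral>\<^sup>+t. W (\<lambda>j. x j + e t j) * F x * indicator {0..2*pi} t \<partial>lborel) \<le> ennreal (2 * pi) * (W x * F x)"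
    proof (cases "F x = 0")
      case False
      have "(\<integral>\<^sup>+t. W (\<lambda>j. x j + e t j) * F x * indicator {0..2*pi} t \<partial>lborel)
         = (\<integral>\<^sup>+t. F x * (W (\<lambda>j. x j + e t j) * indicator {0..2*pi} t) \<partial>lborel)"
        by (simp add: mult_ac)
      also have "\<dots> = F x * (\<integral>\<^sup>+t\<in>{0..2*pi}. W (\<lambda>j. x j + e t j) \<partial>lborel)"
        by (rule nn_integral_cmult) measurable
      also have "\<dots> \<le> F x * (ennreal (2 * pi) * W x)"
        unfolding eu
      proof (intro mult_left_mono superh_circle[OF W x uC])
        fix \<zeta> :: complex assume "cmod \<zeta> \<le> 1"
        then have "cmod \<zeta> * cnorm n ?u \<le> 1 * \<epsilon>" using nu by (intro mult_mono) auto
        then show "cnorm n (\<lambda>j. x j + \<zeta> * ?u j) < 1"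
          using cnorm_triangle[of n x "\<lambda>i. \<zeta> * ?u i"] cnorm_scale[of n \<zeta> ?u] small supp[OF False] by simp
      qed simp
      finally show ?thesis by (simp add: mult_ac)
    qed simp
  qed
  also have "\<dots> = ennreal (2 * pi) * (\<integral>\<^sup>+x. W x * F x \<partial>lebC n)"
    by (rule nn_integral_cmult) measurable
  finally show ?thesis unfolding e_def .
qed

text \<open>If \<open>W\<close> has finite mass in the ball, the value \<open>\<infinity>\<close>, which becomes 0 here, is taken on a null set only.\<close>

definition wloc :: "nat \<Rightarrow> real \<Rightarrow> ((nat \<Rightarrow> complex) \<Rightarrow> ennreal) \<Rightarrow> (nat \<Rightarrow> complex) \<Rightarrow> real" where
  "wloc n \<theta> W x = enn2real (W x) * indicator {x. cnorm n x \<le> \<theta>} x"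

text \<open>The Laplacian of \<open>bump\<^sup>3\<close> is \<open>- 12 q\<close> times the kernel in this integral. For superharmonic \<open>w\<close> the number
  \<open>q * lapl n w q z\<close> therefore measures the Riesz mass of \<open>w\<close> near \<open>z\<close> at scale \<open>1 / \<surd>q\<close>.\<close>

definition lapl :: "nat \<Rightarrow> ((nat \<Rightarrow> complex) \<Rightarrow> real) \<Rightarrow> real \<Rightarrow> (nat \<Rightarrow> complex) \<Rightarrow> real" where
  "lapl n w q z = (\<integral>x. w x * (real n * (bump n q z x)\<^sup>2 - 2 * (q * (cdist n x z)\<^sup>2) * bump n q z x) \<partial>lebC n)"

lemma wloc_nonneg [simp]: "0 \<le> wloc n \<theta> W x"
  by (simp add: wloc_def)

lemma wloc_measurable:
  assumes W: "superh n W"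
  shows "wloc n \<theta> W \<in> borel_measurable (lebC n)"
proof -
  note [measurable] = superh_measurable[OF W]
  show ?thesis unfolding wloc_def by measurable
qed

lemma AE_wloc:
  assumes W: "superh n W"
    and fin: "mass_in_ball n \<theta> W \<noteq> \<infinity>"
  shows "AE x in lebC n. W x * indicator {x. cnorm n x \<le> \<theta>} x = ennreal (wloc n \<theta> W x)"
proof -
  note [measurable] = superh_measurable[OF W]
  have "AE x in lebC n. W x * indicator {x. cnorm n x \<le> \<theta>} x \<noteq> \<infinity>"
    by (rule nn_integral_PInf_AE) (use fin in auto)
  then show ?thesis
  proof eventually_elim
    case (elim x)
    then show ?case by (cases "cnorm n x \<le> \<theta>") (auto simp: wloc_def less_top)
  qed
qed

lemma nn_integral_wloc:
  assumes W: "superh n W"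
    and fin: "mass_in_ball n \<theta> W \<noteq> \<infinity>"
    and h: "\<And>x. h x \<noteq> 0 \<Longrightarrow> cnorm n x \<le> \<theta>"
  shows "(\<integral>\<^sup>+x. W x * ennreal (h x) \<partial>lebC n) = (\<integral>\<^sup>+x. ennreal (wloc n \<theta> W x * h x) \<partial>lebC n)"
proof (rule nn_integral_cong_AE, use AE_wloc[OF W fin] in eventually_elim)
  case (elim x)
  show ?case
  proof (cases "h x = 0")
    case False
    then have "W x = ennreal (wloc n \<theta> W x)" using elim h[of x] by simp
    then show ?thesis by (simp add: ennreal_mult')
  qed simp
qed

lemma wloc_integrable:
  assumes W: "superh n W"
    and fin: "mass_in_ball n \<theta> W \<noteq> \<infinity>"
  shows "integrable (lebC n) (wloc n \<theta> W)"
proof (rule integrableI_nonneg)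
  show "wloc n \<theta> W \<in> borel_measurable (lebC n)" by (rule wloc_measurable[OF W])
  have "(\<integral>\<^sup>+x. ennreal (wloc n \<theta> W x) \<partial>lebC n) = mass_in_ball n \<theta> W"
    by (rule nn_integral_cong_AE) (use AE_wloc[OF W fin] in auto)
  then show "(\<integral>\<^sup>+x. ennreal (wloc n \<theta> W x) \<partial>lebC n) < \<infinity>" using fin by (simp add: less_top)
qed auto

lemma wloc_mult_integrable:
  assumes W: "superh n W"
    and fin: "mass_in_ball n \<theta> W \<noteq> \<infinity>"
    and h [measurable]: "h \<in> borel_measurable borel" and b: "\<And>x. cnorm n x \<le> \<theta> \<Longrightarrow> \<bar>h x\<bar> \<le> B"
  shows "integrable (lebC n) (\<lambda>x. wloc n \<theta> W x * h x)"
proof (rule Bochner_Integration.integrable_bound)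
  show "integrable (lebC n) (\<lambda>x. B * wloc n \<theta> W x)"
    by (intro integrable_mult_right wloc_integrable[OF W fin])
  have [measurable]: "wloc n \<theta> W \<in> borel_measurable (lebC n)" by (rule wloc_measurable[OF W])
  show "(\<lambda>x. wloc n \<theta> W x * h x) \<in> borel_measurable (lebC n)" by measurable
  have "norm (wloc n \<theta> W x * h x) \<le> norm (B * wloc n \<theta> W x)" for x
  proof (cases "cnorm n x \<le> \<theta>")
    case True
    then have "wloc n \<theta> W x * \<bar>h x\<bar> \<le> wloc n \<theta> W x * B" by (intro mult_left_mono b) auto
    also have "\<dots> \<le> wloc n \<theta> W x * \<bar>B\<bar>" by (intro mult_left_mono) auto
    finally show ?thesis by (simp add: abs_mult mult.commute)
  qed (simp add: wloc_def)
  then show "AE x in lebC n. norm (wloc n \<theta> W x * h x) \<le> norm (B * wloc n \<theta> W x)" by simp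
qed

lemma lapl_kernel_bound:
  assumes q: "0 < q"
  shows "\<bar>real n * (bump n q z x)\<^sup>2 - 2 * (q * (cdist n x z)\<^sup>2) * bump n q z x\<bar> \<le> real n + 2"
proof -
  define X where "X = q * (cdist n x z)\<^sup>2 * bump n q z x"
  have b: "0 \<le> bump n q z x" "bump n q z x \<le> 1" using bump_le_1[of q n z x] q by auto
  have "X \<le> 1"
  proof (cases "bump n q z x = 0")
    case False
    then have "q * (cdist n x z)\<^sup>2 \<le> 1" by (auto simp: bump_def max_def split: if_splits)
    then show ?thesis unfolding X_def by (rule mult_le_one) (use b in auto)
  qed (simp add: X_def)
  moreover have "0 \<le> X" using b q by (simp add: X_def)
  moreover have "real n * (bump n q z x)\<^sup>2 \<le> real n * 1" using b by (intro mult_left_mono) (auto simp: power_le_one)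
  moreover have "0 \<le> real n * (bump n q z x)\<^sup>2" by simp
  moreover have "2 * (q * (cdist n x z)\<^sup>2) * bump n q z x = 2 * X" by (simp add: X_def)
  ultimately show ?thesis by linarith
qed

lemma lapl_integrable:
  assumes W: "superh n W"
    and fin: "mass_in_ball n \<theta> W \<noteq> \<infinity>"
    and q: "0 < q"
  shows "integrable (lebC n) (\<lambda>x. wloc n \<theta> W x *
    (real n * (bump n q z x)\<^sup>2 - 2 * (q * (cdist n x z)\<^sup>2) * bump n q z x))"
  by (rule wloc_mult_integrable[OF W fin _ lapl_kernel_bound[OF q]]) measurable

lemma integral_le_of_nn_integral_le:
  fixes f g :: "'a \<Rightarrow> real"
  assumes f: "integrable M f" and g: "integrable M g" "\<And>x. 0 \<le> g x"
    and le: "(\<integral>\<^sup>+x. ennreal (f x) \<partial>M) \<le> (\<integral>\<^sup>+x. ennreal (g x) \<partial>M)"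
  shows "(\<integral>x. f x \<partial>M) \<le> (\<integral>x. g x \<partial>M)"
proof -
  have m: "integrable M (\<lambda>x. max 0 (f x))" using f by simp
  have "ennreal (\<integral>x. max 0 (f x) \<partial>M) = (\<integral>\<^sup>+x. ennreal (max 0 (f x)) \<partial>M)"
    by (rule nn_integral_eq_integral[symmetric, OF m]) auto
  also have "\<dots> = (\<integral>\<^sup>+x. ennreal (f x) \<partial>M)" by (intro nn_integral_cong) (auto simp: max_def ennreal_neg)
  also have "\<dots> \<le> ennreal (\<integral>x. g x \<partial>M)" using le nn_integral_eq_integral[OF g(1)] g(2) by simp
  finally have "(\<integral>x. max 0 (f x) \<partial>M) \<le> (\<integral>x. g x \<partial>M)"
    using g by (subst (asm) ennreal_le_iff) auto
  moreover have "(\<integral>x. f x \<partial>M) \<le> (\<integral>x. max 0 (f x) \<partial>M)" by (rule integral_mono[OF f m]) auto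
  ultimately show ?thesis by simp
qed

text \<open>Taylor expansion of the test function along a circle of radius \<open>\<epsilon>\<close> in one coordinate. The terms of first order have
  mean zero; the error is uniform in \<open>x\<close>, so that it survives integration against \<open>W\<close>.\<close>

lemma bump_cube_circle_mean:
  fixes q \<epsilon> :: real
  defines "f \<equiv> \<lambda>n q z i x \<epsilon> t. bump n q z (\<lambda>j. x j - (if j = i then of_real \<epsilon> * cis t else 0)) ^ 3"
  assumes i: "i < n" and x: "cnorm n x \<le> 1" and z: "cnorm n z \<le> 1" and q: "0 < q" and e: "0 < \<epsilon>" "\<epsilon> < 1"
  shows "continuous_on {0..2*pi} (f n q z i x \<epsilon>)"
    and "\<bar>integral {0..2*pi} (f n q z i x \<epsilon>) - 2 * pi * (bump n q z x ^ 3 + \<epsilon>\<^sup>2 *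
        (- 3 * q * (bump n q z x)\<^sup>2 + 6 * q\<^sup>2 * (cmod (x i - z i))\<^sup>2 * bump n q z x))\<bar>
      \<le> 2 * pi * ((125 * q ^ 3 + 3 * q\<^sup>2) * \<epsilon> ^ 3)"
proof -
  define a where "a = cnj (x i - z i)"
  define R where "R = (\<lambda>t. Re (a * cis t))"
  define d where "d = (\<lambda>t. q * \<epsilon>\<^sup>2 - 2 * q * \<epsilon> * R t)"
  define u where "u = 1 - q * (cdist n x z)\<^sup>2"
  define b where "b = max 0 u"
  have b: "b = bump n q z x" "0 \<le> b" "b \<le> 1" using q by (auto simp: b_def u_def bump_def)
  have a2: "cmod a \<le> 2"
    using cmod_le_cnorm[OF i, of "\<lambda>i. x i - z i"] cdist_le_cnorm[of n x z] x z
    unfolding a_def complex_mod_cnj by simp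
  have Rdef: "Re (a * cis t) = R t" for t by (simp add: R_def)
  have Rb: "\<bar>R t\<bar> \<le> 2" for t
    using abs_Re_le_cmod[of "a * cis t"] a2 by (simp add: R_def norm_mult)
  have f: "f n q z i x \<epsilon> t = max 0 (u - d t) ^ 3" for t
  proof -
    have "(cdist n (\<lambda>j. x j - (if j = i then of_real \<epsilon> * cis t else 0)) z)\<^sup>2
       = (\<Sum>j<n. (cmod (x j - z j))\<^sup>2 + (if j = i then \<epsilon>\<^sup>2 - 2 * \<epsilon> * R t else 0))"
      unfolding cnorm_power2
    proof (rule sum.cong[OF refl])
      fix j
      have "(cmod (u - of_real \<epsilon> * cis t))\<^sup>2 = (cmod u)\<^sup>2 + (\<epsilon>\<^sup>2 - 2 * \<epsilon> * Re (cnj u * cis t))" for u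
      proof -
        have "\<epsilon> * (\<epsilon> * (cos t * cos t)) + \<epsilon> * (\<epsilon> * (sin t * sin t)) = \<epsilon> * \<epsilon>"
          by (simp only: distrib_left[symmetric] sin_cos_squared_add3 mult_1_right)
        then show ?thesis unfolding cmod_power2 by (simp add: power2_eq_square algebra_simps)
      qed
      from this[of "x i - z i"]
      show "(cmod (x j - (if j = i then of_real \<epsilon> * cis t else 0) - z j))\<^sup>2
        = (cmod (x j - z j))\<^sup>2 + (if j = i then \<epsilon>\<^sup>2 - 2 * \<epsilon> * R t else 0)"
        by (auto simp: R_def a_def algebra_simps)
    qed
    also have "\<dots> = (cdist n x z)\<^sup>2 + (\<epsilon>\<^sup>2 - 2 * \<epsilon> * R t)"
      using i by (simp add: sum.distrib cnorm_power2)
    finally have eq: "(cdist n (\<lambda>j. x j - (if j = i then of_real \<epsilon> * cis t else 0)) z)\<^sup>2 = \<dots>" .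
    show ?thesis unfolding f_def bump_def d_def u_def eq by (simp add: algebra_simps)
  qed
  have contd: "continuous_on {0..2*pi} d" unfolding d_def R_def by (intro continuous_intros)
  then show contf: "continuous_on {0..2*pi} (f n q z i x \<epsilon>)"
    unfolding f[abs_def] by (intro continuous_intros)
  define P where "P = (\<lambda>t. b ^ 3 - 3 * b\<^sup>2 * d t + 3 * b * (d t)\<^sup>2)"
  define J where "J = b ^ 3 - 3 * b\<^sup>2 * (q * \<epsilon>\<^sup>2) + 3 * b * (q\<^sup>2 * (\<epsilon> ^ 4 + 2 * \<epsilon>\<^sup>2 * (cmod a)\<^sup>2))"
  have err: "norm (f n q z i x \<epsilon> t - P t) \<le> 125 * q ^ 3 * \<epsilon> ^ 3" for t
  proof -
    have "q * \<epsilon> * \<bar>R t\<bar> \<le> q * \<epsilon> * 2" using Rb q e by (intro mult_left_mono) auto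
    moreover have "q * \<epsilon>\<^sup>2 \<le> q * \<epsilon> * 1"
      unfolding power2_eq_square mult.assoc[symmetric] using q e by (intro mult_left_mono) auto
    moreover have "\<bar>d t\<bar> \<le> \<bar>q * \<epsilon>\<^sup>2\<bar> + \<bar>2 * q * \<epsilon> * R t\<bar>" unfolding d_def by (rule abs_triangle_ineq4)
    moreover have "\<bar>q * \<epsilon>\<^sup>2\<bar> = q * \<epsilon>\<^sup>2" "\<bar>2 * q * \<epsilon> * R t\<bar> = 2 * (q * \<epsilon> * \<bar>R t\<bar>)"
      using q e by (auto simp: abs_mult)
    ultimately have "\<bar>d t\<bar> \<le> 5 * (q * \<epsilon>)" by linarith
    then have "\<bar>d t\<bar> ^ 3 \<le> (5 * (q * \<epsilon>)) ^ 3" by (intro power_mono) auto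
    then have "\<bar>d t\<bar> ^ 3 \<le> 125 * q ^ 3 * \<epsilon> ^ 3" by (simp add: power_mult_distrib)
    moreover have "\<bar>f n q z i x \<epsilon> t - P t\<bar> \<le> \<bar>d t\<bar> ^ 3"
      unfolding f P_def b_def by (rule cube_taylor)
    ultimately show ?thesis by simp
  qed
  have ic: "((\<lambda>s. c) has_integral (2 * pi * c)) {0..2*pi}" for c :: real
    using has_integral_const_real[of c 0 "2*pi"] by simp
  have "(d has_integral (2 * pi * (q * \<epsilon>\<^sup>2) - 2 * q * \<epsilon> * 0)) {0..2*pi}"
    unfolding d_def R_def by (intro has_integral_diff ic has_integral_mult_right has_integral_Re_cis)
  then have intd: "(d has_integral (2 * pi * (q * \<epsilon>\<^sup>2))) {0..2*pi}" by simp
  have intd2: "((\<lambda>t. (d t)\<^sup>2) has_integral (2 * pi * (q\<^sup>2 * (\<epsilon> ^ 4 + 2 * \<epsilon>\<^sup>2 * (cmod a)\<^sup>2)))) {0..2*pi}"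
  proof -
    have "((\<lambda>t. q\<^sup>2 * \<epsilon> ^ 4 - 4 * q\<^sup>2 * \<epsilon> ^ 3 * Re (a * cis t) + 4 * q\<^sup>2 * \<epsilon>\<^sup>2 * (Re (a * cis t))\<^sup>2)
      has_integral (2 * pi * (q\<^sup>2 * \<epsilon> ^ 4) - 4 * q\<^sup>2 * \<epsilon> ^ 3 * 0 + 4 * q\<^sup>2 * \<epsilon>\<^sup>2 * (pi * (cmod a)\<^sup>2))) {0..2*pi}"
      by (intro has_integral_add has_integral_diff ic has_integral_mult_right has_integral_Re_cis has_integral_Re_cis_power2)
    also have "(\<lambda>t. q\<^sup>2 * \<epsilon> ^ 4 - 4 * q\<^sup>2 * \<epsilon> ^ 3 * Re (a * cis t) + 4 * q\<^sup>2 * \<epsilon>\<^sup>2 * (Re (a * cis t))\<^sup>2) = (\<lambda>t. (d t)\<^sup>2)"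
      unfolding d_def Rdef
      by (simp add: fun_eq_iff power2_eq_square power3_eq_cube power4_eq_xxxx algebra_simps)
    also have "2 * pi * (q\<^sup>2 * \<epsilon> ^ 4) - 4 * q\<^sup>2 * \<epsilon> ^ 3 * 0 + 4 * q\<^sup>2 * \<epsilon>\<^sup>2 * (pi * (cmod a)\<^sup>2)
       = 2 * pi * (q\<^sup>2 * (\<epsilon> ^ 4 + 2 * \<epsilon>\<^sup>2 * (cmod a)\<^sup>2))" by (simp add: algebra_simps)
    finally show ?thesis .
  qed
  have "(P has_integral (2 * pi * b ^ 3 - 3 * b\<^sup>2 * (2 * pi * (q * \<epsilon>\<^sup>2))
      + 3 * b * (2 * pi * (q\<^sup>2 * (\<epsilon> ^ 4 + 2 * \<epsilon>\<^sup>2 * (cmod a)\<^sup>2))))) {0..2*pi}"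
    unfolding P_def by (intro has_integral_diff has_integral_mult_right has_integral_add ic intd intd2)
  then have "(P has_integral (2 * pi * J)) {0..2*pi}" by (simp add: J_def algebra_simps)
  then have "((\<lambda>t. f n q z i x \<epsilon> t - P t) has_integral (integral {0..2*pi} (f n q z i x \<epsilon>) - 2 * pi * J)) {0..2*pi}"
    by (intro has_integral_diff integrable_integral integrable_continuous_real contf)
  then have "norm (integral {0..2*pi} (f n q z i x \<epsilon>) - 2 * pi * J) \<le> (125 * q ^ 3 * \<epsilon> ^ 3) * measure lborel {0..2*pi}"
    using q e err by (intro has_integral_bound_real[where S="{}"]) auto
  then have 1: "\<bar>integral {0..2*pi} (f n q z i x \<epsilon>) - 2 * pi * J\<bar> \<le> 2 * pi * (125 * q ^ 3 * \<epsilon> ^ 3)"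
    by (simp add: mult.commute)
  have "\<epsilon> ^ 4 \<le> \<epsilon> ^ 3" using e by (intro power_decreasing) auto
  then have "b * \<epsilon> ^ 4 \<le> 1 * \<epsilon> ^ 3" using b e by (intro mult_mono) auto
  then have "(3 * q\<^sup>2) * (b * \<epsilon> ^ 4) \<le> (3 * q\<^sup>2) * (1 * \<epsilon> ^ 3)" by (rule mult_left_mono) simp
  moreover have "0 \<le> (3 * q\<^sup>2) * (b * \<epsilon> ^ 4)" using b by simp
  moreover have "J = b ^ 3 + \<epsilon>\<^sup>2 * (- 3 * q * b\<^sup>2 + 6 * q\<^sup>2 * (cmod (x i - z i))\<^sup>2 * b) + (3 * q\<^sup>2) * (b * \<epsilon> ^ 4)"
    unfolding J_def a_def complex_mod_cnj by (simp add: algebra_simps)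
  ultimately have "\<bar>J - (b ^ 3 + \<epsilon>\<^sup>2 * (- 3 * q * b\<^sup>2 + 6 * q\<^sup>2 * (cmod (x i - z i))\<^sup>2 * b))\<bar> \<le> 3 * q\<^sup>2 * \<epsilon> ^ 3"
    by simp
  then have "2 * pi * \<bar>J - (b ^ 3 + \<epsilon>\<^sup>2 * (- 3 * q * b\<^sup>2 + 6 * q\<^sup>2 * (cmod (x i - z i))\<^sup>2 * b))\<bar> \<le> 2 * pi * (3 * q\<^sup>2 * \<epsilon> ^ 3)"
    by (rule mult_left_mono) simp
  then have 2: "\<bar>2 * pi * J - 2 * pi * (b ^ 3 + \<epsilon>\<^sup>2 * (- 3 * q * b\<^sup>2 + 6 * q\<^sup>2 * (cmod (x i - z i))\<^sup>2 * b))\<bar> \<le> 2 * pi * (3 * q\<^sup>2 * \<epsilon> ^ 3)"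
    by (simp only: right_diff_distrib[symmetric] abs_mult) simp
  have "2 * pi * ((125 * q ^ 3 + 3 * q\<^sup>2) * \<epsilon> ^ 3) = 2 * pi * (125 * q ^ 3 * \<epsilon> ^ 3) + 2 * pi * (3 * q\<^sup>2 * \<epsilon> ^ 3)"
    by (simp add: algebra_simps)
  with 1 2 show "\<bar>integral {0..2*pi} (f n q z i x \<epsilon>) - 2 * pi * (bump n q z x ^ 3 + \<epsilon>\<^sup>2 *
        (- 3 * q * (bump n q z x)\<^sup>2 + 6 * q\<^sup>2 * (cmod (x i - z i))\<^sup>2 * bump n q z x))\<bar>
      \<le> 2 * pi * ((125 * q ^ 3 + 3 * q\<^sup>2) * \<epsilon> ^ 3)"
    unfolding b(1)[symmetric] by linarith
qed

text \<open>\<open>\<integral> W \<Delta>F \<le> 0\<close> for a non-negative linear combination \<open>F\<close> of test functions. No single summand need have a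
  sign, which is what the comparison of several small balls with one large ball requires. The proof sums the
  discrete inequality over the coordinates and lets \<open>\<epsilon>\<close> tend to 0.\<close>

lemma superh_laplacian_nonneg:
  fixes q coef :: "'k \<Rightarrow> real" and z :: "'k \<Rightarrow> nat \<Rightarrow> complex"
  assumes W: "superh n W"
    and fin: "mass_in_ball n \<theta> W \<noteq> \<infinity>"
    and \<theta>: "\<rho> < \<theta>" "\<theta> < 1" and I: "finite I"
    and q: "\<And>k. k \<in> I \<Longrightarrow> 0 < q k" and z: "\<And>k. k \<in> I \<Longrightarrow> cnorm n (z k) \<le> 1"
    and pos: "\<And>x. 0 \<le> (\<Sum>k\<in>I. coef k * bump n (q k) (z k) x ^ 3)"
    and supp: "\<And>x. (\<Sum>k\<in>I. coef k * bump n (q k) (z k) x ^ 3) \<noteq> 0 \<Longrightarrow> cnorm n x \<le> \<rho>"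
  shows "0 \<le> (\<Sum>k\<in>I. coef k * (q k * lapl n (wloc n \<theta> W) (q k) (z k)))"
proof -
  define w where "w = wloc n \<theta> W"
  define F where "F = (\<lambda>x. \<Sum>k\<in>I. coef k * bump n (q k) (z k) x ^ 3)"
  define T where "T = (\<lambda>i x. \<Sum>k\<in>I. coef k * (- 3 * q k * (bump n (q k) (z k) x)\<^sup>2
       + 6 * (q k)\<^sup>2 * (cmod (x i - z k i))\<^sup>2 * bump n (q k) (z k) x))"
  \<comment> \<open>\<open>4 T i\<close> is the Laplacian of \<open>F\<close> in the \<open>i\<close>-th coordinate, and \<open>C\<close> the constant in the Taylor error.\<close>
  define C where "C = (\<Sum>k\<in>I. \<bar>coef k\<bar> * (125 * q k ^ 3 + 3 * (q k)\<^sup>2))"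
  note [measurable] = superh_measurable[OF W]
  have [measurable]: "F \<in> borel_measurable borel" unfolding F_def by measurable
  have [measurable]: "T i \<in> borel_measurable borel" for i unfolding T_def by measurable
  have C: "0 \<le> C" unfolding C_def using q by (intro sum_nonneg mult_nonneg_nonneg add_nonneg_nonneg) (auto intro: less_imp_le)
  have b01: "0 \<le> bump n (q k) (z k) x" "bump n (q k) (z k) x \<le> 1" if "k \<in> I" for k x
    using bump_le_1[of "q k" n "z k" x] q[OF that] by auto
  have comp2: "cmod (x i - z k i) \<le> 2" if "k \<in> I" "i < n" "cnorm n x \<le> 1" for k i x
    using cmod_le_cnorm[OF that(2), of "\<lambda>i. x i - z k i"] cdist_le_cnorm[of n x "z k"] z[OF that(1)] that(3) by simp
  have Fb: "\<bar>F x\<bar> \<le> (\<Sum>k\<in>I. \<bar>coef k\<bar>)" for x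
    unfolding F_def
  proof (intro order_trans[OF sum_abs] sum_mono)
    fix k assume k: "k \<in> I"
    have "\<bar>coef k\<bar> * \<bar>bump n (q k) (z k) x ^ 3\<bar> \<le> \<bar>coef k\<bar> * 1"
      using b01[OF k, of x] by (intro mult_left_mono) (auto simp: power_le_one)
    then show "\<bar>coef k * bump n (q k) (z k) x ^ 3\<bar> \<le> \<bar>coef k\<bar>" by (simp add: abs_mult)
  qed
  have Tb: "\<bar>T i x\<bar> \<le> (\<Sum>k\<in>I. \<bar>coef k\<bar> * (3 * q k + 24 * (q k)\<^sup>2))" if "cnorm n x \<le> 1" "i < n" for i x
    unfolding T_def
  proof (intro order_trans[OF sum_abs] sum_mono)
    fix k assume k: "k \<in> I"
    let ?b = "bump n (q k) (z k) x"
    define X where "X = q k * ?b\<^sup>2"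
    define Y where "Y = (q k)\<^sup>2 * ((cmod (x i - z k i))\<^sup>2 * ?b)"
    have "q k * ?b\<^sup>2 \<le> q k * 1"
      using b01[OF k, of x] q[OF k] by (intro mult_left_mono) (auto simp: power_le_one)
    then have X: "0 \<le> X" "X \<le> q k" using q[OF k] by (auto simp: X_def)
    have "(cmod (x i - z k i))\<^sup>2 \<le> 2\<^sup>2" by (intro power_mono comp2[OF k that(2,1)]) auto
    then have "(cmod (x i - z k i))\<^sup>2 * ?b \<le> 4 * 1" using b01[OF k, of x] by (intro mult_mono) auto
    then have "Y \<le> (q k)\<^sup>2 * (4 * 1)" unfolding Y_def by (intro mult_left_mono) auto
    moreover have "0 \<le> Y" using b01[OF k, of x] by (simp add: Y_def)
    moreover have "- 3 * q k * ?b\<^sup>2 + 6 * (q k)\<^sup>2 * (cmod (x i - z k i))\<^sup>2 * ?b = 6 * Y - 3 * X"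
      by (simp add: X_def Y_def mult_ac)
    ultimately have "\<bar>- 3 * q k * ?b\<^sup>2 + 6 * (q k)\<^sup>2 * (cmod (x i - z k i))\<^sup>2 * ?b\<bar> \<le> 3 * q k + 24 * (q k)\<^sup>2"
      using X by linarith
    then show "\<bar>coef k * (- 3 * q k * ?b\<^sup>2 + 6 * (q k)\<^sup>2 * (cmod (x i - z k i))\<^sup>2 * ?b)\<bar>
       \<le> \<bar>coef k\<bar> * (3 * q k + 24 * (q k)\<^sup>2)"
      by (subst abs_mult) (intro mult_left_mono, auto)
  qed
  have intw: "integrable (lebC n) w" unfolding w_def by (rule wloc_integrable[OF W fin])
  have intF: "integrable (lebC n) (\<lambda>x. w x * F x)"
    unfolding w_def by (rule wloc_mult_integrable[OF W fin _ Fb]) measurable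
  have intT: "integrable (lebC n) (\<lambda>x. w x * T i x)" if "i < n" for i
    unfolding w_def by (rule wloc_mult_integrable[OF W fin _ Tb]) (use \<theta> that in auto)
  have wnn: "0 \<le> (\<integral>x. w x \<partial>lebC n)" by (rule Bochner_Integration.integral_nonneg) (simp add: w_def)
  have step: "(\<integral>x. w x * T i x \<partial>lebC n) \<le> C * \<epsilon> * (\<integral>x. w x \<partial>lebC n)"
    if i: "i < n" and e: "0 < \<epsilon>" "\<epsilon> < 1" "\<rho> + \<epsilon> \<le> \<theta>" for i \<epsilon>
  proof -
    define G where "G = (\<lambda>x. F x + \<epsilon>\<^sup>2 * T i x - C * \<epsilon> ^ 3)"
    define sh where "sh = (\<lambda>x t. \<lambda>j. x j - (if j = i then of_real \<epsilon> * cis t else (0::complex)))"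
    have pw: "ennreal (2 * pi * G x) \<le> (\<integral>\<^sup>+t\<in>{0..2*pi}. ennreal (F (sh x t)) \<partial>lborel)"
      if x: "cnorm n x \<le> 1" for x
    proof -
      define B where "B = (\<lambda>k t. bump n (q k) (z k) (sh x t) ^ 3)"
      define H where "H = (\<lambda>k. integral {0..2*pi} (B k))"
      define E where "E = (\<lambda>k. bump n (q k) (z k) x ^ 3 + \<epsilon>\<^sup>2 * (- 3 * q k * (bump n (q k) (z k) x)\<^sup>2
          + 6 * (q k)\<^sup>2 * (cmod (x i - z k i))\<^sup>2 * bump n (q k) (z k) x))"
      have cont: "continuous_on {0..2*pi} (B k)"
        and HE: "\<bar>H k - 2 * pi * E k\<bar> \<le> 2 * pi * ((125 * q k ^ 3 + 3 * (q k)\<^sup>2) * \<epsilon> ^ 3)" if "k \<in> I" for k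
        using bump_cube_circle_mean[OF i x z[OF that] q[OF that] e(1,2)] unfolding B_def H_def E_def sh_def by auto
      have "2 * pi * G x \<le> (\<Sum>k\<in>I. coef k * H k)"
      proof -
        have "coef k * (2 * pi * E k) - \<bar>coef k\<bar> * (2 * pi * ((125 * q k ^ 3 + 3 * (q k)\<^sup>2) * \<epsilon> ^ 3)) \<le> coef k * H k"
          if "k \<in> I" for k
        proof -
          have "\<bar>coef k\<bar> * \<bar>H k - 2 * pi * E k\<bar> \<le> \<bar>coef k\<bar> * (2 * pi * ((125 * q k ^ 3 + 3 * (q k)\<^sup>2) * \<epsilon> ^ 3))"
            by (rule mult_left_mono[OF HE[OF that]]) simp
          then have "\<bar>coef k * H k - coef k * (2 * pi * E k)\<bar> \<le> \<bar>coef k\<bar> * (2 * pi * ((125 * q k ^ 3 + 3 * (q k)\<^sup>2) * \<epsilon> ^ 3))"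
            by (simp only: abs_mult[symmetric] right_diff_distrib)
          then show ?thesis by linarith
        qed
        then have "(\<Sum>k\<in>I. coef k * (2 * pi * E k) - \<bar>coef k\<bar> * (2 * pi * ((125 * q k ^ 3 + 3 * (q k)\<^sup>2) * \<epsilon> ^ 3)))
            \<le> (\<Sum>k\<in>I. coef k * H k)" by (rule sum_mono)
        moreover have "(\<Sum>k\<in>I. coef k * (2 * pi * E k) - \<bar>coef k\<bar> * (2 * pi * ((125 * q k ^ 3 + 3 * (q k)\<^sup>2) * \<epsilon> ^ 3))) = 2 * pi * G x"
        proof -
          have "G x = (\<Sum>k\<in>I. coef k * E k - \<bar>coef k\<bar> * ((125 * q k ^ 3 + 3 * (q k)\<^sup>2) * \<epsilon> ^ 3))"
            by (simp add: G_def F_def T_def C_def E_def sum.distrib sum_subtractf sum_distrib_left sum_distrib_right algebra_simps)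
          then show ?thesis by (simp add: sum_distrib_left right_diff_distrib mult_ac)
        qed
        ultimately show ?thesis by simp
      qed
      then have "ennreal (2 * pi * G x) \<le> ennreal (\<Sum>k\<in>I. coef k * H k)" by (rule ennreal_leI)
      also have "\<dots> \<le> (\<integral>\<^sup>+t\<in>{0..2*pi}. ennreal (F (sh x t)) \<partial>lborel)"
      proof (rule nn_integral_ge_has_integral)
        show "continuous_on {0..2*pi} (\<lambda>t. \<Sum>k\<in>I. coef k * B k t)" by (intro continuous_intros cont)
        show "((\<lambda>t. \<Sum>k\<in>I. coef k * B k t) has_integral (\<Sum>k\<in>I. coef k * H k)) {0..2*pi}"
          unfolding H_def
          by (intro has_integral_sum I has_integral_mult_right integrable_integral integrable_continuous_real cont)
      qed (simp add: F_def B_def)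
      finally show ?thesis .
    qed
    have [measurable]: "G \<in> borel_measurable borel" unfolding G_def by measurable
    have intG: "integrable (lebC n) (\<lambda>x. w x * G x)"
    proof -
      have "integrable (lebC n) (\<lambda>x. w x * F x + \<epsilon>\<^sup>2 * (w x * T i x) - (C * \<epsilon> ^ 3) * w x)"
        by (intro Bochner_Integration.integrable_add Bochner_Integration.integrable_diff integrable_mult_right intF intT[OF i] intw)
      then show ?thesis by (simp add: G_def algebra_simps)
    qed
    have Gint: "(\<integral>x. w x * G x \<partial>lebC n) = (\<integral>x. w x * F x \<partial>lebC n) + \<epsilon>\<^sup>2 * (\<integral>x. w x * T i x \<partial>lebC n) - (C * \<epsilon> ^ 3) * (\<integral>x. w x \<partial>lebC n)"
    proof -
      have "(\<integral>x. w x * G x \<partial>lebC n) = (\<integral>x. w x * F x + \<epsilon>\<^sup>2 * (w x * T i x) - (C * \<epsilon> ^ 3) * w x \<partial>lebC n)"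
        by (simp add: G_def algebra_simps)
      also have "\<dots> = (\<integral>x. w x * F x \<partial>lebC n) + (\<integral>x. \<epsilon>\<^sup>2 * (w x * T i x) \<partial>lebC n) - (\<integral>x. (C * \<epsilon> ^ 3) * w x \<partial>lebC n)"
        by (subst Bochner_Integration.integral_diff, (intro Bochner_Integration.integrable_add
              integrable_mult_right intF intT[OF i] intw)+, subst Bochner_Integration.integral_add,
            (intro integrable_mult_right intF intT[OF i])+, rule refl)
      finally show ?thesis by simp
    qed
    have "ennreal (2 * pi) * (\<integral>\<^sup>+x. ennreal (w x * G x) \<partial>lebC n) = (\<integral>\<^sup>+x. ennreal (2 * pi) * ennreal (w x * G x) \<partial>lebC n)"
      by (rule nn_integral_cmult[symmetric]) (use borel_measurable_integrable[OF intG] in simp)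
    also have "\<dots> \<le> (\<integral>\<^sup>+x. W x * (\<integral>\<^sup>+t\<in>{0..2*pi}. ennreal (F (sh x t)) \<partial>lborel) \<partial>lebC n)"
    proof (rule nn_integral_mono_AE, use AE_wloc[OF W fin] in eventually_elim)
      case (elim x)
      show ?case
      proof (cases "cnorm n x \<le> \<theta>")
        case True
        then have Wx: "W x = ennreal (w x)" using elim by (simp add: w_def)
        have "ennreal (2 * pi) * ennreal (w x * G x) = ennreal (w x) * ennreal (2 * pi * G x)"
          by (simp add: ennreal_mult'[symmetric] w_def ennreal_mult''[symmetric] mult_ac)
        also have "\<dots> \<le> W x * (\<integral>\<^sup>+t\<in>{0..2*pi}. ennreal (F (sh x t)) \<partial>lborel)"
          unfolding Wx using True \<theta> by (intro mult_left_mono pw) auto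
        finally show ?thesis .
      qed (simp add: w_def wloc_def)
    qed
    also have "\<dots> \<le> ennreal (2 * pi) * (\<integral>\<^sup>+x. W x * ennreal (F x) \<partial>lebC n)"
      unfolding sh_def
    proof (rule superh_coordinate_mean[OF W i])
      show "cnorm n x \<le> \<rho>" if "ennreal (F x) \<noteq> 0" for x
      proof -
        have "F x \<noteq> 0" using that by auto
        then show ?thesis unfolding F_def by (rule supp)
      qed
    qed (use e \<theta> in auto)
    also have "(\<integral>\<^sup>+x. W x * ennreal (F x) \<partial>lebC n) = (\<integral>\<^sup>+x. ennreal (w x * F x) \<partial>lebC n)"
      unfolding w_def
    proof (rule nn_integral_wloc[OF W fin])
      fix x assume "F x \<noteq> 0"
      then have "cnorm n x \<le> \<rho>" unfolding F_def by (rule supp)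
      then show "cnorm n x \<le> \<theta>" using \<theta> by simp
    qed
    finally have "(\<integral>\<^sup>+x. ennreal (w x * G x) \<partial>lebC n) \<le> (\<integral>\<^sup>+x. ennreal (w x * F x) \<partial>lebC n)"
      by (subst (asm) ennreal_mult_le_mult_iff) auto
    moreover have "0 \<le> F x" for x unfolding F_def by (rule pos)
    ultimately have "(\<integral>x. w x * G x \<partial>lebC n) \<le> (\<integral>x. w x * F x \<partial>lebC n)"
      by (intro integral_le_of_nn_integral_le intG intF) (auto simp: w_def)
    then have "\<epsilon>\<^sup>2 * (\<integral>x. w x * T i x \<partial>lebC n) \<le> \<epsilon>\<^sup>2 * (C * \<epsilon> * (\<integral>x. w x \<partial>lebC n))"
      unfolding Gint by (simp add: power2_eq_square power3_eq_cube mult_ac)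
    then show ?thesis using e by simp
  qed
  have neg: "(\<integral>x. w x * T i x \<partial>lebC n) \<le> 0" if i: "i < n" for i
  proof (rule ccontr)
    assume "\<not> ?thesis"
    then have p: "(\<integral>x. w x * T i x \<partial>lebC n) > 0" by simp
    define D where "D = C * (\<integral>x. w x \<partial>lebC n) + 1"
    have D: "D > 0" using C wnn by (simp add: D_def add_nonneg_pos)
    define \<epsilon> where "\<epsilon> = min (min (1/2) (\<theta> - \<rho>)) ((\<integral>x. w x * T i x \<partial>lebC n) / (2 * D))"
    have "\<epsilon> \<le> 1/2" unfolding \<epsilon>_def by (rule min.coboundedI1, rule min.cobounded1)
    moreover have "\<epsilon> \<le> \<theta> - \<rho>" unfolding \<epsilon>_def by (rule min.coboundedI1, rule min.cobounded2)
    moreover have "0 < \<epsilon>" using p D \<theta> by (simp add: \<epsilon>_def)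
    ultimately have e: "0 < \<epsilon>" "\<epsilon> < 1" "\<rho> + \<epsilon> \<le> \<theta>" by linarith+
    have "\<epsilon> \<le> (\<integral>x. w x * T i x \<partial>lebC n) / (2 * D)" by (simp add: \<epsilon>_def)
    then have "2 * (D * \<epsilon>) \<le> (\<integral>x. w x * T i x \<partial>lebC n)" using D by (simp add: field_simps)
    also have "\<dots> \<le> C * \<epsilon> * (\<integral>x. w x \<partial>lebC n)" by (rule step[OF i e])
    also have "\<dots> \<le> D * \<epsilon>" using e by (simp add: D_def algebra_simps)
    finally have "D * \<epsilon> \<le> 0" by simp
    then show False using D e by (simp add: mult_le_0_iff)
  qed
  define kl where "kl = (\<lambda>k x. real n * (bump n (q k) (z k) x)\<^sup>2 - 2 * (q k * (cdist n x (z k))\<^sup>2) * bump n (q k) (z k) x)"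
  have intk: "integrable (lebC n) (\<lambda>x. w x * kl k x)" if k: "k \<in> I" for k
    unfolding w_def kl_def by (rule lapl_integrable[OF W fin q[OF k]])
  have sumT: "(\<Sum>i<n. T i x) = (\<Sum>k\<in>I. (- 3 * (coef k * q k)) * kl k x)" for x
  proof -
    have "(\<Sum>i<n. T i x) = (\<Sum>k\<in>I. \<Sum>i<n. coef k * (- 3 * q k * (bump n (q k) (z k) x)\<^sup>2
       + 6 * (q k)\<^sup>2 * (cmod (x i - z k i))\<^sup>2 * bump n (q k) (z k) x))"
      unfolding T_def by (rule sum.swap)
    also have "\<dots> = (\<Sum>k\<in>I. (- 3 * (coef k * q k)) * kl k x)"
    proof (rule sum.cong[OF refl])
      fix k
      have "(\<Sum>i<n. coef k * (- 3 * q k * (bump n (q k) (z k) x)\<^sup>2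
         + 6 * (q k)\<^sup>2 * (cmod (x i - z k i))\<^sup>2 * bump n (q k) (z k) x))
        = coef k * (real n * (- 3 * q k * (bump n (q k) (z k) x)\<^sup>2)
          + 6 * (q k)\<^sup>2 * (\<Sum>i<n. (cmod (x i - z k i))\<^sup>2) * bump n (q k) (z k) x)"
        by (simp add: sum_distrib_left[symmetric] sum_distrib_right[symmetric] sum_subtractf)
      then show "(\<Sum>i<n. coef k * (- 3 * q k * (bump n (q k) (z k) x)\<^sup>2
         + 6 * (q k)\<^sup>2 * (cmod (x i - z k i))\<^sup>2 * bump n (q k) (z k) x)) = (- 3 * (coef k * q k)) * kl k x"
        unfolding cnorm_power2[symmetric] by (simp add: kl_def power2_eq_square algebra_simps)
    qed
    finally show ?thesis .
  qed
  have "(\<Sum>i<n. \<integral>x. w x * T i x \<partial>lebC n) = (\<integral>x. (\<Sum>i<n. w x * T i x) \<partial>lebC n)"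
    by (rule Bochner_Integration.integral_sum[symmetric]) (use intT in auto)
  also have "\<dots> = (\<integral>x. (\<Sum>k\<in>I. (- 3 * (coef k * q k)) * (w x * kl k x)) \<partial>lebC n)"
    unfolding sum_distrib_left[symmetric] sumT by (simp add: sum_distrib_left mult_ac)
  also have "\<dots> = (\<Sum>k\<in>I. \<integral>x. (- 3 * (coef k * q k)) * (w x * kl k x) \<partial>lebC n)"
    by (rule Bochner_Integration.integral_sum) (intro integrable_mult_right intk)
  also have "\<dots> = - 3 * (\<Sum>k\<in>I. coef k * (q k * lapl n w (q k) (z k)))"
  proof -
    have eq: "lapl n w (q k) (z k) = (\<integral>x. w x * kl k x \<partial>lebC n)" for k by (simp add: lapl_def kl_def)
    show ?thesis
      unfolding eq sum_distrib_left
      by (intro sum.cong refl, subst integral_mult_right_zero, simp only: mult.assoc)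
  qed
  finally have "- 3 * (\<Sum>k\<in>I. coef k * (q k * lapl n w (q k) (z k))) \<le> 0"
    using neg by (metis (no_types, lifting) lessThan_iff sum_nonpos)
  then show ?thesis by (simp add: w_def)
qed

text \<open>For disjoint balls the test functions add up to at most 1 where they do not vanish, hence to at most a multiple of one
  large test function. As the Laplacian of the difference has a sign against \<open>W\<close>, the Riesz masses near the
  \<open>z \<in> S\<close> add up to at most a constant. With \<open>t = (1 - \<tau>) / 8\<close> the small balls lie in the ball of radius
  \<open>1 - 7 t\<close>, and the large test function has radius \<open>1 - 6 t\<close>.\<close>

lemma superh_packing:
  assumes W: "superh n W" and \<tau>: "0 < \<tau>" "\<tau> < 1" and K: "0 \<le> K"
    and fin: "mass_in_ball n ((1 + \<tau>) / 2) W \<le> ennreal K"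
    and S: "finite S" "S \<subseteq> Cn n" "\<And>z. z \<in> S \<Longrightarrow> cnorm n z \<le> \<tau>"
    and r: "\<And>z. z \<in> S \<Longrightarrow> 0 < r z \<and> r z \<le> (1 - \<tau>) / 8"
    and disj: "\<And>z z'. z \<in> S \<Longrightarrow> z' \<in> S \<Longrightarrow> z \<noteq> z' \<Longrightarrow> r z + r z' \<le> cdist n z z'"
    and P: "P = real n * (1 / (1 - 6 * ((1 - \<tau>) / 8))\<^sup>2)
      / (1 - ((1 - 7 * ((1 - \<tau>) / 8)) / (1 - 6 * ((1 - \<tau>) / 8)))\<^sup>2) ^ 3"
  shows "(\<Sum>z\<in>S. (1 / (r z)\<^sup>2) * lapl n (wloc n ((1 + \<tau>) / 2) W) (1 / (r z)\<^sup>2) z) \<le> P * K"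
proof -
  define t where "t = (1 - \<tau>) / 8"
  have t: "0 < t" "t < 1/8" "\<tau> = 1 - 8 * t" using \<tau> by (auto simp: t_def field_simps)
  have th: "(1 + \<tau>) / 2 = 1 - 4 * t" using t by simp
  define q0 where "q0 = 1 / (1 - 6 * t)\<^sup>2"
  define c1 where "c1 = 1 - ((1 - 7 * t) / (1 - 6 * t))\<^sup>2"
  have q0: "0 < q0" "1 / sqrt q0 = 1 - 6 * t" using t by (auto simp: q0_def real_sqrt_divide)
  have "((1 - 7 * t) / (1 - 6 * t))\<^sup>2 < 1\<^sup>2"
    using t by (intro power_strict_mono) (auto simp: field_simps)
  then have c1: "0 < c1" by (simp add: c1_def)
  have Pe: "P = real n * q0 / c1 ^ 3" unfolding P q0_def c1_def t_def by simp
  define w where "w = wloc n (1 - 4 * t) W"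
  have fin': "mass_in_ball n (1 - 4 * t) W \<noteq> \<infinity>"
    using fin unfolding th by (auto simp: top_unique)
  define q where "q = (\<lambda>k. case k of None \<Rightarrow> q0 | Some z \<Rightarrow> 1 / (r z)\<^sup>2)"
  define ce :: "(nat \<Rightarrow> complex) option \<Rightarrow> nat \<Rightarrow> complex" where "ce = (\<lambda>k. case k of None \<Rightarrow> (\<lambda>_. 0) | Some z \<Rightarrow> z)"
  define coef where "coef = (\<lambda>k. case k of None \<Rightarrow> 1 / c1 ^ 3 | Some (z :: nat \<Rightarrow> complex) \<Rightarrow> - 1)"
  define I where "I = insert None (Some ` S)"
  have sumI: "(\<Sum>k\<in>I. f k) = f None + (\<Sum>z\<in>S. f (Some z))" for f :: "_ \<Rightarrow> real"
    unfolding I_def using S(1) by (subst sum.insert) (auto simp: sum.reindex)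
  have F: "(\<Sum>k\<in>I. coef k * bump n (q k) (ce k) x ^ 3)
     = bump n q0 (\<lambda>_. 0) x ^ 3 / c1 ^ 3 - (\<Sum>z\<in>S. bump n (1 / (r z)\<^sup>2) z x ^ 3)" for x
    unfolding sumI by (simp add: coef_def q_def ce_def sum_negf)
  have near: "cdist n x z < r z" if "z \<in> S" "bump n (1 / (r z)\<^sup>2) z x \<noteq> 0" for z x
    using bump_nonzero[OF that(2)] r[OF that(1)] by (simp add: real_sqrt_divide)
  have inner: "cnorm n x \<le> 1 - 7 * t" if "z \<in> S" "bump n (1 / (r z)\<^sup>2) z x \<noteq> 0" for z x
    using near[OF that] r[OF that(1)] S(3)[OF that(1)] cnorm_le_cdist[of n x z] t unfolding t_def[symmetric] by linarith
  have "0 \<le> (\<Sum>k\<in>I. coef k * (q k * lapl n w (q k) (ce k)))"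
    unfolding w_def
  proof (rule superh_laplacian_nonneg[OF W fin', where \<rho> = "1 - 6 * t"])
    show "1 - 6 * t < 1 - 4 * t" "1 - 4 * t < 1" using t by auto
    show "finite I" using S by (simp add: I_def)
    show "0 < q k" if "k \<in> I" for k
    proof (cases k)
      case (Some z)
      then have "0 < r z" using that r by (auto simp: I_def)
      then show ?thesis by (simp add: q_def Some)
    qed (simp add: q_def q0)
    show "cnorm n (ce k) \<le> 1" if "k \<in> I" for k using that S(3) \<tau> by (force simp: I_def ce_def)
    show "0 \<le> (\<Sum>k\<in>I. coef k * bump n (q k) (ce k) x ^ 3)" for x
    proof (cases "\<exists>z\<in>S. bump n (1 / (r z)\<^sup>2) z x \<noteq> 0")
      case False
      then have "(\<Sum>z\<in>S. bump n (1 / (r z)\<^sup>2) z x ^ 3) = 0" by (intro sum.neutral) auto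
      then show ?thesis unfolding F using c1 by simp
    next
      case True
      then obtain z where z: "z \<in> S" "bump n (1 / (r z)\<^sup>2) z x \<noteq> 0" by blast
      have uniq: "bump n (1 / (r z')\<^sup>2) z' x = 0" if "z' \<in> S" "z' \<noteq> z" for z'
      proof (rule ccontr)
        assume "bump n (1 / (r z')\<^sup>2) z' x \<noteq> 0"
        then have "cdist n x z' < r z'" by (rule near[OF that(1)])
        moreover have "cdist n x z < r z" by (rule near[OF z])
        moreover have "cdist n z z' \<le> cdist n x z + cdist n x z'"
          using cdist_triangle[of n z z' x] cdist_commute[of n x z] by simp
        ultimately show False using disj[OF z(1) that(1) that(2)[symmetric]] by linarith
      qed
      have "(\<Sum>z'\<in>S. bump n (1 / (r z')\<^sup>2) z' x ^ 3) = (\<Sum>z'\<in>{z}. bump n (1 / (r z')\<^sup>2) z' x ^ 3)"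
        using S(1) z uniq by (intro sum.mono_neutral_right) auto
      also have "\<dots> \<le> 1" using bump_le_1[of "1 / (r z)\<^sup>2" n z x] by (simp add: power_le_one)
      also have "1 \<le> bump n q0 (\<lambda>_. 0) x ^ 3 / c1 ^ 3"
      proof -
        have "(cnorm n x)\<^sup>2 \<le> (1 - 7 * t)\<^sup>2" using inner[OF z] by (intro power_mono) auto
        then have "q0 * (cnorm n x)\<^sup>2 \<le> ((1 - 7 * t) / (1 - 6 * t))\<^sup>2"
          using t by (simp add: q0_def power_divide divide_right_mono)
        then have "c1 \<le> bump n q0 (\<lambda>_. 0) x" by (simp add: c1_def bump_def)
        then have "c1 ^ 3 \<le> bump n q0 (\<lambda>_. 0) x ^ 3" using c1 by (intro power_mono) auto
        then show ?thesis using c1 by (simp add: field_simps)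
      qed
      finally show ?thesis unfolding F by simp
    qed
    show "cnorm n x \<le> 1 - 6 * t" if nz: "(\<Sum>k\<in>I. coef k * bump n (q k) (ce k) x ^ 3) \<noteq> 0" for x
    proof (cases "\<exists>z\<in>S. bump n (1 / (r z)\<^sup>2) z x \<noteq> 0")
      case True
      then show ?thesis using inner t by force
    next
      case False
      then have "(\<Sum>z\<in>S. bump n (1 / (r z)\<^sup>2) z x ^ 3) = 0" by (intro sum.neutral) auto
      then have "bump n q0 (\<lambda>_. 0) x \<noteq> 0" using nz unfolding F by auto
      from bump_nonzero[OF this q0(1)] show ?thesis using q0 by simp
    qed
  qed
  also have "(\<Sum>k\<in>I. coef k * (q k * lapl n w (q k) (ce k)))
     = q0 * lapl n w q0 (\<lambda>_. 0) / c1 ^ 3 - (\<Sum>z\<in>S. (1 / (r z)\<^sup>2) * lapl n w (1 / (r z)\<^sup>2) z)"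
    unfolding sumI by (simp add: coef_def q_def ce_def sum_negf)
  finally have 1: "(\<Sum>z\<in>S. (1 / (r z)\<^sup>2) * lapl n w (1 / (r z)\<^sup>2) z) \<le> q0 * lapl n w q0 (\<lambda>_. 0) / c1 ^ 3"
    by simp
  have "lapl n w q0 (\<lambda>_. 0) \<le> (\<integral>x. real n * w x \<partial>lebC n)"
    unfolding lapl_def
  proof (rule integral_mono)
    show "integrable (lebC n) (\<lambda>x. w x * (real n * (bump n q0 (\<lambda>_. 0) x)\<^sup>2
        - 2 * (q0 * (cdist n x (\<lambda>_. 0))\<^sup>2) * bump n q0 (\<lambda>_. 0) x))"
      unfolding w_def by (rule lapl_integrable[OF W fin' q0(1)])
    show "integrable (lebC n) (\<lambda>x. real n * w x)"
      unfolding w_def by (intro integrable_mult_right wloc_integrable[OF W fin'])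
    fix x
    have "(bump n q0 (\<lambda>_. 0) x)\<^sup>2 \<le> 1" using bump_le_1[of q0 n "\<lambda>_. 0" x] q0 by (simp add: power_le_one)
    then have "real n * (bump n q0 (\<lambda>_. 0) x)\<^sup>2 \<le> real n" by (simp add: mult_left_le)
    moreover have "0 \<le> 2 * (q0 * (cdist n x (\<lambda>_. 0))\<^sup>2) * bump n q0 (\<lambda>_. 0) x" using q0 by simp
    ultimately have "real n * (bump n q0 (\<lambda>_. 0) x)\<^sup>2
        - 2 * (q0 * (cdist n x (\<lambda>_. 0))\<^sup>2) * bump n q0 (\<lambda>_. 0) x \<le> real n" by linarith
    then have "w x * (real n * (bump n q0 (\<lambda>_. 0) x)\<^sup>2
        - 2 * (q0 * (cdist n x (\<lambda>_. 0))\<^sup>2) * bump n q0 (\<lambda>_. 0) x) \<le> w x * real n"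
      by (rule mult_left_mono) (simp add: w_def)
    then show "w x * (real n * (bump n q0 (\<lambda>_. 0) x)\<^sup>2
        - 2 * (q0 * (cdist n x (\<lambda>_. 0))\<^sup>2) * bump n q0 (\<lambda>_. 0) x) \<le> real n * w x" by (simp only: mult.commute)
  qed
  also have "\<dots> = real n * (\<integral>x. w x \<partial>lebC n)" by simp
  also have "\<dots> \<le> real n * K"
  proof (rule mult_left_mono)
    have "ennreal (\<integral>x. w x \<partial>lebC n) = (\<integral>\<^sup>+x. ennreal (w x) \<partial>lebC n)"
      unfolding w_def by (rule nn_integral_eq_integral[symmetric, OF wloc_integrable[OF W fin']]) auto
    also have "\<dots> = mass_in_ball n (1 - 4 * t) W"
      unfolding w_def by (rule nn_integral_cong_AE) (use AE_wloc[OF W fin'] in auto)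
    also have "\<dots> \<le> ennreal K" using fin unfolding th .
    finally show "(\<integral>x. w x \<partial>lebC n) \<le> K" using K by (subst (asm) ennreal_le_iff) auto
  qed simp
  finally have "q0 * lapl n w q0 (\<lambda>_. 0) / c1 ^ 3 \<le> q0 * (real n * K) / c1 ^ 3"
    using q0 c1 by (intro divide_right_mono mult_left_mono) auto
  with 1 show ?thesis unfolding th w_def[symmetric] Pe by (simp add: mult_ac)
qed

section \<open>From means to values\<close>

lemma square_taylor:
  fixes u d :: real
  shows "\<bar>(max 0 (u - d))\<^sup>2 - ((max 0 u)\<^sup>2 - 2 * max 0 u * d)\<bar> \<le> d\<^sup>2"
proof -
  have id: "(u - d)\<^sup>2 = u\<^sup>2 - 2 * u * d + d\<^sup>2" by (simp add: power2_eq_square algebra_simps)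
  consider "0 \<le> u" "d \<le> u" | "0 \<le> u" "u < d" | "u < 0" "d \<le> u" | "u < 0" "u < d" by linarith
  then show ?thesis
  proof cases
    case 1
    then show ?thesis using id by (simp add: max_def)
  next
    case 2
    have "(d - u)\<^sup>2 \<le> d\<^sup>2" using 2 by (intro power_mono) auto
    moreover have "(d - u)\<^sup>2 = (u - d)\<^sup>2" by (simp add: power2_eq_square algebra_simps)
    ultimately show ?thesis using 2 id zero_le_power2[of "u - d"] by (simp add: max_def)
  next
    case 3
    have "(u - d)\<^sup>2 \<le> (- d)\<^sup>2" using 3 by (intro power_mono) auto
    then show ?thesis using 3 by (simp add: max_def)
  next
    case 4
    then show ?thesis by (simp add: max_def)
  qed
qed

lemma has_real_derivative_of_quadratic_error:
  fixes f :: "real \<Rightarrow> real"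
  assumes "\<And>y. \<bar>f y - f x - D * (y - x)\<bar> \<le> C * (y - x)\<^sup>2"
  shows "(f has_real_derivative D) (at x)"
proof -
  have "((\<lambda>y. (f y - f x) / (y - x) - D) \<longlongrightarrow> 0) (at x)"
  proof (rule Lim_null_comparison)
    show "\<forall>\<^sub>F y in at x. norm ((f y - f x) / (y - x) - D) \<le> C * \<bar>y - x\<bar>"
      unfolding eventually_at_filter
    proof (intro always_eventually allI impI)
      fix y assume "y \<noteq> x"
      then have "(f y - f x) / (y - x) - D = (f y - f x - D * (y - x)) / (y - x)" by (simp add: field_simps)
      then have "norm ((f y - f x) / (y - x) - D) = \<bar>f y - f x - D * (y - x)\<bar> / \<bar>y - x\<bar>" by simp
      also have "\<dots> \<le> C * (y - x)\<^sup>2 / \<bar>y - x\<bar>" by (intro divide_right_mono assms) auto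
      also have "\<dots> = C * \<bar>y - x\<bar>"
      proof -
        define a where "a = \<bar>y - x\<bar>"
        have "(y - x)\<^sup>2 = a * a" by (simp add: a_def power2_eq_square)
        moreover have "a \<noteq> 0" using \<open>y \<noteq> x\<close> by (simp add: a_def)
        ultimately show ?thesis unfolding a_def[symmetric] by simp
      qed
      finally show "norm ((f y - f x) / (y - x) - D) \<le> C * \<bar>y - x\<bar>" .
    qed
    have "((\<lambda>y. C * \<bar>y - x\<bar>) \<longlongrightarrow> C * \<bar>x - x\<bar>) (at x)" by (intro tendsto_intros)
    then show "((\<lambda>y. C * \<bar>y - x\<bar>) \<longlongrightarrow> 0) (at x)" by simp
  qed
  then show ?thesis by (simp add: has_field_derivative_iff LIM_zero_iff)
qed

text \<open>The normalised mean \<open>A q\<close> over the ball of radius \<open>1 / \<surd>q\<close> has derivative \<open>q\<^bsup>n-1\<^esup> lapl / bmass\<close>. If the Riesz mass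
  near \<open>z\<close> decays like the power \<open>2n - 2 + \<alpha>\<close> of the radius, this derivative is integrable up to \<open>q = \<infinity>\<close> and the
  means increase by at most \<open>\<beta>\<close> from radius \<open>s\<close> on; their limit is at least \<open>W z\<close> by lower semicontinuity.\<close>

lemma superh_pointwise:
  assumes W: "superh n W"
    and fin: "mass_in_ball n \<theta> W \<noteq> \<infinity>"
    and z: "z \<in> Cn n" "cnorm n z + s \<le> \<theta>" and \<theta>: "\<theta> < 1" and n: "1 \<le> n"
    and pos: "0 < s" "0 < \<alpha>" "0 < \<beta>"
    and good: "\<And>r. 0 < r \<Longrightarrow> r \<le> s \<Longrightarrow>
      1 / r\<^sup>2 * lapl n (wloc n \<theta> W) (1 / r\<^sup>2) z
        \<le> bmass n * \<beta> * (\<alpha> / 2) * (r powr (2 * real n - 2 + \<alpha>) / s powr \<alpha>)"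
  shows "W z \<le> ennreal ((\<integral>x. wloc n \<theta> W x * (bump n (1 / s\<^sup>2) z x)\<^sup>2 \<partial>lebC n) / (bmass n * s ^ (2 * n)) + \<beta>)"
proof -
  define w where "w = wloc n \<theta> W"
  define D where "D = (\<lambda>x. (cdist n x z)\<^sup>2)"
  define B where "B = (\<lambda>q. \<integral>x. w x * (bump n q z x)\<^sup>2 \<partial>lebC n)"
  define B' where "B' = (\<lambda>q. \<integral>x. w x * (D x * bump n q z x) \<partial>lebC n)"
  define A where "A = (\<lambda>q. q ^ n * B q / bmass n)"
  define qs where "qs = 1 / s\<^sup>2"
  \<comment> \<open>\<open>g\<close> is decreasing, because the derivative of its second term cancels the bound for the first one.\<close>
  define g where "g = (\<lambda>q. A q + \<beta> * (q powr (- \<alpha> / 2)) / s powr \<alpha>)"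
  have bm: "0 < bmass n" by (rule bmass)
  have qs: "0 < qs" using pos by (simp add: qs_def)
  note [measurable] = superh_measurable[OF W]
  have bumpeq: "bump n q z x = max 0 (1 - q * D x)" for q x by (simp add: bump_def D_def)
  have Db: "0 \<le> D x" "D x \<le> 4" if "cnorm n x \<le> \<theta>" for x
  proof -
    have "cdist n x z \<le> 2" using cdist_le_cnorm[of n x z] that z \<theta> pos by linarith
    then have "(cdist n x z)\<^sup>2 \<le> 2\<^sup>2" by (intro power_mono) auto
    then show "D x \<le> 4" by (simp add: D_def)
  qed (simp add: D_def)
  have bq: "\<bar>bump n q z x\<bar> \<le> 1 + 4 * \<bar>q\<bar>" if "cnorm n x \<le> \<theta>" for q x
  proof -
    have "\<bar>q * D x\<bar> \<le> \<bar>q\<bar> * 4" unfolding abs_mult using Db[OF that] by (intro mult_left_mono) auto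
    then have "1 - q * D x \<le> 1 + 4 * \<bar>q\<bar>" by linarith
    then show ?thesis unfolding bumpeq by simp
  qed
  have int0: "integrable (lebC n) w" unfolding w_def by (rule wloc_integrable[OF W fin])
  have int1: "integrable (lebC n) (\<lambda>x. w x * (bump n q z x)\<^sup>2)" for q
    unfolding w_def
  proof (rule wloc_mult_integrable[OF W fin])
    show "(\<lambda>x. (bump n q z x)\<^sup>2) \<in> borel_measurable borel" by measurable
    fix x :: "nat \<Rightarrow> complex" assume "cnorm n x \<le> \<theta>"
    then have "\<bar>bump n q z x\<bar>\<^sup>2 \<le> (1 + 4 * \<bar>q\<bar>)\<^sup>2" by (intro power_mono bq) auto
    then show "\<bar>(bump n q z x)\<^sup>2\<bar> \<le> (1 + 4 * \<bar>q\<bar>)\<^sup>2" by simp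
  qed
  have int2: "integrable (lebC n) (\<lambda>x. w x * (D x * bump n q z x))" for q
    unfolding w_def
  proof (rule wloc_mult_integrable[OF W fin])
    show "(\<lambda>x. D x * bump n q z x) \<in> borel_measurable borel" unfolding D_def by measurable
    fix x :: "nat \<Rightarrow> complex" assume x: "cnorm n x \<le> \<theta>"
    have "\<bar>D x\<bar> * \<bar>bump n q z x\<bar> \<le> 4 * (1 + 4 * \<bar>q\<bar>)" using Db[OF x] bq[OF x] by (intro mult_mono) auto
    then show "\<bar>D x * bump n q z x\<bar> \<le> 4 * (1 + 4 * \<bar>q\<bar>)" by (simp only: abs_mult)
  qed
  have derB: "(B has_real_derivative (- 2 * B' q)) (at q)" for q
  proof (rule has_real_derivative_of_quadratic_error)
    fix y
    have "B y - B q - (- 2 * B' q) * (y - q)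
       = (\<integral>x. w x * (bump n y z x)\<^sup>2 - w x * (bump n q z x)\<^sup>2 + (2 * (y - q)) * (w x * (D x * bump n q z x)) \<partial>lebC n)"
      unfolding B_def B'_def
      by (subst Bochner_Integration.integral_add, intro Bochner_Integration.integrable_diff int1,
          intro integrable_mult_right int2, subst Bochner_Integration.integral_diff, rule int1, rule int1,
          subst integral_mult_right_zero, simp add: algebra_simps)
    also have "\<bar>\<dots>\<bar> \<le> (\<integral>x. 16 * (y - q)\<^sup>2 * w x \<partial>lebC n)"
    proof (rule order_trans[OF integral_abs_bound], rule integral_mono)
      show "integrable (lebC n) (\<lambda>x. \<bar>w x * (bump n y z x)\<^sup>2 - w x * (bump n q z x)\<^sup>2 + (2 * (y - q)) * (w x * (D x * bump n q z x))\<bar>)"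
        by (intro integrable_abs Bochner_Integration.integrable_add Bochner_Integration.integrable_diff int1 integrable_mult_right int2)
      show "integrable (lebC n) (\<lambda>x. 16 * (y - q)\<^sup>2 * w x)" by (intro integrable_mult_right int0)
      fix x
      show "\<bar>w x * (bump n y z x)\<^sup>2 - w x * (bump n q z x)\<^sup>2 + (2 * (y - q)) * (w x * (D x * bump n q z x))\<bar> \<le> 16 * (y - q)\<^sup>2 * w x"
      proof (cases "cnorm n x \<le> \<theta>")
        case True
        let ?d = "(y - q) * D x"
        have "1 - y * D x = (1 - q * D x) - ?d" by (simp add: algebra_simps)
        then have "\<bar>(bump n y z x)\<^sup>2 - ((bump n q z x)\<^sup>2 - 2 * bump n q z x * ?d)\<bar> \<le> ?d\<^sup>2"
          unfolding bumpeq by (simp only: square_taylor)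
        also have "?d\<^sup>2 = (y - q)\<^sup>2 * (D x)\<^sup>2" by (simp add: power_mult_distrib)
        also have "\<dots> \<le> (y - q)\<^sup>2 * 4\<^sup>2" using Db[OF True] by (intro mult_left_mono power_mono) auto
        finally have "w x * \<bar>(bump n y z x)\<^sup>2 - ((bump n q z x)\<^sup>2 - 2 * bump n q z x * ?d)\<bar> \<le> w x * (16 * (y - q)\<^sup>2)"
          by (intro mult_left_mono) (auto simp: w_def)
        moreover have "\<bar>w x * (bump n y z x)\<^sup>2 - w x * (bump n q z x)\<^sup>2 + (2 * (y - q)) * (w x * (D x * bump n q z x))\<bar>
            = w x * \<bar>(bump n y z x)\<^sup>2 - ((bump n q z x)\<^sup>2 - 2 * bump n q z x * ?d)\<bar>"
        proof -
          have "w x * (bump n y z x)\<^sup>2 - w x * (bump n q z x)\<^sup>2 + (2 * (y - q)) * (w x * (D x * bump n q z x))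
            = w x * ((bump n y z x)\<^sup>2 - ((bump n q z x)\<^sup>2 - 2 * bump n q z x * ?d))" by (simp add: algebra_simps)
          then show ?thesis by (simp add: abs_mult w_def)
        qed
        ultimately show ?thesis by (simp add: mult_ac)
      qed (simp add: w_def wloc_def)
    qed
    also have "\<dots> = (16 * (\<integral>x. w x \<partial>lebC n)) * (y - q)\<^sup>2" by simp
    finally show "\<bar>B y - B q - (- 2 * B' q) * (y - q)\<bar> \<le> (16 * (\<integral>x. w x \<partial>lebC n)) * (y - q)\<^sup>2" .
  qed
  have lap: "lapl n w q z = real n * B q - 2 * q * B' q" for q
  proof -
    have "lapl n w q z = (\<integral>x. real n * (w x * (bump n q z x)\<^sup>2) - (2 * q) * (w x * (D x * bump n q z x)) \<partial>lebC n)"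
      unfolding lapl_def D_def by (intro Bochner_Integration.integral_cong refl) (simp add: algebra_simps)
    also have "\<dots> = (\<integral>x. real n * (w x * (bump n q z x)\<^sup>2) \<partial>lebC n) - (\<integral>x. (2 * q) * (w x * (D x * bump n q z x)) \<partial>lebC n)"
      by (rule Bochner_Integration.integral_diff) (intro integrable_mult_right int1 int2)+
    finally show ?thesis by (simp add: B_def B'_def)
  qed
  have derA: "(A has_real_derivative (q ^ (n - 1) * lapl n w q z / bmass n)) (at q)" for q
  proof -
    have "(A has_real_derivative ((real n * q ^ (n - 1) * B q + q ^ n * (- 2 * B' q)) / bmass n)) (at q)"
      unfolding A_def
      by (rule DERIV_cdivide) (auto intro!: derivative_eq_intros derB simp: algebra_simps)
    moreover have "q ^ n = q ^ (n - 1) * q" using n by (simp add: power_eq_if)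
    ultimately show ?thesis by (simp add: lap algebra_simps)
  qed
  have mono: "A q \<le> A qs + \<beta>" if q: "qs \<le> q" for q
  proof -
    have "g q \<le> g qs"
    proof (rule DERIV_nonpos_imp_nonincreasing[OF q])
      fix x assume x: "qs \<le> x" "x \<le> q"
      then have x0: "0 < x" using qs by simp
      define r where "r = 1 / sqrt x"
      have r: "0 < r" "1 / r\<^sup>2 = x" using x0 by (auto simp: r_def power_divide)
      have "r \<le> s"
      proof (rule power2_le_imp_le)
        show "r\<^sup>2 \<le> s\<^sup>2" using x x0 pos by (simp add: r_def qs_def power_divide field_simps)
      qed (use pos in simp)
      from good[OF r(1) this] have gd: "x * lapl n w x z \<le> bmass n * \<beta> * (\<alpha> / 2) * (r powr (2 * real n - 2 + \<alpha>) / s powr \<alpha>)"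
        unfolding r(2) w_def .
      have rp: "r powr y = x powr (- y / 2)" for y
      proof -
        have "r = x powr (- 1 / 2)" using x0 by (simp add: r_def powr_half_sqrt[symmetric] powr_minus_divide)
        then show ?thesis by (simp add: powr_powr)
      qed
      have "x ^ (n - 1) * lapl n w x z / bmass n = x powr (real n - 2) * (x * lapl n w x z) / bmass n"
      proof -
        have "x powr (real n - 2) * x powr 1 = x powr (real n - 1)" by (subst powr_add[symmetric]) simp
        moreover have "x powr (real n - 1) = x ^ (n - 1)" using n x0 by (simp add: powr_realpow[symmetric] of_nat_diff)
        ultimately show ?thesis using x0 by (simp add: mult.assoc[symmetric])
      qed
      also have "\<dots> \<le> x powr (real n - 2) * (bmass n * \<beta> * (\<alpha> / 2) * (r powr (2 * real n - 2 + \<alpha>) / s powr \<alpha>)) / bmass n"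
        using bm by (intro divide_right_mono mult_left_mono gd) auto
      also have "\<dots> = \<beta> * (\<alpha> / 2) * (x powr (real n - 2) * r powr (2 * real n - 2 + \<alpha>)) / s powr \<alpha>"
        using bm by (simp add: field_simps)
      also have "x powr (real n - 2) * r powr (2 * real n - 2 + \<alpha>) = x powr (- \<alpha> / 2 - 1)"
        unfolding rp by (subst powr_add[symmetric]) (simp add: field_simps)
      finally have le: "x ^ (n - 1) * lapl n w x z / bmass n \<le> \<beta> * (\<alpha> / 2) * x powr (- \<alpha> / 2 - 1) / s powr \<alpha>" .
      have "(g has_real_derivative (x ^ (n - 1) * lapl n w x z / bmass n + \<beta> * ((- \<alpha> / 2) * x powr (- \<alpha> / 2 - 1)) / s powr \<alpha>)) (at x)"
        unfolding g_def
        by (intro DERIV_add derA DERIV_cdivide DERIV_cmult has_real_derivative_powr[OF x0])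
      moreover have "x ^ (n - 1) * lapl n w x z / bmass n + \<beta> * ((- \<alpha> / 2) * x powr (- \<alpha> / 2 - 1)) / s powr \<alpha> \<le> 0"
        using le by simp
      ultimately show "\<exists>y. (g has_real_derivative y) (at x) \<and> y \<le> 0" by blast
    qed
    moreover have "g qs = A qs + \<beta>"
    proof -
      have "qs powr (- \<alpha> / 2) = s powr \<alpha>"
      proof -
        have "qs = s powr (- 2)" using pos by (simp add: qs_def powr_minus_divide)
        then show ?thesis by (simp add: powr_powr)
      qed
      then show ?thesis using pos by (simp add: g_def)
    qed
    moreover have "A q \<le> g q" using pos by (simp add: g_def)
    ultimately show ?thesis by simp
  qed
  define L where "L = A qs + \<beta>"
  have Bnn: "0 \<le> B q" for q unfolding B_def by (rule Bochner_Integration.integral_nonneg) (simp add: w_def)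
  have L: "0 \<le> L" using Bnn[of qs] bm pos qs by (simp add: L_def A_def)
  have "W z \<le> ennreal L"
  proof (rule ccontr)
    assume "\<not> ?thesis"
    then have "ennreal L < W z" by simp
    then obtain c' where c': "ennreal L < c'" "c' < W z" using dense by blast
    then obtain c where c: "c' = ennreal c" "0 \<le> c" by (cases c') auto
    have Lc: "L < c" using c' c L by (simp add: ennreal_less_iff)
    obtain d where d: "0 < d" "\<And>x. x \<in> Cn n \<Longrightarrow> cdist n x z < d \<Longrightarrow> ennreal c < W x"
      using superh_lsc[OF W z(1), of "ennreal c"] c' c by blast
    define r where "r = min s d"
    have r: "0 < r" "r \<le> s" "r \<le> d" using pos d by (auto simp: r_def)
    define q where "q = 1 / r\<^sup>2"
    have q: "0 < q" "1 / sqrt q = r" using r by (auto simp: q_def real_sqrt_divide)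
    have "qs \<le> q" using r pos unfolding q_def qs_def by (intro divide_left_mono power_mono) auto
    then have "A q \<le> L" unfolding L_def by (rule mono)
    have "ennreal (c * (bmass n / q ^ n)) = ennreal c * (\<integral>\<^sup>+x. ennreal ((bump n q z x)\<^sup>2) \<partial>lebC n)"
      unfolding nn_integral_bump_power2[OF q(1) z(1)] using c bm q by (simp add: ennreal_mult del: times_divide_eq_right)
    also have "\<dots> = (\<integral>\<^sup>+x. ennreal c * ennreal ((bump n q z x)\<^sup>2) \<partial>lebC n)"
      by (rule nn_integral_cmult[symmetric]) measurable
    also have "\<dots> \<le> (\<integral>\<^sup>+x. W x * ennreal ((bump n q z x)\<^sup>2) \<partial>lebC n)"
    proof (rule nn_integral_mono_AE, use AE_lebC_Cn[of n] in eventually_elim)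
      fix x assume x: "x \<in> Cn n"
      show "ennreal c * ennreal ((bump n q z x)\<^sup>2) \<le> W x * ennreal ((bump n q z x)\<^sup>2)"
      proof (cases "bump n q z x = 0")
        case False
        then have "cdist n x z < r" using bump_nonzero[OF False q(1)] q by simp
        then show ?thesis using d(2)[OF x] r by (intro mult_right_mono) (auto intro: less_imp_le)
      qed simp
    qed
    also have "\<dots> = (\<integral>\<^sup>+x. ennreal (w x * (bump n q z x)\<^sup>2) \<partial>lebC n)"
      unfolding w_def
    proof (rule nn_integral_wloc[OF W fin])
      fix x assume "(bump n q z x)\<^sup>2 \<noteq> 0"
      then have "cdist n x z < r" using bump_nonzero[of n q z x] q by simp
      then show "cnorm n x \<le> \<theta>" using cnorm_le_cdist[of n x z] z r by linarith
    qed
    also have "\<dots> = ennreal (B q)"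
      unfolding B_def by (rule nn_integral_eq_integral[OF int1]) (simp add: w_def)
    finally have "c * (bmass n / q ^ n) \<le> B q" using Bnn by (subst (asm) ennreal_le_iff) auto
    then have "c \<le> A q" using q bm by (simp add: A_def field_simps)
    then show False using Lc \<open>A q \<le> L\<close> by simp
  qed
  moreover have "L = (\<integral>x. wloc n \<theta> W x * (bump n (1 / s\<^sup>2) z x)\<^sup>2 \<partial>lebC n) / (bmass n * s ^ (2 * n)) + \<beta>"
    using pos by (simp add: L_def A_def B_def w_def qs_def power_divide power_mult)
  ultimately show ?thesis by simp
qed

section \<open>Vitali covering\<close>

text \<open>Zorn's lemma yields a maximal disjoint family with the property that a ball which meets the family meets
  a member of at least half its radius. By maximality every ball meets the family, since otherwise one of nearly the largest
  radius among the missing ones could be added. Only the centres have to be covered, so the factor is 3.\<close>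

lemma vitali_selection:
  fixes d :: "'a \<Rightarrow> 'a \<Rightarrow> real" and r :: "'a \<Rightarrow> real"
  assumes sym: "\<And>x y. d x y = d y x" and refl: "\<And>x. d x x = 0"
    and r: "\<And>x. x \<in> S \<Longrightarrow> 0 < r x \<and> r x \<le> R"
  obtains C where "C \<subseteq> S" "\<And>x y. x \<in> C \<Longrightarrow> y \<in> C \<Longrightarrow> x \<noteq> y \<Longrightarrow> r x + r y \<le> d x y"
    "\<And>x. x \<in> S \<Longrightarrow> \<exists>c\<in>C. d x c < 3 * r c"
proof -
  define meets where "meets = (\<lambda>x c. d x c < r x + r c)"
  define \<F> where "\<F> = {C. C \<subseteq> S \<and> (\<forall>x\<in>C. \<forall>y\<in>C. x \<noteq> y \<longrightarrow> \<not> meets x y)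
    \<and> (\<forall>x\<in>S. (\<exists>c\<in>C. meets x c) \<longrightarrow> (\<exists>c\<in>C. meets x c \<and> r x \<le> 2 * r c))}"
  have "{} \<in> \<F>" by (simp add: \<F>_def)
  then have "\<F> \<noteq> {}" by blast
  moreover have "\<Union>\<C> \<in> \<F>" if "\<C> \<noteq> {}" "subset.chain \<F> \<C>" for \<C>
  proof -
    have sub: "\<C> \<subseteq> \<F>" and lin: "\<And>A B. A \<in> \<C> \<Longrightarrow> B \<in> \<C> \<Longrightarrow> A \<subseteq> B \<or> B \<subseteq> A"
      using that(2) by (auto simp: subset_chain_def)
    have "\<not> meets x y" if "x \<in> \<Union>\<C>" "y \<in> \<Union>\<C>" "x \<noteq> y" for x y
    proof -
      obtain A B where "A \<in> \<C>" "x \<in> A" "B \<in> \<C>" "y \<in> B" using \<open>x \<in> \<Union>\<C>\<close> \<open>y \<in> \<Union>\<C>\<close> by blast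
      with lin obtain E where "E \<in> \<C>" "x \<in> E" "y \<in> E" by blast
      then show ?thesis using sub \<open>x \<noteq> y\<close> unfolding \<F>_def by blast
    qed
    moreover have "\<exists>c\<in>\<Union>\<C>. meets x c \<and> r x \<le> 2 * r c" if "x \<in> S" "\<exists>c\<in>\<Union>\<C>. meets x c" for x
    proof -
      obtain A c where A: "A \<in> \<C>" "c \<in> A" "meets x c" using \<open>\<exists>c\<in>\<Union>\<C>. meets x c\<close> by blast
      then have "A \<in> \<F>" using sub by blast
      then have "\<exists>c\<in>A. meets x c \<and> r x \<le> 2 * r c" using A \<open>x \<in> S\<close> unfolding \<F>_def by blast
      then show ?thesis using A by blast
    qed
    moreover have "\<Union>\<C> \<subseteq> S" using sub by (auto simp: \<F>_def)
    ultimately show ?thesis unfolding \<F>_def by blast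
  qed
  ultimately obtain M where M: "M \<in> \<F>" "\<And>X. X \<in> \<F> \<Longrightarrow> M \<subseteq> X \<Longrightarrow> X = M"
    using subset_Zorn_nonempty[of \<F>] by blast
  have Msub: "M \<subseteq> S" using M(1) by (simp add: \<F>_def)
  have Mdisj: "\<not> meets x y" if "x \<in> M" "y \<in> M" "x \<noteq> y" for x y
    using M(1) that unfolding \<F>_def by blast
  have Mbig: "\<exists>c\<in>M. meets x c \<and> r x \<le> 2 * r c" if "x \<in> S" "\<exists>c\<in>M. meets x c" for x
  proof -
    have "\<forall>x\<in>S. (\<exists>c\<in>M. meets x c) \<longrightarrow> (\<exists>c\<in>M. meets x c \<and> r x \<le> 2 * r c)"
      using M(1) by (simp add: \<F>_def)
    then show ?thesis using that by blast
  qed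
  have all: "\<exists>c\<in>M. meets x c" if "x \<in> S" for x
  proof (rule ccontr)
    assume no: "\<not> ?thesis"
    define T where "T = {x \<in> S. \<not> (\<exists>c\<in>M. meets x c)}"
    have "x \<in> T" using no that by (simp add: T_def)
    have bdd: "bdd_above (r ` T)" using r by (intro bdd_aboveI[of _ R]) (auto simp: T_def)
    have rx: "0 < r x" using r that by blast
    have le: "r y \<le> Sup (r ` T)" if "y \<in> T" for y using bdd that by (intro cSup_upper) auto
    then have "0 < Sup (r ` T)" using rx \<open>x \<in> T\<close> by fastforce
    then have "Sup (r ` T) / 2 < Sup (r ` T)" by simp
    then obtain z where z: "z \<in> T" "Sup (r ` T) / 2 < r z"
      using less_cSup_iff[of "r ` T"] bdd \<open>x \<in> T\<close> by blast
    have zS: "z \<in> S" and zM: "\<And>c. c \<in> M \<Longrightarrow> \<not> meets z c" using z by (auto simp: T_def)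
    have zz: "meets z z" using r[OF zS] by (simp add: meets_def refl)
    have symm: "meets u v \<longleftrightarrow> meets v u" for u v by (simp add: meets_def sym add.commute)
    have "insert z M \<in> \<F>"
    proof -
      have "insert z M \<subseteq> S" using Msub zS by blast
      moreover have "\<not> meets u v" if "u \<in> insert z M" "v \<in> insert z M" "u \<noteq> v" for u v
        using that Mdisj zM symm by blast
      moreover have "\<exists>c\<in>insert z M. meets u c \<and> r u \<le> 2 * r c" if u: "u \<in> S" "\<exists>c\<in>insert z M. meets u c" for u
      proof (cases "\<exists>c\<in>M. meets u c")
        case True
        then show ?thesis using Mbig[OF u(1) True] by blast
      next
        case False
        then have "u \<in> T" using u by (simp add: T_def)
        then have "r u \<le> 2 * r z" using le[of u] z by linarith
        then show ?thesis using False u by blast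
      qed
      ultimately show ?thesis unfolding \<F>_def by blast
    qed
    then have "insert z M = M" using M(2) by blast
    then show False using zM zz by blast
  qed
  show thesis
  proof (rule that[of M])
    show "M \<subseteq> S" by (rule Msub)
    show "r x + r y \<le> d x y" if "x \<in> M" "y \<in> M" "x \<noteq> y" for x y
      using Mdisj[OF that] by (simp add: meets_def)
    show "\<exists>c\<in>M. d x c < 3 * r c" if x: "x \<in> S" for x
    proof -
      obtain c where "c \<in> M" "meets x c" "r x \<le> 2 * r c" using Mbig[OF x all[OF x]] by blast
      then show ?thesis by (intro bexI[of _ c]) (auto simp: meets_def)
    qed
  qed
qed

section \<open>The estimate for superharmonic functions\<close>

lemma exists_power_factor_below:
  fixes a b :: real
  assumes "0 < a" "a < b"
  obtains \<theta> where "0 < \<theta>" "\<theta> \<le> 1" "(1 + \<theta>) ^ k * a < b"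
proof -
  have "((\<lambda>\<theta>. (1 + \<theta>) ^ k * a) \<longlongrightarrow> (1 + 0) ^ k * a) (at_right 0)" by (intro tendsto_intros)
  then have "\<forall>\<^sub>F \<theta> in at_right 0. (1 + \<theta>) ^ k * a < b" using assms by (intro order_tendstoD) auto
  moreover have "\<forall>\<^sub>F \<theta> in at_right (0::real). \<theta> \<in> {0<..<1}" by (intro eventually_at_right_real) simp
  ultimately have "\<forall>\<^sub>F \<theta> in at_right 0. (1 + \<theta>) ^ k * a < b \<and> \<theta> \<in> {0<..<1}" by (rule eventually_conj)
  then obtain \<theta> where "(1 + \<theta>) ^ k * a < b" "\<theta> \<in> {0<..<1}"
    using eventually_happens trivial_limit_at_right_real by blast
  then show thesis by (intro that[of \<theta>]) auto
qed

definition thin_balls :: "nat \<Rightarrow> real \<Rightarrow> real \<Rightarrow> (nat \<Rightarrow> complex) set \<Rightarrow> ((nat \<Rightarrow> complex) \<Rightarrow> real) \<Rightarrow> bool" where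
  "thin_balls n \<alpha> \<eta> C r \<longleftrightarrow> C \<subseteq> Cn n \<and> countable C \<and> (\<forall>c\<in>C. 0 < r c \<and> r c \<le> \<eta>) \<and>
    (\<lambda>c. r c powr (2 * real n - 2 + \<alpha>)) summable_on C \<and>
    (\<Sum>\<^sub>\<infinity>c\<in>C. r c powr (2 * real n - 2 + \<alpha>))
      < 9 ^ (n - 1) * exp 1 powr (2 * real n - 2 + \<alpha>) * \<eta> powr \<alpha> / \<alpha>"

text \<open>A point is bad if at some radius \<open>\<rho> \<le> s\<close> the Riesz mass is too large for the previous estimate. The packing
  estimate bounds the sum of the powers of the radii for a disjoint subfamily, and the enlargement
  by the factor 3 turns \<open>s = \<eta> / 3\<close> into \<open>\<eta>\<close> and produces \<open>3\<^bsup>2n-2\<^esup> = 9\<^bsup>n-1\<^esup>\<close>. The remaining constant is made less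
  than 1 by the choice of \<open>\<beta>\<close>. At the other points \<open>W\<close> exceeds a mean by at most \<open>\<beta>\<close>, and the mean is at most
  \<open>Q nu \<sigma> \<tau> ln (1/\<eta>)\<close> up to a constant. As \<open>Q nu \<sigma> \<tau> < \<nu>\<close>, all constants, which may depend on \<open>n\<close>, disappear when
  \<open>\<eta>\<close> is small.\<close>

lemma superh_upper_bound_outside_balls:
  assumes st: "0 < \<sigma>" "\<sigma> < 1" "0 < \<tau>" "\<tau> < 1" and \<nu>: "nu \<sigma> \<tau> < \<nu>" and n: "1 \<le> n"
  obtains \<eta>\<^sub>0 where "0 < \<eta>\<^sub>0" "\<eta>\<^sub>0 < 1"
    "\<And>W z0 \<alpha> \<eta>. superh n W \<Longrightarrow> z0 \<in> Cn n \<Longrightarrow> cnorm n z0 \<le> \<sigma> \<Longrightarrow> W z0 \<le> 1 \<Longrightarrow>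
      0 < \<alpha> \<Longrightarrow> \<alpha> \<le> 2 \<Longrightarrow> 0 < \<eta> \<Longrightarrow> \<eta> < \<eta>\<^sub>0 \<Longrightarrow>
      \<exists>C r. thin_balls n \<alpha> \<eta> C r \<and>
        (\<forall>z\<in>Cn n. cnorm n z \<le> \<tau> \<longrightarrow> (\<forall>c\<in>C. r c \<le> cdist n z c) \<longrightarrow> W z \<le> ennreal (\<nu> * ln (1 / \<eta>)))"
proof -
  define t where "t = (1 - \<tau>) / 8"
  have t: "0 < t" "t < 1/8" "\<tau> = 1 - 8 * t" using st by (auto simp: t_def field_simps)
  obtain K where K: "0 < K"
    "\<And>W z0. superh n W \<Longrightarrow> z0 \<in> Cn n \<Longrightarrow> cnorm n z0 \<le> \<sigma> \<Longrightarrow> W z0 \<le> 1 \<Longrightarrow>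
      mass_in_ball n ((1 + \<tau>) / 2) W \<le> ennreal K"
    using superh_L1_bound[OF st, of n] by blast
  \<comment> \<open>the constant of the packing estimate\<close>
  define P where "P = real n * (1 / (1 - 6 * ((1 - \<tau>) / 8))\<^sup>2)
      / (1 - ((1 - 7 * ((1 - \<tau>) / 8)) / (1 - 6 * ((1 - \<tau>) / 8)))\<^sup>2) ^ 3"
  have P: "0 \<le> P"
  proof -
    have "((1 - 7 * t) / (1 - 6 * t))\<^sup>2 \<le> 1\<^sup>2" using t by (intro power_mono) (auto simp: field_simps)
    then show ?thesis unfolding P_def t_def[symmetric] by (intro divide_nonneg_nonneg mult_nonneg_nonneg zero_le_power) (use t in auto)
  qed
  obtain \<theta> where \<theta>: "0 < \<theta>" "\<theta> \<le> 1" "(1 + \<theta>) ^ (2 * n + 2) * nu \<sigma> \<tau> < \<nu>"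
    by (rule exists_power_factor_below[OF nu_pos[OF st] \<nu>])
  define Q where "Q = (1 + \<theta>) ^ (2 * n + 2)"
  have Q: "0 < Q" using \<theta> by (simp add: Q_def)
  define \<beta> where "\<beta> = 2 * P * K / bmass n + 1"
  have bm: "0 < bmass n" by (rule bmass)
  have "0 \<le> 2 * P * K / bmass n" using P K(1) bm by simp
  then have \<beta>: "0 < \<beta>" "2 * P * K < bmass n * \<beta>" using bm by (auto simp: \<beta>_def distrib_left)
  \<comment> \<open>All additive constants are collected in \<open>c0\<close>, and \<open>\<eta>\<^sub>0\<close> is so small that \<open>c0 \<le> gap * ln (1/\<eta>)\<close>.\<close>
  define c0 where "c0 = Q * (2 + nu \<sigma> \<tau> * (ln (3 / \<theta>) + (ln 2 - ln (1 - \<tau>\<^sup>2) / 2))) + \<beta>"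
  define gap where "gap = \<nu> - Q * nu \<sigma> \<tau>"
  have gap: "0 < gap" using \<theta> by (simp add: gap_def Q_def)
  define \<eta>\<^sub>0 where "\<eta>\<^sub>0 = min (min (1/2) t) (exp (- (c0 / gap)))"
  have eta0: "0 < \<eta>\<^sub>0" "\<eta>\<^sub>0 \<le> 1/2" "\<eta>\<^sub>0 \<le> t" "\<eta>\<^sub>0 \<le> exp (- (c0 / gap))"
    using t unfolding \<eta>\<^sub>0_def by (auto intro: min.coboundedI1 min.coboundedI2)
  show thesis
  proof (rule that[of \<eta>\<^sub>0])
    show "0 < \<eta>\<^sub>0" "\<eta>\<^sub>0 < 1" using eta0 by auto
    fix W z0 and \<alpha> \<eta> :: real
    assume W: "superh n W" and z0: "z0 \<in> Cn n" "cnorm n z0 \<le> \<sigma>" "W z0 \<le> 1"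
      and \<alpha>: "0 < \<alpha>" "\<alpha> \<le> 2" and \<eta>: "0 < \<eta>" "\<eta> < \<eta>\<^sub>0"
    define s where "s = \<eta> / 3"
    have s: "0 < s" "s \<le> t" "3 * s = \<eta>" "s < 1" using \<eta> eta0 by (auto simp: s_def)
    define e where "e = 2 * real n - 2 + \<alpha>"
    have e: "0 < e" using n \<alpha> by (simp add: e_def)
    define w where "w = wloc n ((1 + \<tau>) / 2) W"
    note fin = K(2)[OF W z0]
    have fin': "mass_in_ball n ((1 + \<tau>) / 2) W \<noteq> \<infinity>"
      using fin by (auto simp: top_unique)
    define a where "a = bmass n * \<beta> * (\<alpha> / 2)"
    have a: "0 < a" using bm \<beta> \<alpha> by (simp add: a_def)
    define bad where "bad = (\<lambda>z \<rho>. 0 < \<rho> \<and> \<rho> \<le> s \<and> a * (\<rho> powr e / s powr \<alpha>) < 1 / \<rho>\<^sup>2 * lapl n w (1 / \<rho>\<^sup>2) z)"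
    define S where "S = {z \<in> Cn n. cnorm n z \<le> \<tau> \<and> (\<exists>\<rho>. bad z \<rho>)}"
    define rr where "rr = (\<lambda>z. SOME \<rho>. bad z \<rho>)"
    have rr: "bad z (rr z)" if "z \<in> S" for z
      using that unfolding S_def rr_def by (auto intro: someI_ex)
    have rrs: "0 < rr z \<and> rr z \<le> s" if "z \<in> S" for z using rr[OF that] by (simp add: bad_def)
    obtain C where C: "C \<subseteq> S" "\<And>x y. x \<in> C \<Longrightarrow> y \<in> C \<Longrightarrow> x \<noteq> y \<Longrightarrow> rr x + rr y \<le> cdist n x y"
        "\<And>x. x \<in> S \<Longrightarrow> \<exists>c\<in>C. cdist n x c < 3 * rr c"
      using vitali_selection[of "cdist n" S rr s, OF cdist_commute _ rrs] by auto
    define Bd where "Bd = P * K * s powr \<alpha> / a"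
    have fsum: "(\<Sum>z\<in>F. rr z powr e) \<le> Bd" if F: "finite F" "F \<subseteq> C" for F
    proof -
      have FS: "F \<subseteq> S" using F C by blast
      have "(\<Sum>z\<in>F. a * (rr z powr e / s powr \<alpha>)) \<le> (\<Sum>z\<in>F. 1 / (rr z)\<^sup>2 * lapl n w (1 / (rr z)\<^sup>2) z)"
        using rr FS by (intro sum_mono) (auto simp: bad_def intro: less_imp_le)
      also have "\<dots> \<le> P * K"
        unfolding w_def
      proof (rule superh_packing[OF W st(3,4) _ fin F(1) _ _ _ _ P_def])
        show "0 \<le> K" using K by simp
        show "F \<subseteq> Cn n" using FS by (auto simp: S_def)
        show "cnorm n z \<le> \<tau>" if "z \<in> F" for z using FS that by (auto simp: S_def)
        show "0 < rr z \<and> rr z \<le> (1 - \<tau>) / 8" if "z \<in> F" for z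
          using rrs[of z] FS that s(2) unfolding t_def[symmetric] by force
        show "rr z + rr z' \<le> cdist n z z'" if "z \<in> F" "z' \<in> F" "z \<noteq> z'" for z z'
          using C(2) F that by blast
      qed
      finally have "a / s powr \<alpha> * (\<Sum>z\<in>F. rr z powr e) \<le> P * K"
        by (simp add: sum_distrib_left)
      then show ?thesis using a s by (simp add: Bd_def field_simps)
    qed
    have sm: "(\<lambda>c. rr c powr e) summable_on C"
      by (rule nonneg_bdd_above_summable_on) (auto intro!: bdd_aboveI[of _ Bd] fsum)
    have scale: "(3 * rr c) powr e = 3 powr e * rr c powr e" if "c \<in> C" for c
      using rrs[of c] C that by (subst powr_mult) auto
    have sm3: "(\<lambda>c. (3 * rr c) powr e) summable_on C"
      using summable_on_cmult_right[OF sm, of "3 powr e"] by (simp add: scale cong: summable_on_cong)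
    have cnt: "countable C"
    proof -
      have "countable {c \<in> C. rr c powr e \<noteq> 0}"
        by (rule summable_countable_real[OF sm])
      also have "{c \<in> C. rr c powr e \<noteq> 0} = C" using rrs C by force
      finally show ?thesis .
    qed
    have tot: "(\<Sum>\<^sub>\<infinity>c\<in>C. (3 * rr c) powr e) < 9 ^ (n - 1) * exp 1 powr e * \<eta> powr \<alpha> / \<alpha>"
    proof -
      have "(\<Sum>\<^sub>\<infinity>c\<in>C. (3 * rr c) powr e) = (\<Sum>\<^sub>\<infinity>c\<in>C. 3 powr e * rr c powr e)"
        by (rule infsum_cong) (rule scale)
      also have "\<dots> = 3 powr e * (\<Sum>\<^sub>\<infinity>c\<in>C. rr c powr e)" by (rule infsum_cmult_right) (rule sm)
      also have "\<dots> \<le> 3 powr e * Bd"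
        by (intro mult_left_mono infsum_le_finite_sums sm fsum) auto
      also have "3 powr e = 9 ^ (n - 1) * 3 powr \<alpha>"
      proof -
        have "3 powr e = 3 powr (2 * real (n - 1)) * 3 powr \<alpha>"
          using n unfolding e_def by (subst powr_add[symmetric]) (simp add: of_nat_diff algebra_simps)
        also have "3 powr (2 * real (n - 1)) = (3::real) ^ (2 * (n - 1))" by (subst powr_realpow[symmetric]) auto
        finally show ?thesis by (simp add: power_mult)
      qed
      also have "9 ^ (n - 1) * 3 powr \<alpha> * Bd = 9 ^ (n - 1) * ((3 * s) powr \<alpha> / \<alpha>) * (2 * P * K / (bmass n * \<beta>))"
        using s bm \<beta> \<alpha> by (subst powr_mult) (simp_all add: Bd_def a_def field_simps)
      also have "\<dots> < 9 ^ (n - 1) * ((3 * s) powr \<alpha> / \<alpha>) * 1"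
      proof (rule mult_strict_left_mono)
        show "2 * P * K / (bmass n * \<beta>) < 1" using \<beta> bm by simp
        show "0 < 9 ^ (n - 1) * ((3 * s) powr \<alpha> / \<alpha>)" using s \<alpha> by simp
      qed
      also have "\<dots> \<le> 9 ^ (n - 1) * ((3 * s) powr \<alpha> / \<alpha>) * exp 1 powr e"
        using s \<alpha> e by (intro mult_left_mono) (auto simp: exp_powr_real)
      finally show ?thesis unfolding s(3) by (simp add: mult_ac)
    qed
    have val: "W z \<le> ennreal (\<nu> * ln (1 / \<eta>))"
      if z: "z \<in> Cn n" "cnorm n z \<le> \<tau>" and out: "\<forall>c\<in>C. 3 * rr c \<le> cdist n z c" for z
    proof -
      have "z \<notin> S" using C(3) out by fastforce
      then have good: "1 / \<rho>\<^sup>2 * lapl n w (1 / \<rho>\<^sup>2) z \<le> a * (\<rho> powr e / s powr \<alpha>)" if "0 < \<rho>" "\<rho> \<le> s" for \<rho>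
        using z that unfolding S_def bad_def by force
      let ?m = "\<integral>x. w x * (bump n (1 / s\<^sup>2) z x)\<^sup>2 \<partial>lebC n"
      have Wz: "W z \<le> ennreal (?m / (bmass n * s ^ (2 * n)) + \<beta>)"
        unfolding w_def
      proof (rule superh_pointwise[OF W fin' z(1) _ _ n s(1) \<alpha>(1) \<beta>(1)])
        show "cnorm n z + s \<le> (1 + \<tau>) / 2" "(1 + \<tau>) / 2 < 1" using z s t by auto
      qed (use good in \<open>simp add: w_def a_def e_def\<close>)
      have bq: "0 < 1 / s\<^sup>2" "1 / sqrt (1 / s\<^sup>2) = s" using s by (auto simp: real_sqrt_divide)
      have int: "integrable (lebC n) (\<lambda>x. w x * (bump n (1 / s\<^sup>2) z x)\<^sup>2)"
        unfolding w_def
      proof (rule wloc_mult_integrable[OF W fin'])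
        show "\<bar>(bump n (1 / s\<^sup>2) z x)\<^sup>2\<bar> \<le> 1" for x
          using bump_le_1[of "1 / s\<^sup>2" n z x] by (simp add: power_le_one)
      qed measurable
      have "ennreal ?m = (\<integral>\<^sup>+x. ennreal (w x * (bump n (1 / s\<^sup>2) z x)\<^sup>2) \<partial>lebC n)"
        by (rule nn_integral_eq_integral[symmetric, OF int]) (simp add: w_def)
      also have "\<dots> = (\<integral>\<^sup>+x. W x * ennreal ((bump n (1 / s\<^sup>2) z x)\<^sup>2) \<partial>lebC n)"
        unfolding w_def
      proof (rule nn_integral_wloc[symmetric, OF W fin'])
        fix x assume "(bump n (1 / s\<^sup>2) z x)\<^sup>2 \<noteq> 0"
        then have "cdist n x z < s" using bump_nonzero[of n "1 / s\<^sup>2" z x] bq by simp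
        then show "cnorm n x \<le> (1 + \<tau>) / 2" using cnorm_le_cdist[of n x z] z s t by simp
      qed
      also have "\<dots> \<le> ennreal (Q * (growth \<sigma> \<tau> (\<theta> * s) + 1) * bmass n * s ^ (2 * n))"
        unfolding Q_def using s t by (intro superh_mean_bound[OF W z z0 st s(1) _ \<theta>(1,2)]) auto
      finally have "?m \<le> Q * (growth \<sigma> \<tau> (\<theta> * s) + 1) * bmass n * s ^ (2 * n)"
      proof (subst (asm) ennreal_le_iff)
        have "1 \<le> growth \<sigma> \<tau> (\<theta> * s)"
          using \<theta> s by (intro growth_ge_1 st) (auto intro: mult_le_one le_less_trans[OF mult_left_le_one_le])
        then show "0 \<le> Q * (growth \<sigma> \<tau> (\<theta> * s) + 1) * bmass n * s ^ (2 * n)" using Q bm s by simp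
      qed
      then have "?m / (bmass n * s ^ (2 * n)) \<le> Q * (growth \<sigma> \<tau> (\<theta> * s) + 1)"
        using bm s by (simp add: divide_le_eq mult_ac)
      moreover have "ln (1 / (\<theta> * s)) = ln (1 / \<eta>) + ln (3 / \<theta>)"
        using \<theta> s \<eta> by (simp add: s(3)[symmetric] ln_div ln_mult)
      then have "Q * (growth \<sigma> \<tau> (\<theta> * s) + 1) + \<beta> = Q * nu \<sigma> \<tau> * ln (1 / \<eta>) + c0"
        by (simp add: growth_def c0_def algebra_simps)
      moreover have "c0 \<le> gap * ln (1 / \<eta>)"
      proof -
        have "\<eta> < exp (- (c0 / gap))" using \<eta> eta0 by simp
        then have "ln \<eta> < - (c0 / gap)" using \<eta> by (metis exp_less_cancel_iff exp_ln)
        then have "c0 / gap \<le> ln (1 / \<eta>)" using \<eta> by (simp add: ln_div)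
        then show ?thesis using gap by (simp add: divide_le_eq mult.commute)
      qed
      ultimately have "?m / (bmass n * s ^ (2 * n)) + \<beta> \<le> \<nu> * ln (1 / \<eta>)"
        by (simp add: gap_def left_diff_distrib)
      with Wz show ?thesis using ennreal_leI order_trans by blast
    qed
    show "\<exists>C r. thin_balls n \<alpha> \<eta> C r \<and>
        (\<forall>z\<in>Cn n. cnorm n z \<le> \<tau> \<longrightarrow> (\<forall>c\<in>C. r c \<le> cdist n z c) \<longrightarrow> W z \<le> ennreal (\<nu> * ln (1 / \<eta>)))"
    proof (intro exI[of _ C] exI[of _ "\<lambda>c. 3 * rr c"] conjI)
      have "C \<subseteq> Cn n" using C by (auto simp: S_def)
      moreover have "\<forall>c\<in>C. 0 < 3 * rr c \<and> 3 * rr c \<le> \<eta>"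
      proof
        fix c assume "c \<in> C"
        then have "0 < rr c \<and> rr c \<le> s" using rrs C by blast
        then show "0 < 3 * rr c \<and> 3 * rr c \<le> \<eta>" using s by simp
      qed
      ultimately show "thin_balls n \<alpha> \<eta> C (\<lambda>c. 3 * rr c)"
        unfolding thin_balls_def e_def[symmetric] using cnt sm3 tot by blast
    qed (use val in blast)
  qed
qed

text \<open>If the infimum of \<open>W\<close> over the ball of radius \<open>\<sigma>\<close> is 0, the growth estimate makes the infima over all small
  balls vanish, and lower semicontinuity does the rest.\<close>

lemma superh_eq_0:
  assumes W: "superh n W" and z: "z \<in> Cn n" "cnorm n z \<le> \<tau>"
    and st: "0 < \<sigma>" "\<sigma> < 1" "0 < \<tau>" "\<tau> < 1"
    and small: "\<And>\<delta>. 0 < \<delta> \<Longrightarrow> \<exists>z0\<in>Cn n. cnorm n z0 \<le> \<sigma> \<and> W z0 \<le> ennreal \<delta>"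
  shows "W z = 0"
proof (rule ccontr)
  assume "W z \<noteq> 0"
  then have "0 < W z" by (simp add: zero_less_iff_neq_zero)
  then obtain c' where c': "0 < c'" "c' < W z" using dense by blast
  then obtain c where c: "c' = ennreal c" "0 < c" by (cases c') auto
  obtain d where d: "0 < d" "\<And>x. x \<in> Cn n \<Longrightarrow> cdist n x z < d \<Longrightarrow> ennreal c < W x"
    using superh_lsc[OF W z(1), of "ennreal c"] c' c by blast
  define t where "t = min (d / 2) (1 / 2)"
  have t: "0 < t" "t < 1" "t < d" using d by (auto simp: t_def min_def)
  have g: "1 \<le> growth \<sigma> \<tau> t" by (rule growth_ge_1[OF st t(1,2)])
  define \<delta> where "\<delta> = c / (2 * growth \<sigma> \<tau> t)"
  have "0 < \<delta>" using c g by (simp add: \<delta>_def)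
  from small[OF this] obtain z0 where z0: "z0 \<in> Cn n" "cnorm n z0 \<le> \<sigma>" "W z0 \<le> ennreal \<delta>" by blast
  have "ennreal (c / growth \<sigma> \<tau> t) \<le> W z0"
    using d t c by (intro superh_log_growth[OF W z z0(1,2) st t(1,2)]) (auto intro: less_imp_le)
  also note z0(3)
  finally have "c / growth \<sigma> \<tau> t \<le> \<delta>" using \<open>0 < \<delta>\<close> by (subst (asm) ennreal_le_iff) auto
  then show False using c g by (simp add: \<delta>_def field_simps)
qed

lemma superh_scale:
  assumes W: "superh n W" and c: "0 < c"
  shows "superh n (\<lambda>x. ennreal c * W x)"
proof -
  have less: "y < ennreal c * w \<longleftrightarrow> ennreal (1 / c) * y < w" for y w
  proof -
    have "y = ennreal c * (ennreal (1 / c) * y)" using c by (simp add: mult.assoc[symmetric] ennreal_mult[symmetric])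
    then have "ennreal c * w \<le> y \<longleftrightarrow> ennreal c * w \<le> ennreal c * (ennreal (1 / c) * y)" by simp
    also have "\<dots> \<longleftrightarrow> w \<le> ennreal (1 / c) * y" using c by (subst ennreal_mult_le_mult_iff) auto
    finally show ?thesis by (simp add: not_le[symmetric])
  qed
  show ?thesis
    unfolding superh_def less
  proof (intro conjI allI ballI impI)
    fix y show "open {x. ennreal (1 / c) * y < W x}" using W by (simp add: superh_def)
  next
    fix a y assume "a \<in> Cn n" "ennreal (1 / c) * y < W a"
    then show "\<exists>d>0. \<forall>z\<in>Cn n. cdist n z a < d \<longrightarrow> ennreal (1 / c) * y < W z"
      using W by (simp add: superh_def)
  next
    fix a w assume a: "a \<in> Cn n" "w \<in> Cn n" "\<forall>\<zeta>. cmod \<zeta> \<le> 1 \<longrightarrow> cnorm n (\<lambda>i. a i + \<zeta> * w i) < 1"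
    have [measurable]: "(\<lambda>t. (\<lambda>i. a i + cis t * w i)) \<in> borel_measurable lborel"
      by (intro borel_measurable_funI) (auto intro!: borel_measurable_continuous_onI continuous_intros)
    note [measurable] = superh_measurable[OF W]
    have "(\<integral>\<^sup>+t\<in>{0..2*pi}. ennreal c * W (\<lambda>i. a i + cis t * w i) \<partial>lborel)
      = ennreal c * (\<integral>\<^sup>+t\<in>{0..2*pi}. W (\<lambda>i. a i + cis t * w i) \<partial>lborel)"
      by (subst nn_integral_cmult[symmetric]) (auto simp: mult.assoc)
    also have "\<dots> \<le> ennreal c * (ennreal (2 * pi) * W a)"
      using a by (intro mult_left_mono superh_circle[OF W]) auto
    finally show "(\<integral>\<^sup>+t\<in>{0..2*pi}. ennreal c * W (\<lambda>i. a i + cis t * w i) \<partial>lborel) \<le> ennreal (2 * pi) * (ennreal c * W a)"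
      by (simp add: mult_ac)
  qed
qed

section \<open>Plurisubharmonic functions\<close>

text \<open>The positive and negative parts are never subtracted: \<open>(M - f) + f\<^sup>+ + M\<^sup>- = f\<^sup>- + M\<^sup>+\<close> is integrated, and
  only the bounded integral of \<open>f\<^sup>+\<close> is moved to the other side.\<close>

lemma circle_mean_le_bound:
  assumes [measurable]: "f \<in> borel_measurable borel" and le: "\<And>t. f t \<le> ereal M"
    and v: "v \<le> circle_mean f" "v \<le> ereal M"
  shows "(\<integral>\<^sup>+t\<in>{0..2*pi}. e2ennreal (ereal M - f t) \<partial>lborel) \<le> ennreal (2 * pi) * e2ennreal (ereal M - v)"
proof -
  define p where "p = (\<integral>\<^sup>+t\<in>{0..2*pi}. e2ennreal (f t) \<partial>lborel)"
  define m where "m = (\<integral>\<^sup>+t\<in>{0..2*pi}. e2ennreal (- f t) \<partial>lborel)"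
  define I where "I = (\<integral>\<^sup>+t\<in>{0..2*pi}. e2ennreal (ereal M - f t) \<partial>lborel)"
  have const: "(\<integral>\<^sup>+t\<in>{0..2*pi}. ennreal k \<partial>lborel) = ennreal k * ennreal (2 * pi)" for k
    by (subst nn_integral_cmult_indicator) auto
  have pw: "e2ennreal (ereal M - y) + e2ennreal y + ennreal (max 0 (- M)) = e2ennreal (- y) + ennreal (max 0 M)"
    if "y \<le> ereal M" for y
  proof (cases y)
    case (real u)
    then have "u \<le> M" using that by simp
    have "e2ennreal (ereal M - y) + e2ennreal y + ennreal (max 0 (- M)) = ennreal (M - u) + ennreal (max 0 u) + ennreal (max 0 (- M))"
      using real by (simp add: e2ennreal_ereal max_def ennreal_neg)
    also have "\<dots> = ennreal (M - u + max 0 u + max 0 (- M))" using \<open>u \<le> M\<close> by (simp add: ennreal_plus[symmetric] del: ennreal_plus)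
    also have "M - u + max 0 u + max 0 (- M) = max 0 (- u) + max 0 M" by auto
    also have "ennreal \<dots> = e2ennreal (- y) + ennreal (max 0 M)"
      using real by (simp add: e2ennreal_ereal max_def ennreal_neg)
    finally show ?thesis .
  qed (use that in \<open>auto simp: e2ennreal_infty\<close>)
  have "I + p + ennreal (max 0 (- M)) * ennreal (2 * pi) = m + ennreal (max 0 M) * ennreal (2 * pi)"
  proof -
    have "I + p + ennreal (max 0 (- M)) * ennreal (2 * pi)
      = (\<integral>\<^sup>+t\<in>{0..2*pi}. (e2ennreal (ereal M - f t) + e2ennreal (f t) + ennreal (max 0 (- M))) \<partial>lborel)"
      unfolding I_def p_def const[symmetric]
      by (simp add: nn_integral_add distrib_right)
    also have "\<dots> = (\<integral>\<^sup>+t\<in>{0..2*pi}. (e2ennreal (- f t) + ennreal (max 0 M)) \<partial>lborel)"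
      by (simp only: pw[OF le])
    also have "\<dots> = m + ennreal (max 0 M) * ennreal (2 * pi)"
      unfolding m_def const[symmetric] by (simp add: nn_integral_add distrib_right)
    finally show ?thesis .
  qed
  moreover have "p \<le> ennreal (max 0 M) * ennreal (2 * pi)"
    unfolding p_def const[symmetric]
  proof (intro nn_integral_mono mult_right_mono)
    fix t
    have "e2ennreal (f t) \<le> e2ennreal (ereal M)" by (intro e2ennreal_mono le)
    also have "\<dots> \<le> ennreal (max 0 M)" by (simp add: ennreal_leI)
    finally show "e2ennreal (f t) \<le> ennreal (max 0 M)" .
  qed simp
  ultimately have eq: "I + p + ennreal (max 0 (- M) * (2 * pi)) = m + ennreal (max 0 M * (2 * pi))"
      and ple: "p \<le> ennreal (max 0 M * (2 * pi))"
    by (simp_all add: ennreal_mult)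
  have "p < top" using ple by (rule le_less_trans) simp
  then obtain p' where p: "p = ennreal p'" "0 \<le> p'" by (cases p) auto
  have cm: "v \<le> (enn2ereal p - enn2ereal m) / ereal (2 * pi)"
    using v(1) unfolding circle_mean_def p_def m_def .
  show ?thesis
  proof (cases m)
    case top
    then have "v = - \<infinity>" using cm p by (simp add: enn2ereal_ennreal)
    then show ?thesis by (simp add: e2ennreal_infty ennreal_mult_top)
  next
    case (real m')
    have "I \<le> m + ennreal (max 0 M * (2 * pi))" unfolding eq[symmetric] by (simp add: add.assoc)
    then have "I < top" by (rule le_less_trans) (simp add: real)
    then obtain I' where I: "I = ennreal I'" "0 \<le> I'" by (cases I) auto
    have "I' + p' + max 0 (- M) * (2 * pi) = m' + max 0 M * (2 * pi)"
      using eq I p real by (simp add: ennreal_plus[symmetric] del: ennreal_plus)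
    moreover have "max 0 M - max 0 (- M) = M" by auto
    then have "max 0 M * (2 * pi) - max 0 (- M) * (2 * pi) = M * (2 * pi)" by (simp add: left_diff_distrib[symmetric])
    ultimately have I'eq: "I' = 2 * pi * M - (p' - m')" by (simp add: mult.commute)
    show ?thesis
    proof (cases v)
      case (real v')
      have "v' \<le> (p' - m') / (2 * pi)"
        using cm p \<open>m = ennreal m'\<close> \<open>0 \<le> m'\<close> real by (simp add: enn2ereal_ennreal)
      then have "v' * (2 * pi) \<le> p' - m'" by (subst (asm) pos_le_divide_eq) auto
      then have "I' \<le> 2 * pi * (M - v')" unfolding I'eq by (simp add: algebra_simps)
      then have "I \<le> ennreal (2 * pi * (M - v'))" unfolding I by (rule ennreal_leI)
      also have "\<dots> = ennreal (2 * pi) * e2ennreal (ereal M - v)"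
        using real v(2) by (simp add: ennreal_mult e2ennreal_ereal)
      finally show ?thesis unfolding I_def .
    next
      case MInf
      then show ?thesis by (simp add: e2ennreal_infty ennreal_mult_top)
    qed (use v in auto)
  qed
qed

text \<open>\<open>M - V\<close>, transported to the unit ball. Outside the ball it is set to 0, the least value, which keeps it
  lower semicontinuous.\<close>

definition deficit :: "nat \<Rightarrow> real \<Rightarrow> real \<Rightarrow> ((nat \<Rightarrow> complex) \<Rightarrow> ereal) \<Rightarrow> (nat \<Rightarrow> complex) \<Rightarrow> ennreal" where
  "deficit n R M V x = (if cnorm n x < 1 then e2ennreal (ereal M - V (\<lambda>i. of_real R * trunc n x i)) else 0)"

lemma cnorm_scale_real: "0 < R \<Longrightarrow> cnorm n (\<lambda>i. of_real R * x i) = R * cnorm n x"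
  using cnorm_scale[of n "of_real R" x] by simp

lemma scaled_in_ball:
  "0 < R \<Longrightarrow> cnorm n x < \<rho> \<Longrightarrow> (\<lambda>i. of_real R * trunc n x i) \<in> Cball0 n (\<rho> * R)"
  using Cn_scale[of "trunc n x" n "of_real R"] cnorm_scale_real[of R n "trunc n x"]
  by (simp add: Cball_def mult.commute)

lemma deficit_lsc:
  assumes R: "0 < R" and usc: "usc_on n (Cball0 n R) V" and c: "c < deficit n R M V a"
  shows "\<exists>d>0. \<forall>z. cdist n z a < d \<longrightarrow> c < deficit n R M V z"
proof -
  have a: "cnorm n a < 1" using c by (auto simp: deficit_def split: if_splits)
  let ?s = "\<lambda>x. (\<lambda>i. of_real R * trunc n x i)"
  have c': "c < e2ennreal (ereal M - V (?s a))" using c a by (simp add: deficit_def)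
  obtain k where k: "c = ennreal k" "0 \<le> k" using c' by (cases c) auto
  have iff: "ennreal k < e2ennreal (ereal M - y) \<longleftrightarrow> y < ereal (M - k)" for y
  proof (cases y)
    case (real u)
    then show ?thesis using k by (auto simp: e2ennreal_ereal ennreal_less_iff)
  qed (auto simp: e2ennreal_infty e2ennreal_neg)
  have "V (?s a) < ereal (M - k)" using c' k iff by simp
  moreover have "?s a \<in> Cball0 n R" using scaled_in_ball[OF R a] by simp
  ultimately obtain d where d: "0 < d" "\<And>z. z \<in> Cball0 n R \<Longrightarrow> cdist n z (?s a) < d \<Longrightarrow> V z < ereal (M - k)"
    using usc unfolding usc_on_def by blast
  define d' where "d' = min (d / R) (1 - cnorm n a)"
  have d': "0 < d'" "d' \<le> d / R" "d' \<le> 1 - cnorm n a" using d R a by (auto simp: d'_def)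
  have "c < deficit n R M V z" if z: "cdist n z a < d'" for z
  proof -
    have z1: "cnorm n z < 1" using cnorm_le_cdist[of n z a] z d' by linarith
    have "cdist n (?s z) (?s a) = R * cdist n z a"
    proof -
      have "cdist n (?s z) (?s a) = cnorm n (\<lambda>i. of_real R * (z i - a i))"
        by (rule cnorm_cong) (simp add: trunc_def algebra_simps)
      then show ?thesis using cnorm_scale_real[OF R, of n "\<lambda>i. z i - a i"] by simp
    qed
    also have "\<dots> < d"
    proof -
      have "cdist n z a < d / R" using z d' by linarith
      then show ?thesis using R by (simp add: pos_less_divide_eq mult.commute)
    qed
    finally have "V (?s z) < ereal (M - k)" using d(2) scaled_in_ball[OF R z1] by simp
    then show ?thesis using z1 k iff by (simp add: deficit_def)
  qed
  then show ?thesis using d' by blast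
qed

lemma superh_deficit:
  assumes R: "0 < R" and psh: "psh_on n (Cball0 n R) V" and M: "\<And>z. z \<in> Cball0 n R \<Longrightarrow> V z \<le> ereal M"
  shows "superh n (deficit n R M V)"
proof -
  have usc: "usc_on n (Cball0 n R) V" using psh by (simp add: psh_on_def)
  let ?W = "deficit n R M V"
  have op: "open {x. c < ?W x}" for c
  proof (subst open_subopen, safe)
    fix a assume "c < ?W a"
    from deficit_lsc[OF R usc this] obtain d where d: "0 < d" "\<And>z. cdist n z a < d \<Longrightarrow> c < ?W z" by blast
    have "open {z. cdist n z a < d}"
      by (intro open_Collect_less continuous_on_cnorm continuous_intros continuous_on_product_coordinates)
    then show "\<exists>T. open T \<and> a \<in> T \<and> T \<subseteq> {x. c < ?W x}" using d by (intro exI[of _ "{z. cdist n z a < d}"]) auto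
  qed
  have [measurable]: "?W \<in> borel_measurable borel"
    by (rule borel_measurableI_greater) (use op in simp)
  show ?thesis
    unfolding superh_def
  proof (intro conjI allI ballI impI)
    show "open {x. c < ?W x}" for c by (rule op)
    show "\<exists>d>0. \<forall>z\<in>Cn n. cdist n z a < d \<longrightarrow> c < ?W z" if "c < ?W a" for a c
      using deficit_lsc[OF R usc that] by blast
    fix a w assume aw: "a \<in> Cn n" "w \<in> Cn n" and disc: "\<forall>\<zeta>. cmod \<zeta> \<le> 1 \<longrightarrow> cnorm n (\<lambda>i. a i + \<zeta> * w i) < 1"
    let ?\<gamma> = "\<lambda>t. (\<lambda>i. a i + cis t * w i)"
    have [measurable]: "?\<gamma> \<in> borel_measurable lborel"
      by (intro borel_measurable_funI) (auto intro!: borel_measurable_continuous_onI continuous_intros)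
    define f where "f = (\<lambda>t. V (\<lambda>i. of_real R * a i + cis t * (of_real R * w i)))"
    have pt: "(\<lambda>i. of_real R * trunc n (\<lambda>i. a i + \<zeta> * w i) i) = (\<lambda>i. of_real R * a i + \<zeta> * (of_real R * w i))" for \<zeta>
      using aw by (auto simp: trunc_def Cn_def fun_eq_iff algebra_simps)
    have inb: "(\<lambda>i. of_real R * a i + \<zeta> * (of_real R * w i)) \<in> Cball0 n R" if "cmod \<zeta> \<le> 1" for \<zeta>
      using scaled_in_ball[OF R disc[rule_format, OF that]] unfolding pt by simp
    have Wf: "?W (?\<gamma> t) = e2ennreal (ereal M - f t)" for t
      using disc[rule_format, of "cis t"] unfolding deficit_def pt f_def by simp
    have fM: "f t \<le> ereal M" for t unfolding f_def using inb[of "cis t"] by (intro M) simp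
    have fW: "f t = ereal M - enn2ereal (?W (?\<gamma> t))" for t
    proof -
      have "0 \<le> ereal M - f t" using fM[of t] by (cases "f t") auto
      then have "enn2ereal (?W (?\<gamma> t)) = ereal M - f t" unfolding Wf by (rule enn2ereal_e2ennreal)
      then show ?thesis by (cases "f t") auto
    qed
    have mf: "f \<in> borel_measurable borel"
    proof -
      have "(\<lambda>t. ereal M - enn2ereal (?W (?\<gamma> t))) \<in> borel_measurable lborel" by measurable
      then show ?thesis by (simp add: fW[symmetric])
    qed
    have a1: "cnorm n a < 1" using disc[rule_format, of 0] by simp
    have Ra: "(\<lambda>i. of_real R * a i) \<in> Cball0 n R" using inb[of 0] by simp
    have "V (\<lambda>i. of_real R * a i) \<le> circle_mean f"
    proof -
      have sub: "\<forall>a\<in>Cn n. \<forall>w\<in>Cn n. (\<forall>\<zeta>. cmod \<zeta> \<le> 1 \<longrightarrow> (\<lambda>i. a i + \<zeta> * w i) \<in> Cball0 n R) \<longrightarrow>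
          V a \<le> circle_mean (\<lambda>t. V (\<lambda>i. a i + cis t * w i))"
        using psh by (simp add: psh_on_def)
      show ?thesis
        unfolding f_def by (rule sub[rule_format, OF Cn_scale[OF aw(1)] Cn_scale[OF aw(2)] inb])
    qed
    from circle_mean_le_bound[OF mf fM this M[OF Ra]]
    have "(\<integral>\<^sup>+t\<in>{0..2*pi}. ?W (?\<gamma> t) \<partial>lborel) \<le> ennreal (2 * pi) * e2ennreal (ereal M - V (\<lambda>i. of_real R * a i))"
      unfolding Wf .
    also have "e2ennreal (ereal M - V (\<lambda>i. of_real R * a i)) = ?W a"
      using a1 aw by (simp add: deficit_def)
    finally show "(\<integral>\<^sup>+t\<in>{0..2*pi}. ?W (?\<gamma> t) \<partial>lborel) \<le> ennreal (2 * pi) * ?W a" .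
  qed
qed

text \<open>When \<open>V\<close> is unbounded above on the whole ball, the lower bound to be proved is \<open>-\<infinity>\<close>, but only because the
  supremum over the smaller ball is finite.\<close>

lemma usc_bounded_above:
  assumes usc: "usc_on n (Cball0 n R) V" and fin: "\<And>z. z \<in> Cball0 n R \<Longrightarrow> V z < \<infinity>"
    and \<rho>: "0 < \<rho>" "\<rho> < R"
  shows "(SUP z\<in>Cball0 n \<rho>. V z) < \<infinity>"
proof -
  define K where "K = {x \<in> Cn n. cnorm n x \<le> \<rho>}"
  have KR: "x \<in> Cball0 n R" if "x \<in> K" for x using that \<rho> by (simp add: K_def Cball_def)
  have "compact K"
  proof -
    have "compact (\<Pi>\<^sub>E i\<in>(UNIV::nat set). cball (0::complex) \<rho>)"
    proof -
      have "compactin (product_topology (\<lambda>_::nat. euclidean) UNIV) (\<Pi>\<^sub>E i\<in>(UNIV::nat set). cball (0::complex) \<rho>)"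
        by (subst compactin_PiE) auto
      then show ?thesis by (simp add: euclidean_product_topology)
    qed
    moreover have "closed K"
    proof -
      have "K = (\<Inter>i\<in>{n..}. {x. x i = 0}) \<inter> {x. cnorm n x \<le> \<rho>}" by (auto simp: K_def Cn_def)
      also have "closed \<dots>"
        by (intro closed_Int closed_INT ballI closed_Collect_eq closed_Collect_le continuous_on_cnorm
            continuous_on_product_coordinates continuous_on_const)
      finally show ?thesis .
    qed
    moreover have "K \<subseteq> (\<Pi>\<^sub>E i\<in>(UNIV::nat set). cball 0 \<rho>)"
    proof
      fix x assume x: "x \<in> K"
      have "cmod (x i) \<le> \<rho>" for i
      proof (cases "i < n")
        case True
        then show ?thesis using cmod_le_cnorm[OF True, of x] x by (simp add: K_def)
      qed (use x \<rho> in \<open>simp add: K_def Cn_def\<close>)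
      then show "x \<in> (\<Pi>\<^sub>E i\<in>(UNIV::nat set). cball 0 \<rho>)" by (simp add: PiE_iff)
    qed
    ultimately show ?thesis using compact_Int_closed[of "\<Pi>\<^sub>E i\<in>(UNIV::nat set). cball (0::complex) \<rho>" K] by (simp add: Int_absorb1)
  qed
  moreover have "K \<noteq> {}" using \<rho> by (auto simp: K_def intro!: exI[of _ "\<lambda>_. 0"])
  moreover have "\<exists>U. open U \<and> {x \<in> K. c < - V x} = U \<inter> K" for c
  proof -
    have "openin (top_of_set K) {x \<in> K. c < - V x}"
    proof (subst openin_subopen, safe)
      fix a assume a: "a \<in> K" "c < - V a"
      then have "V a < - c" by (simp add: ereal_less_uminus_reorder)
      then obtain d where d: "0 < d" "\<And>z. z \<in> Cball0 n R \<Longrightarrow> cdist n z a < d \<Longrightarrow> V z < - c"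
        using usc KR[OF a(1)] unfolding usc_on_def by blast
      have "open {z. cdist n z a < d}"
        by (intro open_Collect_less continuous_on_cnorm continuous_intros continuous_on_product_coordinates)
      then have "openin (top_of_set K) (K \<inter> {z. cdist n z a < d})" by (rule openin_open_Int)
      moreover have "K \<inter> {z. cdist n z a < d} \<subseteq> {x \<in> K. c < - V x}"
        using d(2) KR by (auto simp: ereal_less_uminus_reorder)
      moreover have "a \<in> K \<inter> {z. cdist n z a < d}" using a d by simp
      ultimately show "\<exists>T. openin (top_of_set K) T \<and> a \<in> T \<and> T \<subseteq> {x \<in> K. c < - V x}" by blast
    qed
    then show ?thesis unfolding openin_open by auto
  qed
  ultimately obtain p where p: "p \<in> K" "\<And>y. y \<in> K \<Longrightarrow> - V p \<le> - V y" by (rule lsc_attains_min) blast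
  have "(SUP z\<in>Cball0 n \<rho>. V z) \<le> V p"
    using p(2) by (intro SUP_least) (simp add: K_def Cball_def)
  also have "\<dots> < \<infinity>" by (rule fin[OF KR[OF p(1)]])
  finally show ?thesis .
qed

text \<open>The constant of the theorem is 1, which explains \<open>\<eta> / 1\<close>. With \<open>m\<close> the difference of the two suprema, the
  estimate for superharmonic functions is applied to \<open>(M - V) / m'\<close>, where \<open>m'\<close> is slightly larger than \<open>m\<close> because the supremum
  over the smaller ball need not be attained. Taking \<open>m' \<nu>' = m \<nu>\<close> with \<open>\<nu>'\<close> between \<open>nu \<sigma> \<tau>\<close> and \<open>\<nu>\<close> pays for it.\<close>

lemma psh_lower_bound_outside_balls:
  fixes \<sigma> \<tau> \<nu> :: real
  assumes st: "0 < \<sigma>" "\<sigma> < 1" "0 < \<tau>" "\<tau> < 1" and \<nu>: "nu \<sigma> \<tau> < \<nu>" and n: "1 \<le> (n::nat)"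
  shows "\<exists>\<eta>\<^sub>0::real. 0 < \<eta>\<^sub>0 \<and> \<eta>\<^sub>0 < 1 \<and>
      (\<forall>(R::real) (V :: (nat \<Rightarrow> complex) \<Rightarrow> ereal) (\<alpha>::real) (\<eta>::real).
        R > 0 \<longrightarrow> psh_on n (Cball0 n R) V \<longrightarrow> 0 < \<alpha> \<longrightarrow> \<alpha> \<le> 2 \<longrightarrow> 0 < \<eta> \<longrightarrow> \<eta> < \<eta>\<^sub>0 \<longrightarrow>
        (\<exists>(J :: nat set) (c :: nat \<Rightarrow> nat \<Rightarrow> complex) (r :: nat \<Rightarrow> real).
          (\<forall>j\<in>J. c j \<in> Cn n \<and> 0 < r j \<and> r j \<le> \<eta> * R) \<and>
          (\<lambda>j. r j powr (2 * real n - 2 + \<alpha>)) summable_on J \<and>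
          (\<Sum>\<^sub>\<infinity>j\<in>J. r j powr (2 * real n - 2 + \<alpha>))
            < 9 ^ (n - 1) * (R * exp 1) powr (2 * real n - 2 + \<alpha>) * \<eta> powr \<alpha> / \<alpha> \<and>
          (\<forall>z \<in> Cball0 n (\<tau> * R) - (\<Union>j\<in>J. Cball n (c j) (r j)).
            V z \<ge> (SUP w\<in>Cball0 n (\<sigma> * R). V w)
              + ereal (\<nu> * ln (\<eta> / 1))
                * ((SUP w\<in>Cball0 n R. V w) - (SUP w\<in>Cball0 n (\<sigma> * R). V w)))))"
    (is "\<exists>\<eta>\<^sub>0. 0 < \<eta>\<^sub>0 \<and> \<eta>\<^sub>0 < 1 \<and> (\<forall>R V \<alpha> \<eta>. R > 0 \<longrightarrow> _ \<longrightarrow> _ \<longrightarrow> _ \<longrightarrow> _ \<longrightarrow> _ \<longrightarrow> ?concl R V \<alpha> \<eta>)")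
proof -
  define \<nu>' where "\<nu>' = (nu \<sigma> \<tau> + \<nu>) / 2"
  have \<nu>': "0 < \<nu>'" "nu \<sigma> \<tau> < \<nu>'" "\<nu>' < \<nu>" using nu_pos[OF st] \<nu> by (auto simp: \<nu>'_def)
  show ?thesis
  proof (rule superh_upper_bound_outside_balls[OF st \<nu>'(2) n])
    fix \<eta>\<^sub>0 :: real
    assume \<eta>0: "0 < \<eta>\<^sub>0" "\<eta>\<^sub>0 < 1" and main:
      "\<And>W z0 \<alpha> \<eta>. superh n W \<Longrightarrow> z0 \<in> Cn n \<Longrightarrow> cnorm n z0 \<le> \<sigma> \<Longrightarrow> W z0 \<le> 1 \<Longrightarrow>
        0 < \<alpha> \<Longrightarrow> \<alpha> \<le> 2 \<Longrightarrow> 0 < \<eta> \<Longrightarrow> \<eta> < \<eta>\<^sub>0 \<Longrightarrow>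
        \<exists>C r. thin_balls n \<alpha> \<eta> C r \<and>
          (\<forall>z\<in>Cn n. cnorm n z \<le> \<tau> \<longrightarrow> (\<forall>c\<in>C. r c \<le> cdist n z c) \<longrightarrow> W z \<le> ennreal (\<nu>' * ln (1 / \<eta>)))"
    have core: "?concl R V \<alpha> \<eta>"
      if R: "0 < R" and psh: "psh_on n (Cball0 n R) V" and \<alpha>: "0 < \<alpha>" "\<alpha> \<le> 2" and \<eta>: "0 < \<eta>" "\<eta> < \<eta>\<^sub>0"
      for R \<alpha> \<eta> :: real and V :: "(nat \<Rightarrow> complex) \<Rightarrow> ereal"
    proof -
      define e where "e = 2 * real n - 2 + \<alpha>"
      define SR where "SR = (SUP w\<in>Cball0 n R. V w)"
      define S\<sigma> where "S\<sigma> = (SUP w\<in>Cball0 n (\<sigma> * R). V w)"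
      define k where "k = \<nu> * ln \<eta>"
      have "ln \<eta> < 0" using \<eta> \<eta>0 by simp
      then have k: "k < 0" using \<nu>' by (simp add: k_def mult_pos_neg)
      have kl: "\<nu> * ln (1 / \<eta>) = - k" using \<eta> by (simp add: k_def ln_div)
      have pos: "0 < 9 ^ (n - 1) * (R * exp 1) powr e * \<eta> powr \<alpha> / \<alpha>" using R \<alpha> \<eta> by simp
      \<comment> \<open>No ball is needed when the lower bound holds everywhere.\<close>
      have none: "?concl R V \<alpha> \<eta>" if "\<And>z. z \<in> Cball0 n (\<tau> * R) \<Longrightarrow> S\<sigma> + ereal k * (SR - S\<sigma>) \<le> V z"
        by (rule exI[of _ "{}"]) (use that pos in \<open>simp add: S\<sigma>_def SR_def k_def e_def\<close>)
      have usc: "usc_on n (Cball0 n R) V" and Vfin: "\<And>z. z \<in> Cball0 n R \<Longrightarrow> V z < \<infinity>"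
        using psh by (auto simp: psh_on_def)
      have "\<sigma> * R < R" using R st by simp
      then have S\<sigma>top: "S\<sigma> < \<infinity>"
        unfolding S\<sigma>_def using R st by (intro usc_bounded_above[OF usc Vfin]) auto
      have SRbot: "SR \<noteq> - \<infinity>"
      proof -
        obtain z where "z \<in> Cball0 n R" "V z \<noteq> - \<infinity>" using psh by (auto simp: psh_on_def)
        moreover have "V z \<le> SR" unfolding SR_def by (rule SUP_upper) fact
        ultimately show ?thesis by auto
      qed
      show ?thesis
      proof (cases "S\<sigma> = - \<infinity> \<or> SR = \<infinity>")
        case True
        have eq: "S\<sigma> + ereal k * (SR - S\<sigma>) = - \<infinity>"
          using True S\<sigma>top SRbot k by (cases S\<sigma>; cases SR) auto
        show ?thesis by (rule none, subst eq) simp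
      next
        case False
        then obtain M m0 where M: "SR = ereal M" and m0: "S\<sigma> = ereal m0"
          using S\<sigma>top SRbot by (cases SR; cases S\<sigma>) auto
        have VM: "V z \<le> ereal M" if "z \<in> Cball0 n R" for z
          unfolding M[symmetric] SR_def by (rule SUP_upper) fact
        define m where "m = M - m0"
        define W where "W = deficit n R M V"
        have W: "superh n W" unfolding W_def by (rule superh_deficit[OF R psh VM])
        have "Cball0 n (\<sigma> * R) \<subseteq> Cball0 n R" using \<open>\<sigma> * R < R\<close> by (auto simp: Cball_def)
        then have "S\<sigma> \<le> SR" unfolding S\<sigma>_def SR_def by (intro SUP_subset_mono) auto
        then have m: "0 \<le> m" by (simp add: M m0 m_def)
        define sc where "sc = (\<lambda>z::nat \<Rightarrow> complex. \<lambda>i. z i / of_real R)"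
        have scC: "sc z \<in> Cn n" if "z \<in> Cn n" for z using that by (auto simp: sc_def Cn_def)
        have scinv: "(\<lambda>i. of_real R * trunc n (sc z) i) = z" if "z \<in> Cn n" for z
          using R scC[OF that] by (auto simp: sc_def)
        have cnsc: "cnorm n (sc z) = cnorm n z / R" for z
        proof -
          have "sc z = (\<lambda>i. of_real (1 / R) * z i)" by (auto simp: sc_def)
          then show ?thesis using cnorm_scale_real[of "1 / R" n z] R by simp
        qed
        have Wsc: "W (sc z) = e2ennreal (ereal M - V z)" if "z \<in> Cball0 n R" for z
        proof -
          have "z \<in> Cn n" "cnorm n z < R" using that by (auto simp: Cball_def)
          then show ?thesis using scinv[of z] cnsc[of z] R by (simp add: W_def deficit_def)
        qed
        have tauR: "z \<in> Cn n" "cnorm n (sc z) \<le> \<tau>" "z \<in> Cball0 n R" if "z \<in> Cball0 n (\<tau> * R)" for z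
        proof -
          have z: "z \<in> Cn n" "cnorm n z < \<tau> * R" using that by (auto simp: Cball_def)
          have "\<tau> * R < R" using R st by simp
          with z(2) have "cnorm n z < R" by linarith
          with z show "z \<in> Cn n" "cnorm n (sc z) \<le> \<tau>" "z \<in> Cball0 n R"
            using R unfolding cnsc by (auto simp: Cball_def divide_le_eq)
        qed
        have V_ge: "ereal (M - L) \<le> V z" if "z \<in> Cball0 n R" "W (sc z) \<le> ennreal L" "0 \<le> L" for z L
        proof (cases "V z")
          case (real v)
          then have "ennreal (M - v) \<le> ennreal L" using that Wsc[OF that(1)] by simp
          then show ?thesis using real that(3) by (simp add: ennreal_le_iff)
        next
          case MInf
          then show ?thesis using that Wsc[OF that(1)] by (simp add: top_unique)
        qed simp
        have near: "\<exists>z0\<in>Cn n. cnorm n z0 \<le> \<sigma> \<and> W z0 \<le> ennreal (m + \<delta>)" if \<delta>: "0 < \<delta>" for \<delta>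
        proof -
          have "ereal (m0 - \<delta>) < S\<sigma>" using \<delta> by (simp add: m0)
          then obtain z where z: "z \<in> Cball0 n (\<sigma> * R)" "ereal (m0 - \<delta>) < V z"
            unfolding S\<sigma>_def less_SUP_iff by blast
          then have zR: "z \<in> Cball0 n R" using \<open>Cball0 n (\<sigma> * R) \<subseteq> Cball0 n R\<close> by blast
          have "W (sc z) \<le> e2ennreal (ereal (m + \<delta>))"
            unfolding Wsc[OF zR] using z(2) VM[OF zR]
            by (intro e2ennreal_mono) (cases "V z"; simp add: m_def)
          moreover have "sc z \<in> Cn n" "cnorm n (sc z) \<le> \<sigma>"
            using z R scC unfolding cnsc by (auto simp: Cball_def divide_le_eq)
          ultimately show ?thesis by auto
        qed
        show ?thesis
        proof (cases "m = 0")
          case True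
          show ?thesis
          proof (rule none)
            fix z assume z: "z \<in> Cball0 n (\<tau> * R)"
            have "W (sc z) = 0"
              using near True tauR[OF z] scC by (intro superh_eq_0[OF W _ _ st]) auto
            then have "ereal M \<le> V z" using V_ge[of z 0] tauR[OF z] by simp
            then show "S\<sigma> + ereal k * (SR - S\<sigma>) \<le> V z" using True by (simp add: M m0 m_def)
          qed
        next
          case False
          then have m: "0 < m" using m by simp
          define m' where "m' = m * (\<nu> / \<nu>')"
          have m': "m < m'" "0 < m'" "m' * \<nu>' = m * \<nu>" using m \<nu>' by (auto simp: m'_def field_simps)
          obtain z0 where z0: "z0 \<in> Cn n" "cnorm n z0 \<le> \<sigma>" "W z0 \<le> ennreal m'"
            using near[of "m' - m"] m' by auto
          define W' where "W' = (\<lambda>x. ennreal (1 / m') * W x)"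
          have W': "superh n W'" unfolding W'_def using m' by (intro superh_scale[OF W]) simp
          have "W' z0 \<le> ennreal (1 / m') * ennreal m'" unfolding W'_def by (intro mult_left_mono z0) simp
          then have W'z0: "W' z0 \<le> 1" using m' by (simp add: ennreal_mult[symmetric])
          obtain C r where C: "C \<subseteq> Cn n" "countable C" "\<And>c. c \<in> C \<Longrightarrow> 0 < r c \<and> r c \<le> \<eta>"
            "(\<lambda>c. r c powr e) summable_on C"
            "(\<Sum>\<^sub>\<infinity>c\<in>C. r c powr e) < 9 ^ (n - 1) * exp 1 powr e * \<eta> powr \<alpha> / \<alpha>"
            and Wle: "\<And>z. z \<in> Cn n \<Longrightarrow> cnorm n z \<le> \<tau> \<Longrightarrow> (\<forall>c\<in>C. r c \<le> cdist n z c) \<Longrightarrow> W' z \<le> ennreal (\<nu>' * ln (1 / \<eta>))"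
            using main[OF W' z0(1,2) W'z0 \<alpha> \<eta>] unfolding thin_balls_def e_def[symmetric] by blast
          define h where "h = from_nat_into C"
          define J where "J = to_nat_on C ` C"
          have bij: "bij_betw h J C"
            unfolding h_def J_def using C(2)
            by (intro bij_betwI[of _ _ _ "to_nat_on C"]) auto
          have hC: "h j \<in> C" if "j \<in> J" for j using bij_betwE[OF bij] that by blast
          define c where "c = (\<lambda>j i. of_real R * h j i)"
          define \<rho> where "\<rho> = (\<lambda>j. R * r (h j))"
          have pw: "\<rho> j powr e = R powr e * r (h j) powr e" if "j \<in> J" for j
            using C(3)[OF hC[OF that]] R unfolding \<rho>_def by (simp add: powr_mult)
          have s1: "(\<lambda>j. r (h j) powr e) summable_on J"
            using summable_on_reindex_bij_betw[OF bij, of "\<lambda>c. r c powr e"] C(4) by simp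
          have s2: "(\<lambda>j. \<rho> j powr e) summable_on J"
            using summable_on_cmult_right[OF s1, of "R powr e"] by (simp add: pw cong: summable_on_cong)
          have s3: "(\<Sum>\<^sub>\<infinity>j\<in>J. \<rho> j powr e) < 9 ^ (n - 1) * (R * exp 1) powr e * \<eta> powr \<alpha> / \<alpha>"
          proof -
            have "(\<Sum>\<^sub>\<infinity>j\<in>J. \<rho> j powr e) = (\<Sum>\<^sub>\<infinity>j\<in>J. R powr e * r (h j) powr e)"
              by (rule infsum_cong) (rule pw)
            also have "\<dots> = R powr e * (\<Sum>\<^sub>\<infinity>j\<in>J. r (h j) powr e)" by (rule infsum_cmult_right) (rule s1)
            also have "(\<Sum>\<^sub>\<infinity>j\<in>J. r (h j) powr e) = (\<Sum>\<^sub>\<infinity>c\<in>C. r c powr e)"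
              by (rule infsum_reindex_bij_betw[OF bij])
            also have "R powr e * \<dots> < R powr e * (9 ^ (n - 1) * exp 1 powr e * \<eta> powr \<alpha> / \<alpha>)"
              using R by (intro mult_strict_left_mono C(5)) simp
            also have "\<dots> = 9 ^ (n - 1) * (R * exp 1) powr e * \<eta> powr \<alpha> / \<alpha>"
              using R by (simp add: powr_mult)
            finally show ?thesis .
          qed
          have est: "S\<sigma> + ereal k * (SR - S\<sigma>) \<le> V z"
            if z: "z \<in> Cball0 n (\<tau> * R)" and out: "z \<notin> (\<Union>j\<in>J. Cball n (c j) (\<rho> j))" for z
          proof -
            have far: "r x \<le> cdist n (sc z) x" if "x \<in> C" for x
            proof -
              obtain j where j: "j \<in> J" "h j = x" using bij \<open>x \<in> C\<close> unfolding bij_betw_def by blast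
              have "\<rho> j \<le> cdist n z (c j)" using out j(1) tauR(1)[OF z] by (force simp: Cball_def)
              moreover have "cdist n z (c j) = R * cdist n (sc z) x"
              proof -
                have "(\<lambda>i. z i - c j i) = (\<lambda>i. of_real R * (sc z i - x i))"
                  using R j by (auto simp: c_def sc_def algebra_simps)
                then show ?thesis using cnorm_scale_real[OF R, of n "\<lambda>i. sc z i - x i"] by simp
              qed
              ultimately show ?thesis using R j by (simp add: \<rho>_def)
            qed
            have "W' (sc z) \<le> ennreal (\<nu>' * ln (1 / \<eta>))"
              using tauR[OF z] far scC by (intro Wle) auto
            then have "ennreal m' * W' (sc z) \<le> ennreal m' * ennreal (\<nu>' * ln (1 / \<eta>))" by (intro mult_left_mono) auto
            also have "ennreal m' * W' (sc z) = W (sc z)"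
              using m' by (simp add: W'_def mult.assoc[symmetric] ennreal_mult[symmetric])
            also have "ennreal m' * ennreal (\<nu>' * ln (1 / \<eta>)) = ennreal (m * - k)"
            proof -
              have "m' * (\<nu>' * ln (1 / \<eta>)) = m * - k" using m'(3) unfolding kl[symmetric] by (simp add: mult.assoc[symmetric])
              then show ?thesis using m' by (subst ennreal_mult'[symmetric]) auto
            qed
            finally have "ereal (M - m * - k) \<le> V z"
              using m k by (intro V_ge tauR[OF z]) (auto simp: mult_nonneg_nonpos)
            moreover have "S\<sigma> + ereal k * (SR - S\<sigma>) \<le> ereal (M - m * - k)"
              using m by (simp add: M m0 m_def algebra_simps)
            ultimately show ?thesis by (rule order_trans[rotated])
          qed
          show ?thesis
          proof (intro exI[of _ J] exI[of _ c] exI[of _ \<rho>] conjI)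
            show "\<forall>j\<in>J. c j \<in> Cn n \<and> 0 < \<rho> j \<and> \<rho> j \<le> \<eta> * R"
            proof
              fix j assume j: "j \<in> J"
              then have "h j \<in> Cn n" using C(1) hC by blast
              moreover have "0 < r (h j) \<and> r (h j) \<le> \<eta>" by (rule C(3)[OF hC[OF j]])
              ultimately show "c j \<in> Cn n \<and> 0 < \<rho> j \<and> \<rho> j \<le> \<eta> * R"
                using R by (simp add: c_def \<rho>_def Cn_scale mult.commute)
            qed
          qed (use s2 s3 est in \<open>auto simp: e_def S\<sigma>_def SR_def k_def\<close>)
        qed
      qed
    qed
    show ?thesis
      by (intro exI[of _ \<eta>\<^sub>0] conjI allI impI, rule \<eta>0(1), rule \<eta>0(2)) (rule core; assumption)
  qed
qed

theorem theorem6p3: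
  fixes \<sigma> \<tau> \<nu> :: real
  assumes "0 < \<sigma>" and "\<sigma> < 1" and "0 < \<tau>" and "\<tau> < 1"
    and "\<nu> > nu \<sigma> \<tau>"
  shows "\<exists>C::real. C > 0 \<and> (\<forall>n::nat. n \<ge> 1 \<longrightarrow>
    (\<exists>\<eta>\<^sub>0::real. 0 < \<eta>\<^sub>0 \<and> \<eta>\<^sub>0 < 1 \<and>
      (\<forall>(R::real) (V :: (nat \<Rightarrow> complex) \<Rightarrow> ereal) (\<alpha>::real) (\<eta>::real).
        R > 0 \<longrightarrow> psh_on n (Cball0 n R) V \<longrightarrow> 0 < \<alpha> \<longrightarrow> \<alpha> \<le> 2 \<longrightarrow> 0 < \<eta> \<longrightarrow> \<eta> < \<eta>\<^sub>0 \<longrightarrow>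
        (\<exists>(J :: nat set) (c :: nat \<Rightarrow> nat \<Rightarrow> complex) (r :: nat \<Rightarrow> real).
          (\<forall>j\<in>J. c j \<in> Cn n \<and> 0 < r j \<and> r j \<le> \<eta> * R) \<and>
          (\<lambda>j. r j powr (2 * real n - 2 + \<alpha>)) summable_on J \<and>
          (\<Sum>\<^sub>\<infinity>j\<in>J. r j powr (2 * real n - 2 + \<alpha>))
            < 9 ^ (n - 1) * (R * exp 1) powr (2 * real n - 2 + \<alpha>) * \<eta> powr \<alpha> / \<alpha> \<and>
          (\<forall>z \<in> Cball0 n (\<tau> * R) - (\<Union>j\<in>J. Cball n (c j) (r j)).
            V z \<ge> (SUP w\<in>Cball0 n (\<sigma> * R). V w)
              + ereal (\<nu> * ln (\<eta> / C))
                * ((SUP w\<in>Cball0 n R. V w) - (SUP w\<in>Cball0 n (\<sigma> * R). V w)))))))"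
  by (rule exI[of _ 1], rule conjI, rule zero_less_one, rule allI, rule impI,
      rule psh_lower_bound_outside_balls[OF assms])

end
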